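(* Every weak solution $(\mathbf{u},\xi,\eta,p,q)$ of the reformulated poroelasticity problem (in the sense defined in the context) satisfies the following relations: $$C_\eta(t):=(\eta(\cdot,t),1)=(\eta_0,1)+\bigl[(\phi,1)+\langle\phi_1,1\rangle\bigr]t,\qquad t\ge0,$$ $$C_\xi(t):=(\xi(\cdot,t),1)=\frac{1}{d+\mu\kappa_3}\bigl[\mu\kappa_1C_\eta(t)-(\mathbf{f},x)-\langle\mathbf{f}_1,x\rangle\bigr],$$ $$C_q(t):=(q(\cdot,t),1)=\kappa_1C_\eta(t)-\kappa_3C_\xi(t),$$ $$C_p(t):=(p(\cdot,t),1)=\kappa_1C_\xi(t)+\kappa_2C_\eta(t),$$ $$C_{\mathbf{u}}(t):=\langle\mathbf{u}(\cdot,t)\cdot\mathbf{n},1\rangle=C_q(t).$$ Here $x$ denotes the position vector field $x\mapsto x$ on $\overline\Omega$ and $\mathbf{n}$ the unit outward normal to $\partial\Omega$.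
   Context: Setting. $\Omega\subset\mathbb{R}^d$ ($d=1,2,3$) is a bounded polygonal domain such that $\Delta:H^1_0(\Omega)\cap H^2(\Omega)\to L^2(\Omega)$ is an isomorphism; $T>0$. $(\cdot,\cdot)$ and $\langle\cdot,\cdot\rangle$ are the $L^2(\Omega)$ and $L^2(\partial\Omega)$ inner products; bold spaces are $d$-vector-valued. $H^{-1}(\Omega)$ is the dual of $H^1_0(\Omega)$, and $(\cdot,\cdot)_{\rm dual}$ is the duality pairing of $(H^1(\Omega))'$ with $H^1(\Omega)$. $\varepsilon(\mathbf{u})=\frac12(\nabla\mathbf{u}+\nabla\mathbf{u}^T)$. $\mathbf{RM}=\{\mathbf{a}+\mathbf{b}\times x:\ \mathbf{a},\mathbf{b}\in\mathbb{R}^d\}$ is the space of infinitesimal rigid motions (the kernel of $\varepsilon$), and $\mathbf{H}^1_\perp(\Omega)=\{\mathbf{v}\in\mathbf{H}^1(\Omega):(\mathbf{v},\mathbf{r})=0\ \forall\mathbf{r}\in\mathbf{RM}\}$. Parameters. Lamé constants $\lambda,\mu>0$; Biot–Willis constant $\alpha>0$; constrained specific storage coefficient $c_0\ge0$; solvent viscosity $\mu_f>0$; (symmetric positive definite) permeability tensor $K$; $\rho_f\not\equiv0$ and $\mathbf{g}$ are the given density and gravity. Put $$\kappa_1=\frac{\alpha}{\alpha^2+\lambda c_0},\quad\kappa_2=\frac{\lambda}{\alpha^2+\lambda c_0},\quad\kappa_3=\frac{c_0}{\alpha^2+\lambda c_0}.$$ Data. $\mathbf{f}\in\mathbf{L}^2(\Omega)$,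 $\mathbf{f}_1\in\mathbf{L}^2(\partial\Omega)$, $\phi\in L^2(\Omega)$, $\phi_1\in L^2(\partial\Omega)$, all independent of $t$, $\mathbf{u}_0\in\mathbf{H}^1(\Omega)$, $p_0\in L^2(\Omega)$, with $(\mathbf{f},\mathbf{v})+\langle\mathbf{f}_1,\mathbf{v}\rangle=0$ for all $\mathbf{v}\in\mathbf{RM}$. Weak solution. A 5-tuple $(\mathbf{u},\xi,\eta,p,q)$ with $\mathbf{u}\in L^\infty(0,T;\mathbf{H}^1_\perp(\Omega))$, $\xi\in L^2(0,T;L^2(\Omega))$, $\eta\in L^\infty(0,T;L^2(\Omega))\cap H^1(0,T;H^{-1}(\Omega))$, $q\in L^\infty(0,T;L^2(\Omega))$, $p\in L^2(0,T;H^1(\Omega))$ is a weak solution if for almost every $t\in[0,T]$ $$\mu(\varepsilon(\mathbf{u}),\varepsilon(\mathbf{v}))-(\xi,\operatorname{div}\mathbf{v})=(\mathbf{f},\mathbf{v})+\langle\mathbf{f}_1,\mathbf{v}\rangle\quad\forall\mathbf{v}\in\mathbf{H}^1(\Omega),$$ $$\kappa_3(\xi,\varphi)+(\operatorname{div}\mathbf{u},\varphi)=\kappa_1(\eta,\varphi)\quad\forall\varphi\in L^2(\Omega),$$ $$(\eta_t,\psi)_{\rm dual}+\frac1{\mu_f}\bigl(K(\nabla(\kappa_1\xi+\kappa_2\eta)-\rho_f\mathbf{g}),\nabla\psi\bigr)=(\phi,\psi)+\langle\phi_1,\psi\rangle\quad\forall\psi\in H^1(\Omega),$$ $$p=\kappa_1\xi+\kappa_2\eta,\qquad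 q=\kappa_1\eta-\kappa_3\xi,$$ and $\mathbf{u}(0)=\mathbf{u}_0$, $p(0)=p_0$, $q(0)=q_0:=\operatorname{div}\mathbf{u}_0$, $\eta(0)=\eta_0:=c_0p_0+\alpha q_0$. (The third identity includes that $\eta_t$ acts on $H^1(\Omega)$.) The relations are understood for times $t\in[0,T]$ at which the solution is defined. *)

theory Defs
  imports "HOL-Analysis.Analysis"
begin

section \<open>Polygonal domains, outward normal, surface measure\<close>

text \<open>Polygons and polyhedra are finite unions of convex polytopes. Taking the interior of the
  union makes \<open>\<Omega>\<close> lie on one side of each facet (no slits), so that the outward normal exists.\<close>

definition polygonal_domain :: "'a::euclidean_space set \<Rightarrow> bool" where
  "polygonal_domain \<Omega> \<longleftrightarrow> \<Omega> \<noteq> {} \<and> connected \<Omega> \<and> open \<Omega> \<and> bounded \<Omega> \<and>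
     (\<exists>\<P>. finite \<P> \<and> (\<forall>P\<in>\<P>. polytope P) \<and> \<Omega> = interior (\<Union>\<P>))"

definition is_outward_normal :: "'a::euclidean_space set \<Rightarrow> 'a \<Rightarrow> 'a \<Rightarrow> bool" where
  "is_outward_normal \<Omega> x \<nu> \<longleftrightarrow>
     norm \<nu> = 1 \<and> (\<exists>r>0. \<forall>y\<in>ball x r. y \<in> \<Omega> \<longleftrightarrow> (y - x) \<bullet> \<nu> < 0)"

definition outward_normal :: "'a::euclidean_space set \<Rightarrow> 'a \<Rightarrow> 'a" where
  "outward_normal \<Omega> x = (THE \<nu>. is_outward_normal \<Omega> x \<nu>)"

text \<open>\<open>facet \<Omega> (\<nu>, c)\<close> is the flat part of the boundary in the hyperplane \<open>x \<bullet> \<nu> = c\<close> with outward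
  normal \<open>\<nu>\<close>. What the facets leave out of the boundary has dimension at most \<open>d - 2\<close>.\<close>

definition facet :: "'a::euclidean_space set \<Rightarrow> 'a \<times> real \<Rightarrow> 'a set" where
  "facet \<Omega> P = {x \<in> frontier \<Omega>. is_outward_normal \<Omega> x (fst P) \<and> x \<bullet> fst P = snd P}"

text \<open>The \<open>(d - 1)\<close>-dimensional Lebesgue measure on the hyperplane \<open>x \<bullet> \<nu> = c\<close> (\<open>\<nu>\<close> a unit vector):
  the measure of \<open>A\<close> is the volume of the right cylinder of height 1 over \<open>A\<close>.
  For \<open>d = 1\<close> this is the unit point mass.\<close>

definition hyperplane_measure :: "'a::euclidean_space \<times> real \<Rightarrow> 'a measure" where
  "hyperplane_measure = (\<lambda>(\<nu>, c).
     distr (restrict_space lborel {y. c \<le> y \<bullet> \<nu> \<and> y \<bullet> \<nu> \<le> c + 1}) borel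
       (\<lambda>y. y - (y \<bullet> \<nu> - c) *\<^sub>R \<nu>))"

definition surface_measure :: "'a::euclidean_space set \<Rightarrow> 'a measure" where
  "surface_measure \<Omega> = measure_of UNIV (sets borel)
     (\<lambda>A. \<Sum>P | facet \<Omega> P \<noteq> {}. emeasure (hyperplane_measure P) (A \<inter> facet \<Omega> P))"


section \<open>Lebesgue and Sobolev spaces\<close>

text \<open>Elements are functions, not classes; equality in the space is equality almost everywhere.\<close>

definition L2 :: "'a measure \<Rightarrow> ('a \<Rightarrow> 'b::euclidean_space) set" where
  "L2 M = {f \<in> borel_measurable M. integrable M (\<lambda>x. (norm (f x))\<^sup>2)}"

definition L2_inner :: "'a measure \<Rightarrow> ('a \<Rightarrow> 'b::euclidean_space) \<Rightarrow> ('a \<Rightarrow> 'b) \<Rightarrow> real" where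
  "L2_inner M f g = (\<integral>x. f x \<bullet> g x \<partial>M)"

definition L2_norm :: "'a measure \<Rightarrow> ('a \<Rightarrow> 'b::euclidean_space) \<Rightarrow> real" where
  "L2_norm M f = sqrt (\<integral>x. (norm (f x))\<^sup>2 \<partial>M)"

primrec Ck :: "nat \<Rightarrow> ('a::euclidean_space \<Rightarrow> 'b::euclidean_space) \<Rightarrow> bool" where
  "Ck 0 f \<longleftrightarrow> continuous_on UNIV f"
| "Ck (Suc k) f \<longleftrightarrow> f differentiable_on UNIV \<and>
     (\<forall>b\<in>Basis. Ck k (\<lambda>x. frechet_derivative f (at x) b))"

definition smooth :: "('a::euclidean_space \<Rightarrow> 'b::euclidean_space) \<Rightarrow> bool" where
  "smooth f \<longleftrightarrow> (\<forall>k. Ck k f)"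

definition test_function :: "'a::euclidean_space set \<Rightarrow> ('a \<Rightarrow> real) \<Rightarrow> bool" where
  "test_function S \<phi> \<longleftrightarrow>
     smooth \<phi> \<and> compact (closure {x. \<phi> x \<noteq> 0}) \<and> closure {x. \<phi> x \<noteq> 0} \<subseteq> S"

definition is_weak_partial ::
  "(real^'n) set \<Rightarrow> 'n \<Rightarrow> (real^'n \<Rightarrow> 'b::euclidean_space) \<Rightarrow> (real^'n \<Rightarrow> 'b) \<Rightarrow> bool" where
  "is_weak_partial \<Omega> i v g \<longleftrightarrow> (\<forall>\<phi>. test_function \<Omega> \<phi> \<longrightarrow>
     (\<integral>x. frechet_derivative \<phi> (at x) (axis i 1) *\<^sub>R v x \<partial>lebesgue_on \<Omega>)
       = - (\<integral>x. \<phi> x *\<^sub>R g x \<partial>lebesgue_on \<Omega>))"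

definition wpartial ::
  "(real^'n) set \<Rightarrow> 'n \<Rightarrow> (real^'n \<Rightarrow> 'b::euclidean_space) \<Rightarrow> real^'n \<Rightarrow> 'b" where
  "wpartial \<Omega> i v = (SOME g. g \<in> L2 (lebesgue_on \<Omega>) \<and> is_weak_partial \<Omega> i v g)"

definition H1 :: "(real^'n) set \<Rightarrow> (real^'n \<Rightarrow> 'b::euclidean_space) set" where
  "H1 \<Omega> = {v \<in> L2 (lebesgue_on \<Omega>). \<forall>i. \<exists>g \<in> L2 (lebesgue_on \<Omega>). is_weak_partial \<Omega> i v g}"

definition H1_norm :: "(real^'n) set \<Rightarrow> (real^'n \<Rightarrow> 'b::euclidean_space) \<Rightarrow> real" where
  "H1_norm \<Omega> v = sqrt ((L2_norm (lebesgue_on \<Omega>) v)\<^sup>2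
     + (\<Sum>i\<in>UNIV. (L2_norm (lebesgue_on \<Omega>) (wpartial \<Omega> i v))\<^sup>2))"

definition H10 :: "(real^'n) set \<Rightarrow> (real^'n \<Rightarrow> real) set" where
  "H10 \<Omega> = {v \<in> H1 \<Omega>. \<exists>\<phi>. (\<forall>k. test_function \<Omega> (\<phi> k)) \<and>
     (\<lambda>k::nat. H1_norm \<Omega> (\<lambda>x. \<phi> k x - v x)) \<longlonglongrightarrow> 0}"

definition H2 :: "(real^'n) set \<Rightarrow> (real^'n \<Rightarrow> real) set" where
  "H2 \<Omega> = {v \<in> H1 \<Omega>. \<forall>i. wpartial \<Omega> i v \<in> H1 \<Omega>}"

definition H2_norm :: "(real^'n) set \<Rightarrow> (real^'n \<Rightarrow> real) \<Rightarrow> real" where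
  "H2_norm \<Omega> v = sqrt ((L2_norm (lebesgue_on \<Omega>) v)\<^sup>2
     + (\<Sum>i\<in>UNIV. (H1_norm \<Omega> (wpartial \<Omega> i v))\<^sup>2))"

definition wgrad :: "(real^'n) set \<Rightarrow> (real^'n \<Rightarrow> real) \<Rightarrow> real^'n \<Rightarrow> real^'n" where
  "wgrad \<Omega> v x = (\<chi> i. wpartial \<Omega> i v x)"

definition wjacobian :: "(real^'n) set \<Rightarrow> (real^'n \<Rightarrow> real^'n) \<Rightarrow> real^'n \<Rightarrow> real^'n^'n" where
  "wjacobian \<Omega> v x = (\<chi> i j. wpartial \<Omega> j v x $ i)"

definition wdiv :: "(real^'n) set \<Rightarrow> (real^'n \<Rightarrow> real^'n) \<Rightarrow> real^'n \<Rightarrow> real" where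
  "wdiv \<Omega> v x = (\<Sum>i\<in>UNIV. wpartial \<Omega> i v x $ i)"

definition sym_grad :: "(real^'n) set \<Rightarrow> (real^'n \<Rightarrow> real^'n) \<Rightarrow> real^'n \<Rightarrow> real^'n^'n" where
  "sym_grad \<Omega> v x = (1/2) *\<^sub>R (wjacobian \<Omega> v x + transpose (wjacobian \<Omega> v x))"

definition laplacian :: "(real^'n) set \<Rightarrow> (real^'n \<Rightarrow> real) \<Rightarrow> real^'n \<Rightarrow> real" where
  "laplacian \<Omega> v x = (\<Sum>i\<in>UNIV. wpartial \<Omega> i (wpartial \<Omega> i v) x)"

text \<open>\<open>\<Delta>\<close> is an isomorphism of \<open>H10 \<inter> H2\<close> (with the \<open>H2\<close> norm) onto \<open>L2\<close>. Injectivity is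
  contained in the lower bound.\<close>

definition laplacian_isomorphism :: "(real^'n) set \<Rightarrow> bool" where
  "laplacian_isomorphism \<Omega> \<longleftrightarrow>
     (\<forall>f \<in> L2 (lebesgue_on \<Omega>). \<exists>v \<in> H10 \<Omega> \<inter> H2 \<Omega>. AE x in lebesgue_on \<Omega>. laplacian \<Omega> v x = f x) \<and>
     (\<exists>C. \<forall>v \<in> H10 \<Omega> \<inter> H2 \<Omega>. laplacian \<Omega> v \<in> L2 (lebesgue_on \<Omega>) \<and>
        L2_norm (lebesgue_on \<Omega>) (laplacian \<Omega> v) \<le> C * H2_norm \<Omega> v \<and>
        H2_norm \<Omega> v \<le> C * L2_norm (lebesgue_on \<Omega>) (laplacian \<Omega> v))"

text \<open>\<open>w \<in> L2(\<partial>\<Omega>)\<close> is the trace of \<open>v \<in> H1(\<Omega>)\<close>: the trace map is the extension by continuity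
  of the restriction to \<open>\<partial>\<Omega>\<close> of functions that are smooth up to the boundary. It is written as a
  relation because a trace is only determined up to null sets of the surface measure; by the trace
  theorem every \<open>v \<in> H1(\<Omega>)\<close> has one.\<close>

definition has_trace ::
  "(real^'n) set \<Rightarrow> (real^'n \<Rightarrow> 'b::euclidean_space) \<Rightarrow> (real^'n \<Rightarrow> 'b) \<Rightarrow> bool" where
  "has_trace \<Omega> v w \<longleftrightarrow> v \<in> H1 \<Omega> \<and> w \<in> L2 (surface_measure \<Omega>) \<and>
     (\<exists>s. (\<forall>k::nat. smooth (s k)) \<and>
        (\<lambda>k. H1_norm \<Omega> (\<lambda>x. s k x - v x)) \<longlonglongrightarrow> 0 \<and>
        (\<lambda>k. L2_norm (surface_measure \<Omega>) (\<lambda>x. s k x - w x)) \<longlonglongrightarrow> 0)"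

text \<open>The kernel of \<open>\<epsilon>\<close> in any dimension: \<open>b \<times> x\<close> stands for a skew-symmetric linear map, which for
  \<open>d = 3\<close> is literally a cross product (see \<open>RM_cross3\<close>), for \<open>d = 2\<close> a multiple of the rotation by
  a right angle, and for \<open>d = 1\<close> zero.\<close>

definition RM :: "(real^'n \<Rightarrow> real^'n) set" where
  "RM = {r. \<exists>a B. transpose B = - B \<and> r = (\<lambda>x. a + B *v x)}"

lemma RM_cross3: "RM = {r. \<exists>a b::real^3. r = (\<lambda>x. a + cross3 b x)}"
proof (intro set_eqI iffI)
  fix r :: "real^3 \<Rightarrow> real^3" assume "r \<in> RM"
  then obtain a and B :: "real^3^3" where B: "transpose B = - B" and r: "r = (\<lambda>x. a + B *v x)"
    unfolding RM_def by blast
  have sk: "B $ j $ i = - (B $ i $ j)" for i j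
    using arg_cong[OF B, of "\<lambda>A. A $ i $ j"] by (simp add: transpose_def)
  have d: "B $ i $ i = 0" for i
    using sk[of i i] by linarith
  have "B *v x = cross3 (vector [B$3$2, B$1$3, B$2$1]) x" for x
    unfolding cross3_def matrix_vector_mult_def sum_3 vec_eq_iff forall_3
    by (simp add: d sk[of 2 1] sk[of 3 1] sk[of 3 2])
  then show "r \<in> {r. \<exists>a b. r = (\<lambda>x. a + cross3 b x)}" using r by auto
next
  fix r :: "real^3 \<Rightarrow> real^3" assume "r \<in> {r. \<exists>a b. r = (\<lambda>x. a + cross3 b x)}"
  then obtain a b where r: "r = (\<lambda>x. a + cross3 b x)" by blast
  let ?B = "vector [vector [0, - b$3, b$2], vector [b$3, 0, - b$1], vector [- b$2, b$1, 0]] :: real^3^3"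
  have "transpose ?B = - ?B"
    unfolding transpose_def vec_eq_iff forall_3 by simp
  moreover have "cross3 b x = ?B *v x" for x
    unfolding cross3_def matrix_vector_mult_def sum_3 vec_eq_iff forall_3 by simp
  ultimately show "r \<in> RM" unfolding RM_def using r by auto
qed

definition H1_perp :: "(real^'n) set \<Rightarrow> (real^'n \<Rightarrow> real^'n) set" where
  "H1_perp \<Omega> = {v \<in> H1 \<Omega>. \<forall>r\<in>RM. L2_inner (lebesgue_on \<Omega>) v r = 0}"


section \<open>Dual spaces and functions of time\<close>

text \<open>Dual of a (semi)normed space \<open>X\<close> of functions with norm \<open>N\<close>. The values of a functional
  outside \<open>X\<close> are irrelevant. A function \<open>w\<close> in \<open>L2\<close> is the functional \<open>L2_inner M w\<close>.\<close>

definition dual :: "('c \<Rightarrow> real) set \<Rightarrow> (('c \<Rightarrow> real) \<Rightarrow> real) \<Rightarrow> (('c \<Rightarrow> real) \<Rightarrow> real) set" where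
  "dual X N = {F. (\<forall>v\<in>X. \<forall>w\<in>X. \<forall>a b. F (\<lambda>x. a * v x + b * w x) = a * F v + b * F w) \<and>
     (\<exists>C. \<forall>v\<in>X. \<bar>F v\<bar> \<le> C * N v)}"

definition dual_norm ::
  "('c \<Rightarrow> real) set \<Rightarrow> (('c \<Rightarrow> real) \<Rightarrow> real) \<Rightarrow> (('c \<Rightarrow> real) \<Rightarrow> real) \<Rightarrow> real" where
  "dual_norm X N F = (SUP v\<in>{v\<in>X. N v \<le> 1}. \<bar>F v\<bar>)"

text \<open>Bochner measurability of \<open>u : [0,T] \<rightarrow> X\<close>: an almost everywhere limit, in the norm \<open>N\<close>, of
  simple functions.\<close>

definition strongly_measurable ::
  "real \<Rightarrow> ('c \<Rightarrow> 'b::real_vector) set \<Rightarrow> (('c \<Rightarrow> 'b) \<Rightarrow> real) \<Rightarrow> (real \<Rightarrow> 'c \<Rightarrow> 'b) \<Rightarrow> bool" where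
  "strongly_measurable T X N u \<longleftrightarrow>
     (\<exists>s. (\<forall>k::nat. simple_function (lebesgue_on {0..T}) (s k) \<and> s k ` {0..T} \<subseteq> X) \<and>
        (AE t in lebesgue_on {0..T}. (\<lambda>k. N (\<lambda>x. s k t x - u t x)) \<longlonglongrightarrow> 0))"

definition L2_time ::
  "real \<Rightarrow> ('c \<Rightarrow> 'b::real_vector) set \<Rightarrow> (('c \<Rightarrow> 'b) \<Rightarrow> real) \<Rightarrow> (real \<Rightarrow> 'c \<Rightarrow> 'b) set" where
  "L2_time T X N = {u. (AE t in lebesgue_on {0..T}. u t \<in> X) \<and> strongly_measurable T X N u \<and>
     (\<integral>\<^sup>+t. ennreal ((N (u t))\<^sup>2) \<partial>lebesgue_on {0..T}) < \<infinity>}"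

definition Linf_time ::
  "real \<Rightarrow> ('c \<Rightarrow> 'b::real_vector) set \<Rightarrow> (('c \<Rightarrow> 'b) \<Rightarrow> real) \<Rightarrow> (real \<Rightarrow> 'c \<Rightarrow> 'b) set" where
  "Linf_time T X N = {u. (AE t in lebesgue_on {0..T}. u t \<in> X) \<and> strongly_measurable T X N u \<and>
     (\<exists>C. AE t in lebesgue_on {0..T}. N (u t) \<le> C)}"

text \<open>\<open>G\<close> is the weak time derivative on \<open>(0,T)\<close> of the functional-valued \<open>F\<close>. The vector identity
  \<open>\<integral> \<zeta>' F dt = - \<integral> \<zeta> G dt\<close> in the dual of \<open>X\<close> is evaluated at each \<open>\<psi> \<in> X\<close>.\<close>

definition weak_time_deriv ::
  "real \<Rightarrow> ('c \<Rightarrow> real) set \<Rightarrow> (real \<Rightarrow> ('c \<Rightarrow> real) \<Rightarrow> real) \<Rightarrow> (real \<Rightarrow> ('c \<Rightarrow> real) \<Rightarrow> real) \<Rightarrow> bool" where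
  "weak_time_deriv T X F G \<longleftrightarrow> (\<forall>\<psi>\<in>X. \<forall>\<zeta>. test_function {0<..<T} \<zeta> \<longrightarrow>
     (\<integral>t. deriv \<zeta> t * F t \<psi> \<partial>lebesgue_on {0..T}) = - (\<integral>t. \<zeta> t * G t \<psi> \<partial>lebesgue_on {0..T}))"

definition H1_time_dual ::
  "real \<Rightarrow> ('c \<Rightarrow> real) set \<Rightarrow> (('c \<Rightarrow> real) \<Rightarrow> real) \<Rightarrow> (real \<Rightarrow> ('c \<Rightarrow> real) \<Rightarrow> real) set" where
  "H1_time_dual T X N = {F. F \<in> L2_time T (dual X N) (dual_norm X N) \<and>
     (\<exists>G \<in> L2_time T (dual X N) (dual_norm X N). weak_time_deriv T X F G)}"


section \<open>The reformulated poroelasticity problem\<close>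

definition kappa1 :: "real \<Rightarrow> real \<Rightarrow> real \<Rightarrow> real" where
  "kappa1 \<alpha> lam c0 = \<alpha> / (\<alpha>\<^sup>2 + lam * c0)"

definition kappa2 :: "real \<Rightarrow> real \<Rightarrow> real \<Rightarrow> real" where
  "kappa2 \<alpha> lam c0 = lam / (\<alpha>\<^sup>2 + lam * c0)"

definition kappa3 :: "real \<Rightarrow> real \<Rightarrow> real \<Rightarrow> real" where
  "kappa3 \<alpha> lam c0 = c0 / (\<alpha>\<^sup>2 + lam * c0)"

text \<open>\<open>\<eta>\<close> denotes the representative that is continuous from \<open>[0,T]\<close> to \<open>H\<^sup>-\<^sup>1\<close>, which gives
  \<open>\<eta>(0) = \<eta>\<^sub>0\<close> its meaning; being bounded in \<open>L2\<close>, it has values in \<open>L2\<close> at every time. The other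
  unknowns are defined almost everywhere in time and their initial values are pointwise values.
  The functional \<open>\<eta>\<^sub>t\<close> in the third equation acts on \<open>H1\<close>, so it is the time derivative of \<open>\<eta>\<close>
  tested with all of \<open>H1\<close>, not only with \<open>H10\<close>.\<close>

definition weak_solution ::
  "(real^'n) set \<Rightarrow> real \<Rightarrow> real \<Rightarrow> real \<Rightarrow> real \<Rightarrow> real \<Rightarrow> real \<Rightarrow> (real^'n \<Rightarrow> real^'n^'n) \<Rightarrow>
   (real^'n \<Rightarrow> real) \<Rightarrow> (real^'n \<Rightarrow> real^'n) \<Rightarrow>
   (real^'n \<Rightarrow> real^'n) \<Rightarrow> (real^'n \<Rightarrow> real^'n) \<Rightarrow> (real^'n \<Rightarrow> real) \<Rightarrow> (real^'n \<Rightarrow> real) \<Rightarrow>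
   (real^'n \<Rightarrow> real^'n) \<Rightarrow> (real^'n \<Rightarrow> real) \<Rightarrow>
   (real \<Rightarrow> real^'n \<Rightarrow> real^'n) \<Rightarrow> (real \<Rightarrow> real^'n \<Rightarrow> real) \<Rightarrow> (real \<Rightarrow> real^'n \<Rightarrow> real) \<Rightarrow>
   (real \<Rightarrow> real^'n \<Rightarrow> real) \<Rightarrow> (real \<Rightarrow> real^'n \<Rightarrow> real) \<Rightarrow> bool" where
  "weak_solution \<Omega> T lam \<mu> \<alpha> c0 \<mu>f K \<rho>f grav f f1 \<phi> \<phi>1 u0 p0 u \<xi> \<eta> p q \<longleftrightarrow>
    (let M = lebesgue_on \<Omega>; S = surface_measure \<Omega>; I = lebesgue_on {0..T};
         \<kappa>1 = kappa1 \<alpha> lam c0; \<kappa>2 = kappa2 \<alpha> lam c0; \<kappa>3 = kappa3 \<alpha> lam c0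
     in
      u \<in> Linf_time T (H1_perp \<Omega>) (H1_norm \<Omega>) \<and>
      \<xi> \<in> L2_time T (L2 M) (L2_norm M) \<and>
      \<eta> \<in> Linf_time T (L2 M) (L2_norm M) \<and>
      (\<lambda>t. L2_inner M (\<eta> t)) \<in> H1_time_dual T (H10 \<Omega>) (H1_norm \<Omega>) \<and>
      (\<forall>t\<in>{0..T}. \<eta> t \<in> L2 M \<and>
         ((\<lambda>s. dual_norm (H10 \<Omega>) (H1_norm \<Omega>) (\<lambda>\<psi>. L2_inner M (\<eta> s) \<psi> - L2_inner M (\<eta> t) \<psi>))
            \<longlongrightarrow> 0) (at t within {0..T})) \<and>
      q \<in> Linf_time T (L2 M) (L2_norm M) \<and>
      p \<in> L2_time T (H1 \<Omega>) (H1_norm \<Omega>) \<and>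
      (AE t in I. \<forall>v\<in>H1 \<Omega>. \<forall>tv. has_trace \<Omega> v tv \<longrightarrow>
         \<mu> * L2_inner M (sym_grad \<Omega> (u t)) (sym_grad \<Omega> v) - L2_inner M (\<xi> t) (wdiv \<Omega> v)
           = L2_inner M f v + L2_inner S f1 tv) \<and>
      (AE t in I. \<forall>\<theta>\<in>L2 M.
         \<kappa>3 * L2_inner M (\<xi> t) \<theta> + L2_inner M (wdiv \<Omega> (u t)) \<theta> = \<kappa>1 * L2_inner M (\<eta> t) \<theta>) \<and>
      (\<exists>\<eta>t \<in> L2_time T (dual (H1 \<Omega>) (H1_norm \<Omega>)) (dual_norm (H1 \<Omega>) (H1_norm \<Omega>)).
         weak_time_deriv T (H1 \<Omega>) (\<lambda>t. L2_inner M (\<eta> t)) \<eta>t \<and>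
         (AE t in I. \<forall>\<psi>\<in>H1 \<Omega>. \<forall>t\<psi>. has_trace \<Omega> \<psi> t\<psi> \<longrightarrow>
            \<eta>t t \<psi> + 1 / \<mu>f * L2_inner M
              (\<lambda>x. K x *v (wgrad \<Omega> (\<lambda>y. \<kappa>1 * \<xi> t y + \<kappa>2 * \<eta> t y) x - \<rho>f x *\<^sub>R grav x))
              (wgrad \<Omega> \<psi>)
            = L2_inner M \<phi> \<psi> + L2_inner S \<phi>1 t\<psi>)) \<and>
      (AE t in I. AE x in M. p t x = \<kappa>1 * \<xi> t x + \<kappa>2 * \<eta> t x) \<and>
      (AE t in I. AE x in M. q t x = \<kappa>1 * \<eta> t x - \<kappa>3 * \<xi> t x) \<and>
      (AE x in M. u 0 x = u0 x) \<and>
      (AE x in M. p 0 x = p0 x) \<and>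
      (AE x in M. q 0 x = wdiv \<Omega> u0 x) \<and>
      (AE x in M. \<eta> 0 x = c0 * p0 x + \<alpha> * wdiv \<Omega> u0 x))"

end

theory Submission
  imports Defs
begin

text \<open>The third equation tested with \<open>\<psi> = 1\<close>, which removes the gradient term, says that the mean of
  \<open>\<eta>\<close> has a constant weak time derivative; this mean is continuous in time, hence affine. The first
  equation tested with \<open>v = x\<close>, for which \<open>\<epsilon>(v)\<close> is the identity and \<open>div v = d\<close>, and the second one
  tested with 1 are two linear equations for the means of \<open>\<xi>\<close> and \<open>div u\<close>.

  The flux identity is the divergence theorem on a finite union of polytopes. By translation
  invariance, \<open>\<integral>\<^sub>\<Omega> \<partial>\<^sub>e g\<close> is the limit of \<open>s\<^sup>-\<^sup>1 \<integral> g(x) (1\<^sub>\<Omega>(x - s e) - 1\<^sub>\<Omega>(x)) dx\<close>, to which only points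
  within \<open>s\<close> of the finitely many hyperplanes that carry \<open>\<partial>\<Omega>\<close> contribute. In the
  coordinates \<open>x = z + s \<tau> \<nu>\<close> along each hyperplane, dominated convergence gives the facet integrals.\<close>

text \<open>Two features of the setting force the long geometric part. \<open>wpartial\<close> is an
  arbitrary choice among weak derivatives, so even "the gradient of 1 is 0" and "the divergence of
  \<open>x\<close> is \<open>d\<close>" hold only up to null sets: they need uniqueness of weak
  derivatives and integration by parts of a smooth function against a test function. And the flux of
  \<open>u\<close> exists on the boundary only through \<open>has_trace\<close>, that is, through
  smooth approximations. Both are reduced to one boundary identity for differentiable functions on
  the whole space.

  Translating the domain needs less: finitely many hyperplanes cover the boundary, and two different
  ones meet in a null set.

  The continuity of the mean of \<open>\<eta>\<close> is not immediate either, because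
  \<open>\<eta>\<close> is continuous only with values in the dual of \<open>H10\<close>, to which
  the functional of testing with 1 does not extend directly.\<close>

lemma complete_measure_lebesgue_on:
  assumes "S \<in> sets lebesgue"
  shows "complete_measure (lebesgue_on S)"
proof
  fix A B assume "B \<subseteq> A" "A \<in> null_sets (lebesgue_on S)"
  then have "A \<in> null_sets lebesgue" "A \<subseteq> S"
    using assms by (auto simp: null_sets_restrict_space)
  then have "B \<in> null_sets lebesgue" "B \<subseteq> S"
    using \<open>B \<subseteq> A\<close> completion.complete2 by blast+
  then show "B \<in> sets (lebesgue_on S)"
    using assms by (auto simp: sets_restrict_space_iff)
qed

lemma (in complete_measure) measurable_cong_AE_complete:
  assumes "AE x in M. f x = g x" "g \<in> borel_measurable M"
  shows "f \<in> borel_measurable M"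
proof (rule borel_measurableI)
  fix U :: "'b set" assume "open U"
  then have "g -` U \<inter> space M \<in> sets M" using assms(2) by (simp add: measurable_sets borel_open)
  then show "f -` U \<inter> space M \<in> sets M"
    by (rule in_sets_AE[rotated]) (use assms(1) in auto)
qed

text \<open>By completeness, \<open>f\<close> and \<open>g\<close> are either both measurable or
  both not; in the latter case both integrals take the default value 0. The a.e. identities of the
  weak formulation can thus be integrated as they stand.\<close>

lemma integral_cong_AE_lebesgue_on:
  fixes f g :: "'a::euclidean_space \<Rightarrow> 'b::{banach,second_countable_topology}"
  assumes S: "S \<in> sets lebesgue" and eq: "AE x in lebesgue_on S. f x = g x"
  shows "(\<integral>x. f x \<partial>lebesgue_on S) = (\<integral>x. g x \<partial>lebesgue_on S)"
proof -
  interpret complete_measure "lebesgue_on S" by (rule complete_measure_lebesgue_on[OF S])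
  have eq': "AE x in lebesgue_on S. g x = f x" using eq by (rule AE_mp) auto
  show ?thesis
  proof (cases "f \<in> borel_measurable (lebesgue_on S)")
    case True
    then show ?thesis
      using eq measurable_cong_AE_complete[OF eq'] by (intro integral_cong_AE) auto
  next
    case False
    then have "g \<notin> borel_measurable (lebesgue_on S)"
      using measurable_cong_AE_complete[OF eq] by blast
    then show ?thesis
      using False by (metis borel_measurable_integrable not_integrable_integral_eq)
  qed
qed

section \<open>Hyperplane measure\<close>

lemma space_hyperplane_measure [simp]: "space (hyperplane_measure P) = UNIV"
  and sets_hyperplane_measure [simp, measurable_cong]: "sets (hyperplane_measure P) = sets borel"
  by (cases P; simp add: hyperplane_measure_def)+

lemma nn_integral_hyperplane_measure:
  fixes \<nu> :: "'a::euclidean_space"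
  assumes [measurable]: "G \<in> borel_measurable borel"
  shows "(\<integral>\<^sup>+z. G z \<partial>hyperplane_measure (\<nu>, c)) =
    (\<integral>\<^sup>+y. indicator {0..1} (y \<bullet> \<nu> - c) * G (y - (y \<bullet> \<nu> - c) *\<^sub>R \<nu>) \<partial>lborel)"
proof -
  have S: "{y. c \<le> y \<bullet> \<nu> \<and> y \<bullet> \<nu> \<le> c + 1} \<inter> space lborel \<in> sets lborel"
    by measurable
  have "(\<integral>\<^sup>+z. G z \<partial>hyperplane_measure (\<nu>, c)) =
    (\<integral>\<^sup>+y. G (y - (y \<bullet> \<nu> - c) *\<^sub>R \<nu>) \<partial>restrict_space lborel {y. c \<le> y \<bullet> \<nu> \<and> y \<bullet> \<nu> \<le> c + 1})"
    unfolding hyperplane_measure_def split by (intro nn_integral_distr) (auto intro!: measurable_restrict_space1)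
  also have "\<dots> = (\<integral>\<^sup>+y. G (y - (y \<bullet> \<nu> - c) *\<^sub>R \<nu>) * indicator {y. c \<le> y \<bullet> \<nu> \<and> y \<bullet> \<nu> \<le> c + 1} y \<partial>lborel)"
    using S by (intro nn_integral_restrict_space) auto
  finally show ?thesis
    by (auto simp: indicator_def intro!: nn_integral_cong)
qed

lemma nn_integral_lborel_translate:
  fixes a :: "'a::euclidean_space"
  assumes [measurable]: "f \<in> borel_measurable borel"
  shows "(\<integral>\<^sup>+y. f (a + y) \<partial>lborel) = (\<integral>\<^sup>+y. f y \<partial>lborel)"
proof -
  have "(\<integral>\<^sup>+y. f y \<partial>distr lborel borel ((+) a)) = (\<integral>\<^sup>+y. f (a + y) \<partial>lborel)"
    by (rule nn_integral_distr) auto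
  then show ?thesis by (simp add: lborel_distr_plus)
qed

text \<open>Fubini in the direction \<open>\<nu>\<close>. The unit slab that defines the hyperplane measure is
  traded for \<open>\<psi>\<close> by translating along \<open>\<nu>\<close> and averaging over the translations.\<close>

lemma nn_integral_slab:
  fixes \<nu> :: "'a::euclidean_space"
  assumes nu: "norm \<nu> = 1"
    and [measurable]: "\<psi> \<in> borel_measurable borel" "G \<in> borel_measurable borel"
  shows "(\<integral>\<^sup>+y. \<psi> (y \<bullet> \<nu> - c) * G (y - (y \<bullet> \<nu> - c) *\<^sub>R \<nu>) \<partial>lborel) =
    (\<integral>\<^sup>+t. \<psi> t \<partial>lborel) * (\<integral>\<^sup>+z. G z \<partial>hyperplane_measure (\<nu>, c))"
proof -
  define h where "h y = y \<bullet> \<nu> - c" for y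
  define \<pi> where "\<pi> y = y - h y *\<^sub>R \<nu>" for y
  have [measurable]: "h \<in> borel_measurable borel" "\<pi> \<in> borel_measurable borel"
    unfolding \<pi>_def h_def by measurable
  have nn: "\<nu> \<bullet> \<nu> = 1" using nu by (simp add: norm_eq_1)
  have ht: "h (t *\<^sub>R \<nu> + y) = t + h y" for t y
    by (simp add: h_def inner_add_left nn)
  have pt: "\<pi> (t *\<^sub>R \<nu> + y) = \<pi> y" for t y
    unfolding \<pi>_def ht by (simp add: algebra_simps)
  have R: "(\<integral>\<^sup>+t. f (t + s) \<partial>lborel) = (\<integral>\<^sup>+t. f t \<partial>lborel)"
    if "f \<in> borel_measurable borel" for f :: "real \<Rightarrow> ennreal" and s
    using nn_integral_lborel_translate[OF that, of s] by (simp add: add.commute)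
  let ?F = "\<lambda>t y. indicator {0..1} (h y) * G (\<pi> y) * \<psi> (t + h y) :: ennreal"
  let ?H = "\<lambda>t y. indicator {0..1} (h y - t) * G (\<pi> y) * \<psi> (h y) :: ennreal"
  have "(\<integral>\<^sup>+t. \<psi> t \<partial>lborel) * (\<integral>\<^sup>+z. G z \<partial>hyperplane_measure (\<nu>, c)) =
    (\<integral>\<^sup>+y. (\<integral>\<^sup>+t. ?F t y \<partial>lborel) \<partial>lborel)"
    by (simp add: nn_integral_hyperplane_measure nn_integral_cmult R nn_integral_multc
        flip: h_def \<pi>_def) (simp add: mult.commute)
  also have "\<dots> = (\<integral>\<^sup>+t. (\<integral>\<^sup>+y. ?F t y \<partial>lborel) \<partial>lborel)"
    by (rule lborel_pair.Fubini') measurable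
  \<comment> \<open>For fixed \<open>t\<close>, shifting \<open>y\<close> by
    \<open>t *\<^sub>R \<nu>\<close> moves \<open>t\<close> from the argument of
    \<open>\<psi>\<close> into the window of the slab.\<close>
  also have "\<dots> = (\<integral>\<^sup>+t. (\<integral>\<^sup>+y. ?H t y \<partial>lborel) \<partial>lborel)"
  proof (rule nn_integral_cong)
    fix t :: real
    have "(\<integral>\<^sup>+y. ?H t (t *\<^sub>R \<nu> + y) \<partial>lborel) = (\<integral>\<^sup>+y. ?H t y \<partial>lborel)"
      by (rule nn_integral_lborel_translate) measurable
    then show "(\<integral>\<^sup>+y. ?F t y \<partial>lborel) = (\<integral>\<^sup>+y. ?H t y \<partial>lborel)"
      by (simp add: ht pt)
  qed
  also have "\<dots> = (\<integral>\<^sup>+y. (\<integral>\<^sup>+t. ?H t y \<partial>lborel) \<partial>lborel)"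
    by (rule lborel_pair.Fubini'[symmetric]) measurable
  also have "\<dots> = (\<integral>\<^sup>+y. \<psi> (h y) * G (\<pi> y) \<partial>lborel)"
  proof (rule nn_integral_cong)
    fix y
    \<comment> \<open>The window now selects an interval of \<open>t\<close> of length 1, whatever
      \<open>y\<close> is.\<close>
    have "(\<integral>\<^sup>+t. indicator {0..1} (h y - t) \<partial>lborel) = (\<integral>\<^sup>+t. indicator {h y - 1..h y} (t::real) \<partial>lborel :: ennreal)"
      by (intro nn_integral_cong) (auto simp: indicator_def)
    then have "(\<integral>\<^sup>+t. indicator {0..1} (h y - t) \<partial>lborel) = (1::ennreal)" by simp
    then show "(\<integral>\<^sup>+t. ?H t y \<partial>lborel) = \<psi> (h y) * G (\<pi> y)"
      by (simp add: nn_integral_multc mult.assoc) (simp add: mult.commute)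
  qed
  finally show ?thesis by (simp add: h_def \<pi>_def)
qed

text \<open>Projecting along \<open>\<nu>\<close> moves a point of the unit slab by at most 1, so
  the part of the slab over a set of radius \<open>R\<close> lies in a ball of radius
  \<open>R + 1\<close>.\<close>

lemma emeasure_hyperplane_measure_bounded:
  fixes \<nu> :: "'a::euclidean_space"
  assumes nu: "norm \<nu> = 1" and B: "bounded B" "B \<in> sets borel"
  shows "emeasure (hyperplane_measure (\<nu>, c)) B < \<infinity>"
proof -
  obtain R where R: "\<And>x. x \<in> B \<Longrightarrow> norm x \<le> R"
    using B(1) by (auto simp: bounded_iff)
  have [measurable]: "B \<in> sets borel" by fact
  have "emeasure (hyperplane_measure (\<nu>, c)) B = (\<integral>\<^sup>+z. indicator B z \<partial>hyperplane_measure (\<nu>, c))"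
    using B by simp
  also have "\<dots> = (\<integral>\<^sup>+y. indicator {0..1} (y \<bullet> \<nu> - c) * indicator B (y - (y \<bullet> \<nu> - c) *\<^sub>R \<nu>) \<partial>lborel)"
    by (rule nn_integral_hyperplane_measure) measurable
  also have "\<dots> \<le> (\<integral>\<^sup>+y. indicator (cball (0::'a) (R + 1)) y \<partial>lborel)"
  proof (rule nn_integral_mono)
    fix y :: 'a
    have "norm y \<le> R + 1" if "y - (y \<bullet> \<nu> - c) *\<^sub>R \<nu> \<in> B" "0 \<le> y \<bullet> \<nu> - c" "y \<bullet> \<nu> - c \<le> 1"
    proof -
      have "norm y \<le> norm (y - (y \<bullet> \<nu> - c) *\<^sub>R \<nu>) + norm ((y \<bullet> \<nu> - c) *\<^sub>R \<nu>)"
        using norm_triangle_ineq[of "y - (y \<bullet> \<nu> - c) *\<^sub>R \<nu>" "(y \<bullet> \<nu> - c) *\<^sub>R \<nu>"] by simp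
      then show ?thesis using R[OF that(1)] that nu by simp
    qed
    then show "indicator {0..1} (y \<bullet> \<nu> - c) * indicator B (y - (y \<bullet> \<nu> - c) *\<^sub>R \<nu>)
      \<le> (indicator (cball 0 (R + 1)) y :: ennreal)"
      by (auto simp: indicator_def)
  qed
  also have "\<dots> < \<infinity>"
    using emeasure_bounded_finite[OF bounded_cball, of "0::'a" "R + 1"] by simp
  finally show ?thesis .
qed

lemma sigma_finite_hyperplane_measure:
  fixes \<nu> :: "'a::euclidean_space"
  assumes nu: "norm \<nu> = 1"
  shows "sigma_finite_measure (hyperplane_measure (\<nu>, c))"
proof
  have "range (\<lambda>n. cball 0 (real n)) \<subseteq> sets (hyperplane_measure (\<nu>, c))" by auto
  moreover have "(\<Union>n. cball (0::'a) (real n)) = UNIV"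
    using real_arch_simple by (auto simp: dist_norm)
  moreover have "emeasure (hyperplane_measure (\<nu>, c)) (cball 0 (real n)) \<noteq> \<infinity>" for n
    using emeasure_hyperplane_measure_bounded[OF nu, of "cball 0 (real n)" c] by auto
  ultimately show "\<exists>A. countable A \<and> A \<subseteq> sets (hyperplane_measure (\<nu>, c)) \<and>
      \<Union> A = space (hyperplane_measure (\<nu>, c)) \<and>
      (\<forall>a\<in>A. emeasure (hyperplane_measure (\<nu>, c)) a \<noteq> \<infinity>)"
    by (intro exI[of _ "range (\<lambda>n. cball 0 (real n))"]) auto
qed

text \<open>This is the change of variables \<open>y = z + (s * t) *\<^sub>R \<nu>\<close> with
  Jacobian \<open>s\<close>, read backwards. Both factors are sigma-finite, so it suffices to
  compare rectangles; there \<open>nn_integral_slab\<close> separates the normal from the tangential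
  variable, and rescaling the line produces the factor \<open>s\<close>.\<close>

lemma pair_hyperplane_measure:
  fixes \<nu> :: "'a::euclidean_space"
  assumes nu: "norm \<nu> = 1" and s: "s > 0"
  shows "lborel \<Otimes>\<^sub>M hyperplane_measure (\<nu>, c) =
    distr (density lborel (\<lambda>_. ennreal (1 / s))) (borel \<Otimes>\<^sub>M borel)
      (\<lambda>y. ((y \<bullet> \<nu> - c) / s, y - (y \<bullet> \<nu> - c) *\<^sub>R \<nu>))"
proof (rule pair_measure_eqI)
  show "sigma_finite_measure lborel" ..
  show "sigma_finite_measure (hyperplane_measure (\<nu>, c))"
    by (rule sigma_finite_hyperplane_measure[OF nu])
  fix A :: "real set" and B :: "'a set"
  assume "A \<in> sets lborel" "B \<in> sets (hyperplane_measure (\<nu>, c))"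
  then have [measurable]: "A \<in> sets borel" "B \<in> sets borel" by auto
  let ?f = "\<lambda>y. ((y \<bullet> \<nu> - c) / s, y - (y \<bullet> \<nu> - c) *\<^sub>R \<nu>)"
  let ?M = "density lborel (\<lambda>_. ennreal (1 / s))"
  have "emeasure (distr ?M (borel \<Otimes>\<^sub>M borel) ?f) (A \<times> B)
    = (\<integral>\<^sup>+p. indicator A (fst p) * indicator B (snd p) \<partial>distr ?M (borel \<Otimes>\<^sub>M borel) ?f)"
    by (simp add: indicator_times[symmetric])
  also have "\<dots> = ennreal (1 / s) * (\<integral>\<^sup>+y. indicator A ((y \<bullet> \<nu> - c) / s) * indicator B (y - (y \<bullet> \<nu> - c) *\<^sub>R \<nu>) \<partial>lborel)"
    by (subst nn_integral_distr) (auto simp: nn_integral_density nn_integral_cmult)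
  also have "(\<integral>\<^sup>+y. indicator A ((y \<bullet> \<nu> - c) / s) * indicator B (y - (y \<bullet> \<nu> - c) *\<^sub>R \<nu>) \<partial>lborel)
    = (\<integral>\<^sup>+t. indicator A (t / s) \<partial>lborel) * emeasure (hyperplane_measure (\<nu>, c)) B"
    using nn_integral_slab[OF nu, of "\<lambda>t. indicator A (t / s)" "indicator B" c] by simp
  also have "(\<integral>\<^sup>+t. indicator A (t / s) \<partial>lborel) = ennreal s * (\<integral>\<^sup>+t. indicator A t \<partial>lborel)"
    using nn_integral_real_affine[of "\<lambda>t. indicator A (t / s)" s 0] s by simp
  finally show "emeasure lborel A * emeasure (hyperplane_measure (\<nu>, c)) B =
    emeasure (distr ?M (borel \<Otimes>\<^sub>M borel) ?f) (A \<times> B)"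
    using s by (simp add: mult.assoc[symmetric] ennreal_mult[symmetric])
qed (simp cong: sets_pair_measure_cong)

text \<open>The factor \<open>1 / s\<close> of a difference quotient is exactly the density in these
  coordinates, so a rescaled integral over a layer of width \<open>s\<close> becomes an integral
  over a region that does not shrink with \<open>s\<close>.\<close>

lemma integral_hyperplane_disintegration:
  fixes \<nu> :: "'a::euclidean_space" and F :: "'a \<Rightarrow> real"
  assumes nu: "norm \<nu> = 1" and s: "s > 0" and [measurable]: "F \<in> borel_measurable borel"
  shows "(\<integral>p. F (snd p + (s * fst p) *\<^sub>R \<nu>) \<partial>(lborel \<Otimes>\<^sub>M hyperplane_measure (\<nu>, c))) = 1 / s * (\<integral>y. F y \<partial>lborel)"
  unfolding pair_hyperplane_measure[OF nu s]
  by (subst integral_distr; (subst integral_density)?) (use s in auto)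

lemma AE_hyperplane_measure:
  fixes \<nu> :: "'a::euclidean_space"
  assumes nu: "norm \<nu> = 1"
  shows "AE z in hyperplane_measure (\<nu>, c). z \<bullet> \<nu> = c"
proof -
  have nn: "\<nu> \<bullet> \<nu> = 1" using nu by (simp add: norm_eq_1)
  have "(\<integral>\<^sup>+z. indicator {z. z \<bullet> \<nu> \<noteq> c} z \<partial>hyperplane_measure (\<nu>, c)) =
    (\<integral>\<^sup>+y. indicator {0..1} (y \<bullet> \<nu> - c) * indicator {z. z \<bullet> \<nu> \<noteq> c} (y - (y \<bullet> \<nu> - c) *\<^sub>R \<nu>) \<partial>lborel)"
    by (rule nn_integral_hyperplane_measure) measurable
  also have "\<dots> = 0"
    by (simp add: inner_diff_left nn)
  finally have "emeasure (hyperplane_measure (\<nu>, c)) {z. z \<bullet> \<nu> \<noteq> c} = 0"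
    by (subst (asm) nn_integral_indicator) auto
  then show ?thesis
    by (intro AE_I[where N = "{z. z \<bullet> \<nu> \<noteq> c}"]) auto
qed

text \<open>Pulled back by the projection, the second hyperplane becomes the solution set of
  \<open>a \<bullet> y = b\<close>, where \<open>a\<close> is the part of \<open>\<nu>'\<close>
  tangential to the first one. This set is negligible unless \<open>a = 0\<close> and
  \<open>b = 0\<close>, which would make the hyperplanes equal.\<close>

lemma AE_hyperplane_measure_other:
  fixes \<nu> :: "'a::euclidean_space"
  assumes nu: "norm \<nu> = 1" and ne: "{z. z \<bullet> \<nu> = c} \<noteq> {z. z \<bullet> \<nu>' = c'}" and nu': "norm \<nu>' = 1"
  shows "AE z in hyperplane_measure (\<nu>, c). z \<bullet> \<nu>' \<noteq> c'"
proof -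
  define a where "a = \<nu>' - (\<nu> \<bullet> \<nu>') *\<^sub>R \<nu>"
  define b where "b = c' - c * (\<nu> \<bullet> \<nu>')"
  have nn: "\<nu> \<bullet> \<nu> = 1" "\<nu>' \<bullet> \<nu>' = 1" using nu nu' by (simp_all add: norm_eq_1)
  have eq: "(y - (y \<bullet> \<nu> - c) *\<^sub>R \<nu>) \<bullet> \<nu>' = c' \<longleftrightarrow> a \<bullet> y = b" for y
    by (auto simp: a_def b_def algebra_simps inner_commute)
  have "a \<noteq> 0 \<or> b \<noteq> 0"
  proof (rule ccontr)
    assume "\<not> ?thesis"
    then have n: "\<nu>' = (\<nu> \<bullet> \<nu>') *\<^sub>R \<nu>" and c': "c' = c * (\<nu> \<bullet> \<nu>')" by (auto simp: a_def b_def)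
    then have "\<nu> \<bullet> \<nu>' \<noteq> 0" using nu' by force
    then have "z \<bullet> \<nu>' = c' \<longleftrightarrow> z \<bullet> \<nu> = c" for z
      by (subst n, subst c') (auto simp: mult.commute)
    then show False using ne by auto
  qed
  then have neg: "negligible {y. a \<bullet> y = b}" by (rule negligible_hyperplane)
  have "{y. a \<bullet> y = b} \<in> sets borel" by measurable
  then have n0: "{y. a \<bullet> y = b} \<in> null_sets lborel"
    using neg negligible_iff_null_sets null_sets_completion_iff[of "{y. a \<bullet> y = b}" lborel] by auto
  have "(\<integral>\<^sup>+z. indicator {z. z \<bullet> \<nu>' = c'} z \<partial>hyperplane_measure (\<nu>, c)) =
    (\<integral>\<^sup>+y. indicator {0..1} (y \<bullet> \<nu> - c) * indicator {z. z \<bullet> \<nu>' = c'} (y - (y \<bullet> \<nu> - c) *\<^sub>R \<nu>) \<partial>lborel)"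
    by (rule nn_integral_hyperplane_measure) measurable
  also have "\<dots> = (\<integral>\<^sup>+y. 0 \<partial>(lborel :: 'a measure))"
    by (rule nn_integral_cong_AE, rule AE_mp[OF AE_not_in[OF n0]]) (auto simp: indicator_def eq)
  finally have "emeasure (hyperplane_measure (\<nu>, c)) {z. z \<bullet> \<nu>' = c'} = 0"
    by (subst (asm) nn_integral_indicator) auto
  then show ?thesis
    by (intro AE_I[where N = "{z. z \<bullet> \<nu>' = c'}"]) auto
qed

text \<open>Reversing the normal puts the unit slab on the other side of the same hyperplane, and in
  \<open>nn_integral_slab\<close> the indicators of \<open>{0..1}\<close> and
  \<open>{- 1..0}\<close> have the same integral. Facets of both orientations can therefore be
  integrated against one measure.\<close>

lemma hyperplane_measure_uminus:
  fixes \<nu> :: "'a::euclidean_space"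
  assumes nu: "norm \<nu> = 1"
  shows "hyperplane_measure (- \<nu>, - c) = hyperplane_measure (\<nu>, c)"
proof (rule measure_eqI)
  fix A assume "A \<in> sets (hyperplane_measure (- \<nu>, - c))"
  then have [measurable]: "A \<in> sets borel" by simp
  have "emeasure (hyperplane_measure (- \<nu>, - c)) A = (\<integral>\<^sup>+z. indicator A z \<partial>hyperplane_measure (- \<nu>, - c))"
    by simp
  also have "\<dots> = (\<integral>\<^sup>+y. indicator {- 1..0} (y \<bullet> \<nu> - c) * indicator A (y - (y \<bullet> \<nu> - c) *\<^sub>R \<nu>) \<partial>lborel)"
    by (subst nn_integral_hyperplane_measure)
      (auto intro!: nn_integral_cong simp: indicator_def algebra_simps)
  also have "\<dots> = emeasure (hyperplane_measure (\<nu>, c)) A"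
    using nn_integral_slab[OF nu, of "indicator {- 1..0}" "indicator A" c] by simp
  finally show "emeasure (hyperplane_measure (- \<nu>, - c)) A = emeasure (hyperplane_measure (\<nu>, c)) A" .
qed simp

section \<open>Hyperplane arrangements and facets\<close>

definition hyperplane :: "'a::euclidean_space \<times> real \<Rightarrow> 'a set" where
  "hyperplane P = {x. x \<bullet> fst P = snd P}"

text \<open>Only a covering of the boundary is required: the hyperplanes may also cross
  \<open>\<Omega>\<close>. Distinct elements give distinct hyperplanes, so each hyperplane is listed
  with one of its two unit normals and is counted once.\<close>

locale arrangement =
  fixes \<Omega> :: "'a::euclidean_space set" and AA :: "('a \<times> real) set"
  assumes open_domain: "open \<Omega>" and bounded_domain: "bounded \<Omega>"
    and finite_AA: "finite AA"
    and norm_fst: "P \<in> AA \<Longrightarrow> norm (fst P) = 1"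
    and hyperplane_inj: "P \<in> AA \<Longrightarrow> Q \<in> AA \<Longrightarrow> P \<noteq> Q \<Longrightarrow> hyperplane P \<noteq> hyperplane Q"
    and frontier_subset: "frontier \<Omega> \<subseteq> (\<Union>P\<in>AA. hyperplane P)"

text \<open>A boundary point of a finite intersection of closed half-spaces cannot be interior to
  all of them, so it lies on one of the bounding hyperplanes. This includes polyhedra with empty
  interior.\<close>

lemma polyhedron_frontier_hyperplanes:
  fixes S :: "'a::euclidean_space set"
  assumes "polyhedron S"
  shows "\<exists>\<H>. finite \<H> \<and> (\<forall>h\<in>\<H>. \<exists>P. norm (fst P) = 1 \<and> h = hyperplane P) \<and> frontier S \<subseteq> \<Union>\<H>"
proof -
  obtain F where F: "finite F" "S = \<Inter>F" "\<And>h. h \<in> F \<Longrightarrow> \<exists>a b. a \<noteq> 0 \<and> h = {x. a \<bullet> x \<le> b}"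
    using assms unfolding polyhedron_def by blast
  have 1: "\<exists>P. norm (fst P) = 1 \<and> frontier h = hyperplane P" if h: "h \<in> F" for h
  proof -
    obtain a b where ab: "a \<noteq> 0" "h = {x. a \<bullet> x \<le> b}" using F(3)[OF h] by blast
    have "frontier h = hyperplane ((1 / norm a) *\<^sub>R a, b / norm a)"
      unfolding ab(2) frontier_halfspace_le[OF disjI1, OF ab(1)]
      using ab(1) by (auto simp: hyperplane_def inner_commute[of a] field_simps)
    moreover have "norm ((1 / norm a) *\<^sub>R a) = 1" using ab by simp
    ultimately show ?thesis by (metis fst_conv)
  qed
  have "frontier S \<subseteq> \<Union>(frontier ` F)"
  proof
    fix x assume x: "x \<in> frontier S"
    have cl: "closed h" if "h \<in> F" for h using F(3)[OF that] closed_halfspace_le by auto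
    then have "closed S" using F(2) by auto
    then have "x \<in> S" using x frontier_subset_closed by blast
    show "x \<in> \<Union>(frontier ` F)"
    proof (rule ccontr)
      assume "\<not> ?thesis"
      then have "x \<in> interior h" if "h \<in> F" for h
        using that \<open>x \<in> S\<close> F(2) cl[OF that] by (auto simp: frontier_def)
      then have "x \<in> (\<Inter>h\<in>F. interior h)" by auto
      then have "x \<in> interior S"
        using interior_maximal[of "\<Inter>h\<in>F. interior h" S] F(1,2) interior_subset
          open_INT[of F interior] by blast
      then show False using x by (simp add: frontier_def)
    qed
  qed
  then show ?thesis using F(1) 1 by (intro exI[of _ "frontier ` F"]) auto
qed

lemma polygonal_domain_arrangement:
  fixes \<Omega> :: "'a::euclidean_space set"
  assumes "polygonal_domain \<Omega>"
  shows "\<exists>AA. arrangement \<Omega> AA"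
proof -
  obtain \<P> where P: "finite \<P>" "\<And>P. P \<in> \<P> \<Longrightarrow> polytope P" "\<Omega> = interior (\<Union>\<P>)" "open \<Omega>" "bounded \<Omega>"
    using assms unfolding polygonal_domain_def by blast
  have "\<forall>P\<in>\<P>. \<exists>\<H>. finite \<H> \<and> (\<forall>h\<in>\<H>. \<exists>P. norm (fst P) = 1 \<and> h = hyperplane P) \<and> frontier P \<subseteq> \<Union>\<H>"
    using P(2) polyhedron_frontier_hyperplanes polytope_imp_polyhedron by blast
  then obtain HH where HH: "\<And>P. P \<in> \<P> \<Longrightarrow> finite (HH P)"
      "\<And>P h. P \<in> \<P> \<Longrightarrow> h \<in> HH P \<Longrightarrow> \<exists>P. norm (fst P) = 1 \<and> h = hyperplane P"
      "\<And>P. P \<in> \<P> \<Longrightarrow> frontier P \<subseteq> \<Union>(HH P)"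
    by metis
  define \<H> where "\<H> = (\<Union>P\<in>\<P>. HH P)"
  have "finite \<H>" using P(1) HH(1) by (auto simp: \<H>_def)
  have "\<forall>h\<in>\<H>. \<exists>P. norm (fst P) = 1 \<and> h = hyperplane P" using HH(2) by (auto simp: \<H>_def)
  \<comment> \<open>The hyperplanes are collected as sets and get a normal only now; one that is
    shared by several polytopes, or occurs with both orientations, thus receives a single
    representative.\<close>
  then obtain rep where rep: "\<And>h. h \<in> \<H> \<Longrightarrow> norm (fst (rep h)) = 1 \<and> h = hyperplane (rep h)" by metis
  have "frontier \<Omega> \<subseteq> frontier (\<Union>\<P>)" unfolding P(3) by (rule frontier_interior_subset)
  also have "\<dots> \<subseteq> (\<Union>P\<in>\<P>. frontier P)" by (rule frontier_Union_subset[OF P(1)])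
  also have "\<dots> \<subseteq> \<Union>\<H>" using HH(3) by (fastforce simp: \<H>_def)
  finally have "frontier \<Omega> \<subseteq> (\<Union>P\<in>rep ` \<H>. hyperplane P)" using rep by fastforce
  then have "arrangement \<Omega> (rep ` \<H>)"
  proof unfold_locales
    fix P Q assume "P \<in> rep ` \<H>" "Q \<in> rep ` \<H>" "P \<noteq> Q"
    then show "hyperplane P \<noteq> hyperplane Q" using rep by (metis imageE)
  qed (use P(4,5) \<open>finite \<H>\<close> rep in auto)
  then show ?thesis by blast
qed

section \<open>Outward normals and facets\<close>

lemma is_outward_normal_frontier:
  assumes "is_outward_normal \<Omega> x \<nu>" and "open \<Omega>"
  shows "x \<in> frontier \<Omega>"
proof -
  obtain r where nu: "norm \<nu> = 1" and r: "r > 0" "\<And>y. y \<in> ball x r \<Longrightarrow> y \<in> \<Omega> \<longleftrightarrow> (y - x) \<bullet> \<nu> < 0"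
    using assms unfolding is_outward_normal_def by blast
  have "x \<notin> \<Omega>" using r(2)[of x] r(1) by simp
  moreover have "x \<in> closure \<Omega>"
    unfolding closure_approachable
  proof (intro allI impI)
    fix d :: real assume "d > 0"
    define t where "t = min (d / 2) (r / 2)"
    have t: "t > 0" "t < d" "t < r" using \<open>d > 0\<close> r(1) by (auto simp: t_def)
    have "\<nu> \<bullet> \<nu> = 1" using nu by (simp add: norm_eq_1)
    then have "x - t *\<^sub>R \<nu> \<in> \<Omega>" using r(2)[of "x - t *\<^sub>R \<nu>"] t nu by (simp add: dist_norm)
    moreover have "dist (x - t *\<^sub>R \<nu>) x < d" using t nu by (simp add: dist_norm)
    ultimately show "\<exists>y\<in>\<Omega>. dist y x < d" by blast
  qed
  ultimately show ?thesis using assms(2) by (simp add: frontier_def interior_open)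
qed

lemma facet_eq:
  assumes "open \<Omega>"
  shows "facet \<Omega> (\<nu>, c) = {x. is_outward_normal \<Omega> x \<nu> \<and> x \<bullet> \<nu> = c}"
  using is_outward_normal_frontier[OF _ assms] by (auto simp: facet_def)

text \<open>A small step from \<open>x\<close> in direction \<open>\<nu> - \<nu>'\<close> has
  positive inner product with \<open>\<nu>\<close> and negative inner product with
  \<open>\<nu>'\<close>, so it would end outside and inside \<open>\<Omega>\<close> at once.\<close>

lemma is_outward_normal_unique:
  assumes "is_outward_normal \<Omega> x \<nu>" "is_outward_normal \<Omega> x \<nu>'"
  shows "\<nu> = \<nu>'"
proof (rule ccontr)
  assume ne: "\<nu> \<noteq> \<nu>'"
  obtain r r' where nu: "norm \<nu> = 1" "norm \<nu>' = 1" and r: "r > 0" "r' > 0"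
    "\<And>y. y \<in> ball x r \<Longrightarrow> y \<in> \<Omega> \<longleftrightarrow> (y - x) \<bullet> \<nu> < 0"
    "\<And>y. y \<in> ball x r' \<Longrightarrow> y \<in> \<Omega> \<longleftrightarrow> (y - x) \<bullet> \<nu>' < 0"
    using assms unfolding is_outward_normal_def by blast
  have nn: "\<nu> \<bullet> \<nu> = 1" "\<nu>' \<bullet> \<nu>' = 1" using nu by (simp_all add: norm_eq_1)
  have "(\<nu> - \<nu>') \<bullet> (\<nu> - \<nu>') > 0" using ne by simp
  then have lt: "\<nu> \<bullet> \<nu>' < 1" by (simp add: inner_diff_left inner_diff_right nn inner_commute)
  have no: "norm (\<nu> - \<nu>') \<le> 2" using norm_triangle_ineq4[of \<nu> \<nu>'] nu by simp
  \<comment> \<open>The step direction has norm at most 2, so a quarter of each radius stays inside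
    both balls.\<close>
  define t where "t = min (r / 4) (r' / 4)"
  have t: "t > 0" "t * norm (\<nu> - \<nu>') < r" "t * norm (\<nu> - \<nu>') < r'"
  proof -
    show "t > 0" using r by (simp add: t_def)
    then have "t * norm (\<nu> - \<nu>') \<le> t * 2" using no by (intro mult_left_mono) auto
    moreover have "t * 2 < r" "t * 2 < r'" using r by (auto simp: t_def)
    ultimately show "t * norm (\<nu> - \<nu>') < r" "t * norm (\<nu> - \<nu>') < r'" by linarith+
  qed
  have a: "((x + t *\<^sub>R (\<nu> - \<nu>')) - x) \<bullet> \<nu> = t * (1 - \<nu> \<bullet> \<nu>')"
    "((x + t *\<^sub>R (\<nu> - \<nu>')) - x) \<bullet> \<nu>' = t * (\<nu> \<bullet> \<nu>' - 1)"
    by (simp_all add: inner_diff_left inner_diff_right nn inner_commute[of \<nu>' \<nu>])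
  have "x + t *\<^sub>R (\<nu> - \<nu>') \<in> ball x r" "x + t *\<^sub>R (\<nu> - \<nu>') \<in> ball x r'"
    using t by (simp_all add: dist_norm)
  then have "t * (1 - \<nu> \<bullet> \<nu>') < 0 \<longleftrightarrow> t * (\<nu> \<bullet> \<nu>' - 1) < 0"
    using r(3,4) a by metis
  moreover have "t * (1 - \<nu> \<bullet> \<nu>') > 0" "t * (\<nu> \<bullet> \<nu>' - 1) < 0"
    using t lt by (simp_all add: mult_less_0_iff)
  ultimately show False by linarith
qed

lemma outward_normal_eq:
  "is_outward_normal \<Omega> x \<nu> \<Longrightarrow> outward_normal \<Omega> x = \<nu>"
  unfolding outward_normal_def using is_outward_normal_unique by (intro the_equality) blast+

text \<open>The hypotheses leave open what happens on the hyperplane itself. If \<open>up\<close> is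
  false, its points near \<open>z\<close> are outside: a neighbourhood of such a point within the
  open set \<open>\<Omega>\<close> would reach the upper side. The converse tests \<open>z\<close>
  shifted by a small multiple of \<open>\<nu>\<close> in both directions.\<close>

lemma is_outward_normal_local:
  assumes "open \<Omega>" and nu: "norm \<nu> = 1" and z: "z \<bullet> \<nu> = c" and r: "r > 0"
    and lo: "\<And>y. y \<in> ball z r \<Longrightarrow> y \<bullet> \<nu> < c \<Longrightarrow> y \<in> \<Omega> \<longleftrightarrow> lo"
    and up: "\<And>y. y \<in> ball z r \<Longrightarrow> y \<bullet> \<nu> > c \<Longrightarrow> y \<in> \<Omega> \<longleftrightarrow> up"
  shows "is_outward_normal \<Omega> z \<nu> \<longleftrightarrow> lo \<and> \<not> up"
proof
  have nn: "\<nu> \<bullet> \<nu> = 1" using nu by (simp_all add: norm_eq_1)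
  assume "is_outward_normal \<Omega> z \<nu>"
  then obtain r' where r': "r' > 0" "\<And>y. y \<in> ball z r' \<Longrightarrow> y \<in> \<Omega> \<longleftrightarrow> (y - z) \<bullet> \<nu> < 0"
    unfolding is_outward_normal_def by blast
  define t where "t = min (r / 2) (r' / 2)"
  have t: "t > 0" "t < r" "t < r'" using r r' by (auto simp: t_def)
  have "z - t *\<^sub>R \<nu> \<in> ball z r" "z - t *\<^sub>R \<nu> \<in> ball z r'" "z + t *\<^sub>R \<nu> \<in> ball z r" "z + t *\<^sub>R \<nu> \<in> ball z r'"
    using t nu by (simp_all add: dist_norm)
  then show "lo \<and> \<not> up"
    using lo[of "z - t *\<^sub>R \<nu>"] up[of "z + t *\<^sub>R \<nu>"] r'(2)[of "z - t *\<^sub>R \<nu>"] r'(2)[of "z + t *\<^sub>R \<nu>"] t z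
    by (simp add: inner_diff_left inner_add_left nn)
next
  have nn: "\<nu> \<bullet> \<nu> = 1" using nu by (simp_all add: norm_eq_1)
  assume lu: "lo \<and> \<not> up"
  have "y \<in> \<Omega> \<longleftrightarrow> (y - z) \<bullet> \<nu> < 0" if y: "y \<in> ball z r" for y
  proof (cases "y \<bullet> \<nu> = c")
    case True
    have "y \<notin> \<Omega>"
    proof
      assume "y \<in> \<Omega>"
      then obtain d where d: "d > 0" "ball y d \<subseteq> \<Omega> \<inter> ball z r"
        using \<open>open \<Omega>\<close> y open_contains_ball[of "\<Omega> \<inter> ball z r"] by blast
      have "y + (d / 2) *\<^sub>R \<nu> \<in> ball y d" using d nu by (simp add: dist_norm)
      then have "y + (d / 2) *\<^sub>R \<nu> \<in> \<Omega>" "y + (d / 2) *\<^sub>R \<nu> \<in> ball z r" using d by auto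
      then show False using up[of "y + (d / 2) *\<^sub>R \<nu>"] lu d True by (simp add: inner_add_left nn)
    qed
    then show ?thesis using True z by (simp add: inner_diff_left)
  next
    case False
    then consider "y \<bullet> \<nu> < c" | "y \<bullet> \<nu> > c" by linarith
    then show ?thesis using lo[OF y] up[OF y] lu z by cases (auto simp: inner_diff_left)
  qed
  then show "is_outward_normal \<Omega> z \<nu>" using nu r unfolding is_outward_normal_def by blast
qed

lemma facet_subset_hyperplane: "facet \<Omega> P \<subseteq> hyperplane P"
  by (auto simp: facet_def hyperplane_def)

text \<open>The half-ball at \<open>x\<close> contains smaller half-balls at all nearby points of
  the hyperplane. Facets are therefore relatively open, which makes them Borel sets and keeps a
  nonempty facet from being a null set.\<close>

lemma facet_contains_disc:
  assumes "open \<Omega>" "x \<in> facet \<Omega> (\<nu>, c)"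
  shows "\<exists>r>0. ball x r \<inter> hyperplane (\<nu>, c) \<subseteq> facet \<Omega> (\<nu>, c)"
proof -
  have x: "is_outward_normal \<Omega> x \<nu>" "x \<bullet> \<nu> = c" using assms(2) by (auto simp: facet_def)
  then obtain r where nu: "norm \<nu> = 1" and r: "r > 0" "\<And>y. y \<in> ball x r \<Longrightarrow> y \<in> \<Omega> \<longleftrightarrow> (y - x) \<bullet> \<nu> < 0"
    unfolding is_outward_normal_def by blast
  have "y \<in> facet \<Omega> (\<nu>, c)" if y: "y \<in> ball x r" "y \<bullet> \<nu> = c" for y
  proof -
    have "ball y (r - dist x y) \<subseteq> ball x r" by (intro ball_subset_ball_iff[THEN iffD2]) (auto simp: dist_commute)
    then have "\<forall>w\<in>ball y (r - dist x y). w \<in> \<Omega> \<longleftrightarrow> (w - y) \<bullet> \<nu> < 0"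
      using r(2) x(2) y(2) by (auto simp: inner_diff_left)
    then have "is_outward_normal \<Omega> y \<nu>"
      using nu y(1) unfolding is_outward_normal_def by (intro conjI exI[of _ "r - dist x y"]) auto
    then show ?thesis using y(2) facet_eq[OF assms(1)] by simp
  qed
  then show ?thesis using r(1) by (intro exI[of _ r]) (auto simp: hyperplane_def)
qed

lemma facet_borel [measurable]:
  assumes "open \<Omega>"
  shows "facet \<Omega> P \<in> sets borel"
proof -
  have "openin (top_of_set (hyperplane P)) (facet \<Omega> P)"
    unfolding openin_contains_ball
    using facet_subset_hyperplane[of \<Omega> P] facet_contains_disc[OF assms, of _ "fst P" "snd P"] by auto
  then obtain U where "open U" "facet \<Omega> P = hyperplane P \<inter> U" by (auto simp: openin_open)
  moreover have "hyperplane P \<in> sets borel" unfolding hyperplane_def by measurable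
  ultimately show ?thesis by auto
qed

lemma hyperplane_borel [measurable]: "hyperplane P \<in> sets borel"
  unfolding hyperplane_def by measurable

section \<open>Difference quotients of the indicator function\<close>

context arrangement
begin

text \<open>A small ball around \<open>z\<close> that avoids the other hyperplanes is cut into two
  half-balls. Each is convex and misses the boundary, hence lies entirely inside or entirely outside
  \<open>\<Omega>\<close>; \<open>lo\<close> and \<open>up\<close> record which. Equal values mean
  that no facet of either orientation passes through \<open>z\<close>.\<close>

lemma local_structure:
  assumes P: "(\<nu>, c) \<in> AA" and z: "z \<bullet> \<nu> = c" and oth: "\<And>Q. Q \<in> AA \<Longrightarrow> Q \<noteq> (\<nu>, c) \<Longrightarrow> z \<notin> hyperplane Q"
  obtains r lo up where "r > 0"
    "\<And>y. y \<in> ball z r \<Longrightarrow> y \<bullet> \<nu> < c \<Longrightarrow> y \<in> \<Omega> \<longleftrightarrow> lo"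
    "\<And>y. y \<in> ball z r \<Longrightarrow> y \<bullet> \<nu> > c \<Longrightarrow> y \<in> \<Omega> \<longleftrightarrow> up"
    "\<And>Q. Q \<in> AA \<Longrightarrow> Q \<noteq> (\<nu>, c) \<Longrightarrow> ball z r \<inter> hyperplane Q = {}"
    "z \<in> facet \<Omega> (\<nu>, c) \<longleftrightarrow> lo \<and> \<not> up"
    "z \<in> facet \<Omega> (- \<nu>, - c) \<longleftrightarrow> up \<and> \<not> lo"
proof -
  have nu: "norm \<nu> = 1" using norm_fst[OF P] by simp
  let ?U = "- (\<Union>Q\<in>AA - {(\<nu>, c)}. hyperplane Q)"
  have "closed (hyperplane Q)" for Q :: "'a \<times> real"
    unfolding hyperplane_def using closed_hyperplane[of "fst Q" "snd Q"] by (simp add: inner_commute)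
  then have "open ?U" using finite_AA by (intro open_Compl closed_UN) auto
  moreover have "z \<in> ?U" using oth by auto
  ultimately obtain r where r: "r > 0" "ball z r \<subseteq> ?U" by (rule openE)
  have const: "\<exists>b. \<forall>y\<in>H. y \<in> \<Omega> \<longleftrightarrow> b" if "convex H" "H \<subseteq> ball z r" "H \<inter> hyperplane (\<nu>, c) = {}" for H
  proof -
    have "H \<inter> frontier \<Omega> = {}" using frontier_subset that r(2) by blast
    then have "H \<inter> \<Omega> = {} \<or> H - \<Omega> = {}"
      using connected_Int_frontier[OF convex_connected[OF that(1)]] by blast
    then show ?thesis by blast
  qed
  have "convex {y. y \<bullet> \<nu> < c}" using convex_halfspace_lt[where a = \<nu> and b = c] by (simp add: inner_commute)
  then have "\<exists>b. \<forall>y\<in>ball z r \<inter> {y. y \<bullet> \<nu> < c}. y \<in> \<Omega> \<longleftrightarrow> b"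
    by (intro const convex_Int convex_ball) (auto simp: hyperplane_def)
  then obtain lo where "\<forall>y\<in>ball z r \<inter> {y. y \<bullet> \<nu> < c}. y \<in> \<Omega> \<longleftrightarrow> lo" ..
  then have lo: "\<And>y. y \<in> ball z r \<Longrightarrow> y \<bullet> \<nu> < c \<Longrightarrow> y \<in> \<Omega> \<longleftrightarrow> lo" by blast
  have "convex {y. y \<bullet> \<nu> > c}" using convex_halfspace_gt[where a = \<nu> and b = c] by (simp add: inner_commute)
  then have "\<exists>b. \<forall>y\<in>ball z r \<inter> {y. y \<bullet> \<nu> > c}. y \<in> \<Omega> \<longleftrightarrow> b"
    by (intro const convex_Int convex_ball) (auto simp: hyperplane_def)
  then obtain up where "\<forall>y\<in>ball z r \<inter> {y. y \<bullet> \<nu> > c}. y \<in> \<Omega> \<longleftrightarrow> up" ..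
  then have up: "\<And>y. y \<in> ball z r \<Longrightarrow> y \<bullet> \<nu> > c \<Longrightarrow> y \<in> \<Omega> \<longleftrightarrow> up" by blast
  have 1: "is_outward_normal \<Omega> z \<nu> \<longleftrightarrow> lo \<and> \<not> up"
    by (rule is_outward_normal_local[OF open_domain nu z r(1) lo up])
  have 2: "is_outward_normal \<Omega> z (- \<nu>) \<longleftrightarrow> up \<and> \<not> lo"
    by (rule is_outward_normal_local[where \<nu> = "- \<nu>" and c = "- c" and r = r]) (use open_domain r(1) nu z lo up in auto)
  show thesis
  proof (rule that[OF r(1) lo up])
    show "ball z r \<inter> hyperplane Q = {}" if "Q \<in> AA" "Q \<noteq> (\<nu>, c)" for Q
      using r(2) that by blast
    show "z \<in> facet \<Omega> (\<nu>, c) \<longleftrightarrow> lo \<and> \<not> up" "z \<in> facet \<Omega> (- \<nu>, - c) \<longleftrightarrow> up \<and> \<not> lo"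
      using 1 2 z by (simp_all add: facet_eq[OF open_domain])
  qed
qed

text \<open>A point may be close to several hyperplanes. Dividing by their number distributes the
  difference quotient over the hyperplanes.\<close>

definition near :: "'a \<times> real \<Rightarrow> real \<Rightarrow> 'a \<Rightarrow> real" where
  "near P s x = indicator {x. \<bar>x \<bullet> fst P - snd P\<bar> \<le> s} x"

definition mult_near :: "real \<Rightarrow> 'a \<Rightarrow> real" where
  "mult_near s x = (\<Sum>Q\<in>AA. near Q s x)"

definition shift_diff :: "'a \<Rightarrow> real \<Rightarrow> 'a \<Rightarrow> real" where
  "shift_diff e s x = indicator \<Omega> (x - s *\<^sub>R e) - indicator \<Omega> x"

lemma measurable_near [measurable]: "near P s \<in> borel_measurable borel"
  unfolding near_def by measurable

lemma measurable_mult_near [measurable]: "mult_near s \<in> borel_measurable borel"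
  unfolding mult_near_def by measurable

lemma measurable_shift_diff [measurable]: "shift_diff e s \<in> borel_measurable borel"
proof -
  have [measurable]: "\<Omega> \<in> sets borel" using open_domain by simp
  show ?thesis unfolding shift_diff_def by measurable
qed

lemma near_nonneg: "near P s x \<ge> 0" and near_le_1: "near P s x \<le> 1"
  by (auto simp: near_def indicator_def)

lemma near_le_mult_near: "P \<in> AA \<Longrightarrow> near P s x \<le> mult_near s x"
  unfolding mult_near_def using finite_AA by (intro member_le_sum) (auto simp: near_nonneg)

text \<open>The numerator is one of the nonnegative summands of the denominator; far from all
  hyperplanes the quotient is 0 because division by 0 gives 0.\<close>

lemma weight_bounds:
  assumes "P \<in> AA"
  shows "0 \<le> near P s x / mult_near s x" "near P s x / mult_near s x \<le> 1"
  using near_le_mult_near[OF assms, of s x] near_nonneg[of P s x]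
  by (auto simp: divide_le_eq_1)

text \<open>The segment from \<open>x - s *\<^sub>R e\<close> to \<open>x\<close> has one end in
  \<open>\<Omega>\<close> and one outside, so it meets the boundary and with it some hyperplane, at
  a distance of at most \<open>s\<close> from \<open>x\<close>.\<close>

lemma shift_diff_near:
  assumes e: "norm e \<le> 1" and s: "s > 0" and ne: "shift_diff e s x \<noteq> 0"
  shows "mult_near s x > 0"
proof -
  have "x \<in> \<Omega> \<longleftrightarrow> x - s *\<^sub>R e \<notin> \<Omega>"
    using ne unfolding shift_diff_def by (cases "x \<in> \<Omega>"; cases "x - s *\<^sub>R e \<in> \<Omega>"; simp)
  then have "closed_segment (x - s *\<^sub>R e) x \<inter> \<Omega> \<noteq> {}" "closed_segment (x - s *\<^sub>R e) x - \<Omega> \<noteq> {}"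
    using ends_in_segment[of "x - s *\<^sub>R e" x] by blast+
  then obtain y where y: "y \<in> closed_segment (x - s *\<^sub>R e) x" "y \<in> frontier \<Omega>"
    using connected_Int_frontier[of "closed_segment (x - s *\<^sub>R e) x" \<Omega>] by auto
  then obtain Q where Q: "Q \<in> AA" "y \<bullet> fst Q = snd Q" using frontier_subset by (auto simp: hyperplane_def)
  have "norm (x - y) \<le> norm (x - (x - s *\<^sub>R e))"
    using segment_bound(2)[OF y(1)] by (simp add: norm_minus_commute)
  also have "\<dots> \<le> s" using e s by (simp add: mult_left_le)
  finally have "\<bar>(x - y) \<bullet> fst Q\<bar> \<le> s"
    using Cauchy_Schwarz_ineq2[of "x - y" "fst Q"] norm_fst[OF Q(1)] by simp
  then have "near Q s x = 1" using Q(2) by (simp add: near_def inner_diff_left)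
  then show ?thesis using near_le_mult_near[OF Q(1), of s x] by simp
qed

text \<open>Where the difference is not 0, \<open>mult_near\<close> is positive and the weights add
  up to 1; elsewhere both sides are 0.\<close>

lemma shift_diff_split:
  assumes "norm e \<le> 1" "s > 0"
  shows "g x * shift_diff e s x = (\<Sum>P\<in>AA. g x * shift_diff e s x * (near P s x / mult_near s x))"
proof (cases "shift_diff e s x = 0")
  case False
  then have "mult_near s x > 0" using shift_diff_near assms by blast
  moreover have "(\<Sum>P\<in>AA. near P s x / mult_near s x) = mult_near s x / mult_near s x"
    unfolding mult_near_def by (rule sum_divide_distrib[symmetric])
  ultimately show ?thesis by (subst sum_distrib_left[symmetric]) simp
qed simp

text \<open>The same hyperplane may carry facets of both orientations.\<close>

definition facet_sign :: "'a \<times> real \<Rightarrow> 'a \<Rightarrow> real" where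
  "facet_sign P z = indicator (facet \<Omega> P) z - indicator (facet \<Omega> (- fst P, - snd P)) z"

lemma measurable_facet_sign [measurable]: "facet_sign P \<in> borel_measurable borel"
proof -
  have [measurable]: "facet \<Omega> Q \<in> sets borel" for Q using facet_borel[OF open_domain] .
  show ?thesis unfolding facet_sign_def by measurable
qed

text \<open>Close to a point that lies on only one hyperplane of the arrangement, the domain is a
  half-ball, a ball, or empty (up to that hyperplane). In the coordinates \<open>z + s \<tau> \<nu>\<close> the rescaled
  difference quotient of the indicator function is then eventually constant in \<open>s\<close>.\<close>

lemma shift_diff_pointwise:
  assumes P: "(\<nu>, c) \<in> AA" and z: "z \<bullet> \<nu> = c"
    and oth: "\<And>Q. Q \<in> AA \<Longrightarrow> Q \<noteq> (\<nu>, c) \<Longrightarrow> z \<notin> hyperplane Q"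
    and e: "norm e \<le> 1" and tau: "\<tau> \<noteq> 0" "\<tau> \<noteq> e \<bullet> \<nu>"
  shows "\<exists>\<delta>>0. \<forall>s. 0 < s \<and> s < \<delta> \<longrightarrow> (let x = z + (s * \<tau>) *\<^sub>R \<nu> in
      shift_diff e s x * (near (\<nu>, c) s x / mult_near s x)) =
      (indicator {..<e \<bullet> \<nu>} \<tau> - indicator {..<0} \<tau>) * facet_sign (\<nu>, c) z"
proof -
  have nu: "norm \<nu> = 1" using norm_fst[OF P] by simp
  have nn: "\<nu> \<bullet> \<nu> = 1" using nu by (simp add: norm_eq_1)
  have en: "\<bar>e \<bullet> \<nu>\<bar> \<le> 1" using Cauchy_Schwarz_ineq2[of e \<nu>] nu e by simp
  show ?thesis
  proof (cases "\<bar>\<tau>\<bar> \<le> 1")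
    \<comment> \<open>The point is now further than \<open>s\<close> from the hyperplane, so its
      weight is 0. The limit is 0 too: both jumps of the profile lie in \<open>{- 1..1}\<close>,
      since \<open>\<bar>e \<bullet> \<nu>\<bar> \<le> 1\<close>, and the two indicators agree at
      \<open>\<tau>\<close>.\<close>
    case False
    have "near (\<nu>, c) s (z + (s * \<tau>) *\<^sub>R \<nu>) = 0" if "s > 0" for s
    proof -
      have "\<bar>s * \<tau>\<bar> > s" using that False by (simp add: abs_mult)
      then show ?thesis by (simp add: near_def inner_add_left nn z)
    qed
    moreover have "indicator {..<e \<bullet> \<nu>} \<tau> = (indicator {..<0} \<tau> :: real)"
      using False en by (auto simp: indicator_def)
    ultimately show ?thesis by (intro exI[of _ 1]) (auto simp: Let_def)
  next
    case True
    obtain r lo up where r: "r > 0"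
      and lo: "\<And>y. y \<in> ball z r \<Longrightarrow> y \<bullet> \<nu> < c \<Longrightarrow> y \<in> \<Omega> \<longleftrightarrow> lo"
      and up: "\<And>y. y \<in> ball z r \<Longrightarrow> y \<bullet> \<nu> > c \<Longrightarrow> y \<in> \<Omega> \<longleftrightarrow> up"
      and dis: "\<And>Q. Q \<in> AA \<Longrightarrow> Q \<noteq> (\<nu>, c) \<Longrightarrow> ball z r \<inter> hyperplane Q = {}"
      and f: "z \<in> facet \<Omega> (\<nu>, c) \<longleftrightarrow> lo \<and> \<not> up" "z \<in> facet \<Omega> (- \<nu>, - c) \<longleftrightarrow> up \<and> \<not> lo"
      by (rule local_structure[OF P z oth]) (assumption | rule that)+
    \<comment> \<open>With \<open>s < r / 2\<close>, both \<open>x\<close> and its translate stay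
      within \<open>2 * s < r\<close> of \<open>z\<close>, where no other hyperplane is
      present.\<close>
    have main: "shift_diff e s x * (near (\<nu>, c) s x / mult_near s x) =
      (indicator {..<e \<bullet> \<nu>} \<tau> - indicator {..<0} \<tau>) * facet_sign (\<nu>, c) z"
      if s: "0 < s" "s < r / 2" and x: "x = z + (s * \<tau>) *\<^sub>R \<nu>" for s x
    proof -
      have st: "\<bar>s * \<tau>\<bar> \<le> s" using s True by (simp add: abs_mult mult_left_le)
      have xz: "norm (x - z) \<le> s" using st nu by (simp add: x)
      have se: "norm (s *\<^sub>R e) \<le> s" using e s by (simp add: mult_left_le)
      have xb: "x \<in> ball z r" using xz s by (simp add: dist_norm norm_minus_commute)
      have "norm (x - s *\<^sub>R e - z) \<le> s + s"
        using norm_triangle_ineq4[of "x - z" "s *\<^sub>R e"] xz se by (simp add: algebra_simps)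
      then have yb: "x - s *\<^sub>R e \<in> ball z r" using s by (simp add: dist_norm norm_minus_commute)
      have xn: "x \<bullet> \<nu> = c + s * \<tau>" by (simp add: x inner_add_left z nn)
      have yn: "(x - s *\<^sub>R e) \<bullet> \<nu> = c + s * (\<tau> - e \<bullet> \<nu>)" by (simp add: inner_diff_left xn algebra_simps)
      have near1: "near (\<nu>, c) s x = 1" using st by (simp add: near_def xn)
      \<comment> \<open>The foot of the perpendicular from \<open>z\<close> to \<open>Q\<close> is
        outside the ball, so \<open>z\<close> has distance at least \<open>r\<close> from
        \<open>Q\<close>, and \<open>x\<close> has at least \<open>r - s > s\<close>.\<close>
      have near0: "near Q s x = 0" if Q: "Q \<in> AA" "Q \<noteq> (\<nu>, c)" for Q
      proof -
        have q: "norm (fst Q) = 1" "fst Q \<bullet> fst Q = 1" using norm_fst[OF Q(1)] by (simp_all add: norm_eq_1)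
        have "z - (z \<bullet> fst Q - snd Q) *\<^sub>R fst Q \<in> hyperplane Q"
          by (simp add: hyperplane_def inner_diff_left q)
        then have "z - (z \<bullet> fst Q - snd Q) *\<^sub>R fst Q \<notin> ball z r" using dis[OF Q] by blast
        then have a: "\<bar>z \<bullet> fst Q - snd Q\<bar> \<ge> r" using q by (simp add: dist_norm)
        have "\<bar>(x - z) \<bullet> fst Q\<bar> \<le> s" using Cauchy_Schwarz_ineq2[of "x - z" "fst Q"] q xz by simp
        then have "\<bar>x \<bullet> fst Q - snd Q\<bar> > s" using a s by (simp add: inner_diff_left)
        then show ?thesis by (simp add: near_def)
      qed
      have "mult_near s x = (\<Sum>Q\<in>{(\<nu>, c)}. near Q s x)"
        unfolding mult_near_def using P near0 finite_AA by (intro sum.mono_neutral_right) auto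
      then have m: "mult_near s x = 1" using near1 by simp
      \<comment> \<open>The sign of \<open>\<tau>\<close> tells on which side \<open>x\<close> lies,
        and the sign of \<open>\<tau> - e \<bullet> \<nu>\<close> does so for the translate. The two
        excluded values of \<open>\<tau>\<close> are those that put one of these points on the
        hyperplane.\<close>
      have ix: "indicator \<Omega> x = (if \<tau> < 0 then of_bool lo else of_bool up :: real)"
      proof (cases "\<tau> < 0")
        case True
        then have "s * \<tau> < 0" using s by (simp add: mult_less_0_iff)
        then show ?thesis using lo[OF xb] True xn by (simp add: indicator_def)
      next
        case False
        then have "s * \<tau> > 0" using s tau by simp
        then show ?thesis using up[OF xb] False xn by (simp add: indicator_def)
      qed
      have iy: "indicator \<Omega> (x - s *\<^sub>R e) = (if \<tau> < e \<bullet> \<nu> then of_bool lo else of_bool up :: real)"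
      proof (cases "\<tau> < e \<bullet> \<nu>")
        case True
        then have "s * (\<tau> - e \<bullet> \<nu>) < 0" using s by (simp add: mult_less_0_iff)
        then show ?thesis using lo[OF yb] True yn by (simp add: indicator_def)
      next
        case False
        then have "s * (\<tau> - e \<bullet> \<nu>) > 0" using s tau by simp
        then show ?thesis using up[OF yb] False yn by (simp add: indicator_def)
      qed
      have fs: "facet_sign (\<nu>, c) z = of_bool lo - of_bool up"
        using f by (auto simp: facet_sign_def indicator_def)
      show ?thesis
        unfolding shift_diff_def near1 m ix iy fs by (auto simp: indicator_def)
    qed
    show ?thesis using r main by (intro exI[of _ "r / 2"]) (auto simp: Let_def)
  qed
qed

end

section \<open>Limits of the rescaled difference quotients\<close>

lemma continuous_bounded_cball:
  fixes g :: "'a::euclidean_space \<Rightarrow> 'b::real_normed_vector"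
  assumes "continuous_on UNIV g"
  obtains C where "\<And>x. norm x \<le> R \<Longrightarrow> norm (g x) \<le> C"
proof -
  have "compact (g ` cball 0 R)"
    by (intro compact_continuous_image continuous_on_subset[OF assms]) auto
  then obtain C where "\<forall>y\<in>g ` cball 0 R. norm y \<le> C"
    using compact_imp_bounded bounded_iff by metis
  then show thesis by (intro that[of C]) simp
qed

context arrangement
begin

lemma shift_diff_bounded_support:
  assumes e: "norm e \<le> 1"
  obtains R where "R > 0" "\<And>s x. 0 < s \<Longrightarrow> s \<le> 1 \<Longrightarrow> shift_diff e s x \<noteq> 0 \<Longrightarrow> norm x \<le> R"
proof -
  obtain R0 where R0: "\<And>x. x \<in> \<Omega> \<Longrightarrow> norm x \<le> R0" using bounded_domain by (auto simp: bounded_iff)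
  have "norm x \<le> \<bar>R0\<bar> + 1" if s: "0 < s" "s \<le> 1" "shift_diff e s x \<noteq> 0" for s x
  proof -
    have "norm (s *\<^sub>R e) \<le> 1" using s e by (simp add: mult_le_one)
    then have "norm x \<le> norm (x - s *\<^sub>R e) + 1"
      using norm_triangle_ineq[of "x - s *\<^sub>R e" "s *\<^sub>R e"] by simp
    moreover have "x \<in> \<Omega> \<or> x - s *\<^sub>R e \<in> \<Omega>"
      using s(3) by (auto simp: shift_diff_def indicator_def)
    ultimately show ?thesis using R0 by fastforce
  qed
  then show thesis by (intro that[of "\<bar>R0\<bar> + 1"]) auto
qed

text \<open>The integral of the limiting profile across a facet is the origin of the factor
  \<open>e \<bullet> \<nu>\<close>; a negative \<open>a\<close> contributes minus a length.\<close>

lemma integral_jump: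
  assumes "\<bar>a::real\<bar> \<le> 1"
  shows "(\<integral>t. indicator {..<a} t - indicator {..<0} t \<partial>lborel) = a"
proof (cases "a \<ge> 0")
  case True
  have "(\<lambda>t. indicator {..<a} t - indicator {..<0} t :: real) = indicator {0..<a}"
    using True by (auto simp: indicator_def)
  then show ?thesis using True by simp
next
  case False
  have "(\<lambda>t. indicator {..<a} t - indicator {..<0} t :: real) = (\<lambda>t. - indicator {a..<0} t)"
    using False by (auto simp: indicator_def)
  then show ?thesis using False by simp
qed

text \<open>After the change of variables the prefactor \<open>1 / s k\<close> is gone, and the
  integrands converge a.e. on the product of the line with the hyperplane. The limit is a function
  of the normal variable times one of the tangential variable, so Fubini gives the jump integral
  times a facet integral.\<close>

lemma tendsto_shift_diff_piece:
  fixes g :: "'a \<Rightarrow> real"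
  assumes P: "(\<nu>, c) \<in> AA" and e: "norm e \<le> 1" and g: "continuous_on UNIV g"
    and s: "\<And>k. 0 < s k" "\<And>k. s k \<le> 1" "s \<longlonglongrightarrow> 0"
  shows "(\<lambda>k. 1 / s k * (\<integral>x. g x * shift_diff e (s k) x * (near (\<nu>, c) (s k) x / mult_near (s k) x) \<partial>lborel))
    \<longlonglongrightarrow> (e \<bullet> \<nu>) * (\<integral>z. g z * facet_sign (\<nu>, c) z \<partial>hyperplane_measure (\<nu>, c))"
proof -
  have nu: "norm \<nu> = 1" using norm_fst[OF P] by simp
  have nn: "\<nu> \<bullet> \<nu> = 1" using nu by (simp add: norm_eq_1)
  have en: "\<bar>e \<bullet> \<nu>\<bar> \<le> 1" using Cauchy_Schwarz_ineq2[of e \<nu>] nu e by simp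
  have [measurable]: "g \<in> borel_measurable borel" using g by (rule borel_measurable_continuous_onI)
  interpret H: sigma_finite_measure "hyperplane_measure (\<nu>, c)"
    by (rule sigma_finite_hyperplane_measure[OF nu])
  interpret pair_sigma_finite lborel "hyperplane_measure (\<nu>, c)" ..
  let ?M = "lborel \<Otimes>\<^sub>M hyperplane_measure (\<nu>, c)"
  define \<kappa> :: "real \<Rightarrow> real" where "\<kappa> t = indicator {..<e \<bullet> \<nu>} t - indicator {..<0} t" for t
  have [measurable]: "\<kappa> \<in> borel_measurable borel" unfolding \<kappa>_def by measurable
  define F where "F k x = g x * shift_diff e (s k) x * (near (\<nu>, c) (s k) x / mult_near (s k) x)" for k x
  have [measurable]: "F k \<in> borel_measurable borel" for k unfolding F_def by measurable
  define f where "f k p = F k (snd p + (s k * fst p) *\<^sub>R \<nu>)" for k and p :: "real \<times> 'a"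
  define f0 where "f0 p = \<kappa> (fst p) * (g (snd p) * facet_sign (\<nu>, c) (snd p))" for p :: "real \<times> 'a"
  obtain R where R: "R > 0" "\<And>s x. 0 < s \<Longrightarrow> s \<le> 1 \<Longrightarrow> shift_diff e s x \<noteq> 0 \<Longrightarrow> norm x \<le> R"
    using shift_diff_bounded_support[OF e] by blast
  obtain C where C: "\<And>x. norm x \<le> R \<Longrightarrow> \<bar>g x\<bar> \<le> C"
    using continuous_bounded_cball[of g "R"] g by (metis real_norm_def)
  \<comment> \<open>The weight \<open>near\<close> forces the normal coordinate into
    \<open>{-1..1}\<close>, and the bounded support gives \<open>norm x \<le> R\<close>. As
    \<open>s k \<le> 1\<close>, the foot point then has norm at most \<open>R + 1\<close>.\<close>
  define w where "w p = C * (indicator {-1..1} (fst p) * indicator (cball 0 (R + 1)) (snd p))" for p :: "real \<times> 'a"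
  have C0: "C \<ge> 0" using C[of 0] R(1) by simp
  \<comment> \<open>Pointwise convergence is available only at points that lie on no second
    hyperplane; the others form a null set by \<open>AE_hyperplane_measure_other\<close>.\<close>
  define G where "G = {z. z \<bullet> \<nu> = c} - (\<Union>Q\<in>AA - {(\<nu>, c)}. hyperplane Q)"
  have [measurable]: "G \<in> sets borel"
    unfolding G_def using finite_AA by (intro sets.Diff sets.finite_UN) auto
  have "AE z in hyperplane_measure (\<nu>, c). \<forall>Q\<in>AA - {(\<nu>, c)}. z \<notin> hyperplane Q"
  proof (rule AE_finite_allI)
    show "finite (AA - {(\<nu>, c)})" using finite_AA by simp
    fix Q assume Q: "Q \<in> AA - {(\<nu>, c)}"
    then have "hyperplane (\<nu>, c) \<noteq> hyperplane Q" using hyperplane_inj[OF P, of Q] by auto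
    then show "AE z in hyperplane_measure (\<nu>, c). z \<notin> hyperplane Q"
      using AE_hyperplane_measure_other[OF nu, of c "fst Q" "snd Q"] norm_fst Q
      by (auto simp: hyperplane_def)
  qed
  then have "AE z in hyperplane_measure (\<nu>, c). z \<in> G"
    using AE_hyperplane_measure[OF nu, of c] by eventually_elim (auto simp: G_def)
  moreover have "AE \<tau> in lborel. \<tau> \<notin> {0, e \<bullet> \<nu>}"
    by (intro AE_not_in countable_imp_null_set_lborel) auto
  ultimately have "AE \<tau> in lborel. AE z in hyperplane_measure (\<nu>, c). \<tau> \<notin> {0, e \<bullet> \<nu>} \<and> z \<in> G"
    by (auto elim!: AE_mp)
  moreover have "{p \<in> space ?M. fst p \<notin> {0, e \<bullet> \<nu>} \<and> snd p \<in> G} = (- {0, e \<bullet> \<nu>}) \<times> G"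
    by (auto simp: space_pair_measure)
  then have "{p \<in> space ?M. fst p \<notin> {0, e \<bullet> \<nu>} \<and> snd p \<in> G} \<in> sets ?M"
    by (simp only:) (intro pair_measureI; simp)
  ultimately have good: "AE p in ?M. fst p \<notin> {0, e \<bullet> \<nu>} \<and> snd p \<in> G"
    by (intro AE_pair_measure) simp_all
  have f0m: "f0 \<in> borel_measurable ?M" unfolding f0_def by measurable
  have fm: "f k \<in> borel_measurable ?M" for k unfolding f_def by measurable
  have wi: "integrable ?M w"
  proof -
    have "emeasure ?M ({-1..1::real} \<times> cball 0 (R + 1)) = emeasure lborel {-1..1::real} * emeasure (hyperplane_measure (\<nu>, c)) (cball 0 (R + 1))"
      by (rule H.emeasure_pair_measure_Times) auto
    also have "\<dots> < \<infinity>"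
      using emeasure_hyperplane_measure_bounded[OF nu, of "cball 0 (R + 1)" c] by (simp add: ennreal_mult_less_top)
    finally have fin: "emeasure ?M ({-1..1::real} \<times> cball 0 (R + 1)) < \<infinity>" .
    have ms: "{-1..1::real} \<times> cball 0 (R + 1) \<in> sets ?M" by (intro pair_measureI) auto
    have "integrable ?M (\<lambda>p. C * indicator ({-1..1::real} \<times> cball 0 (R + 1)) p)"
      by (intro integrable_mult_right integrable_real_indicator ms fin)
    then show ?thesis unfolding w_def[abs_def] indicator_times .
  qed
  have fl: "AE p in ?M. (\<lambda>k. f k p) \<longlonglongrightarrow> f0 p"
    using good
  proof eventually_elim
    case (elim p)
    have z: "snd p \<bullet> \<nu> = c" and oth: "\<And>Q. Q \<in> AA \<Longrightarrow> Q \<noteq> (\<nu>, c) \<Longrightarrow> snd p \<notin> hyperplane Q"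
      using elim by (auto simp: G_def)
    obtain \<delta> where d: "\<delta> > 0" "\<And>s. 0 < s \<Longrightarrow> s < \<delta> \<Longrightarrow> shift_diff e s (snd p + (s * fst p) *\<^sub>R \<nu>) *
        (near (\<nu>, c) s (snd p + (s * fst p) *\<^sub>R \<nu>) / mult_near s (snd p + (s * fst p) *\<^sub>R \<nu>)) =
        \<kappa> (fst p) * facet_sign (\<nu>, c) (snd p)"
      using shift_diff_pointwise[OF P z oth e, of "fst p"] elim unfolding \<kappa>_def Let_def by blast
    have "(\<lambda>k. g (snd p + (s k * fst p) *\<^sub>R \<nu>)) \<longlonglongrightarrow> g (snd p + (0 * fst p) *\<^sub>R \<nu>)"
      using g by (intro isCont_tendsto_compose[where g = g] tendsto_intros s(3)) (auto simp: continuous_on_eq_continuous_at)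
    then have "(\<lambda>k. g (snd p + (s k * fst p) *\<^sub>R \<nu>) * (\<kappa> (fst p) * facet_sign (\<nu>, c) (snd p))) \<longlonglongrightarrow>
        g (snd p) * (\<kappa> (fst p) * facet_sign (\<nu>, c) (snd p))"
      by (intro tendsto_mult_right) simp
    moreover have "\<forall>\<^sub>F k in sequentially. g (snd p + (s k * fst p) *\<^sub>R \<nu>) * (\<kappa> (fst p) * facet_sign (\<nu>, c) (snd p)) = f k p"
      using order_tendstoD(2)[OF s(3) d(1)]
    proof eventually_elim
      case (elim k)
      show ?case unfolding f_def F_def d(2)[OF s(1) elim, symmetric] by (simp add: mult.assoc)
    qed
    ultimately have "(\<lambda>k. f k p) \<longlonglongrightarrow> g (snd p) * (\<kappa> (fst p) * facet_sign (\<nu>, c) (snd p))"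
      by (rule Lim_transform_eventually)
    then show ?case by (simp add: f0_def mult_ac)
  qed
  have fb: "AE p in ?M. norm (f k p) \<le> w p" for k
    using good
  proof eventually_elim
    case (elim p)
    define x where "x = snd p + (s k * fst p) *\<^sub>R \<nu>"
    have z: "snd p \<bullet> \<nu> = c" using elim by (auto simp: G_def)
    have xn: "x \<bullet> \<nu> - c = s k * fst p" by (simp add: x_def inner_add_left nn z)
    have fk: "f k p = g x * shift_diff e (s k) x * (near (\<nu>, c) (s k) x / mult_near (s k) x)"
      by (simp add: f_def F_def x_def)
    show ?case
    proof (cases "f k p = 0")
      case True
      then show ?thesis using C0 by (simp add: w_def)
    next
      case False
      then have "near (\<nu>, c) (s k) x \<noteq> 0" "shift_diff e (s k) x \<noteq> 0" by (auto simp: fk)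
      then have n: "\<bar>s k * fst p\<bar> \<le> s k" and x: "norm x \<le> R"
        using R(2)[OF s(1,2)] xn by (auto simp: near_def indicator_def split: if_splits)
      have t: "\<bar>fst p\<bar> \<le> 1" using n s(1)[of k] by (simp add: abs_mult)
      have "norm (snd p) \<le> norm x + norm ((s k * fst p) *\<^sub>R \<nu>)"
        using norm_triangle_ineq4[of x "(s k * fst p) *\<^sub>R \<nu>"] by (simp add: x_def)
      also have "\<dots> \<le> R + 1" using x n s(2)[of k] nu by simp
      finally have w: "w p = C" using t by (simp add: w_def abs_le_iff)
      have a: "\<bar>shift_diff e (s k) x\<bar> \<le> 1" by (auto simp: shift_diff_def indicator_def)
      have "\<bar>g x\<bar> * \<bar>shift_diff e (s k) x\<bar> * \<bar>near (\<nu>, c) (s k) x / mult_near (s k) x\<bar> \<le> C * 1 * 1"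
        using weight_bounds[OF P, of "s k" x] C[OF x] a C0 by (intro mult_mono) auto
      then show ?thesis by (simp add: fk w abs_mult)
    qed
  qed
  have lim: "(\<lambda>k. integral\<^sup>L ?M (f k)) \<longlonglongrightarrow> integral\<^sup>L ?M f0"
    by (rule integral_dominated_convergence[OF f0m fm wi fl fb])
  have int: "integrable ?M f0"
    by (rule integrable_dominated_convergence[OF f0m fm wi fl fb])
  have "integral\<^sup>L ?M (f k) = 1 / s k * (\<integral>x. F k x \<partial>lborel)" for k
    unfolding f_def by (rule integral_hyperplane_disintegration[OF nu s(1)]) measurable
  moreover have "integral\<^sup>L ?M f0 = (e \<bullet> \<nu>) * (\<integral>z. g z * facet_sign (\<nu>, c) z \<partial>hyperplane_measure (\<nu>, c))"
  proof -
    have "integral\<^sup>L ?M f0 = (\<integral>t. (\<integral>z. f0 (t, z) \<partial>hyperplane_measure (\<nu>, c)) \<partial>lborel)"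
      by (rule integral_fst'[symmetric, OF int])
    also have "\<dots> = (\<integral>t. \<kappa> t \<partial>lborel) * (\<integral>z. g z * facet_sign (\<nu>, c) z \<partial>hyperplane_measure (\<nu>, c))"
      by (simp add: f0_def)
    finally show ?thesis using integral_jump[OF en] by (simp add: \<kappa>_def)
  qed
  ultimately show ?thesis using lim by (simp add: F_def)
qed

lemma tendsto_shift_diff:
  fixes g :: "'a \<Rightarrow> real"
  assumes e: "norm e \<le> 1" and g: "continuous_on UNIV g"
    and s: "\<And>k. 0 < s k" "\<And>k. s k \<le> 1" "s \<longlonglongrightarrow> 0"
  shows "(\<lambda>k. 1 / s k * (\<integral>x. g x * shift_diff e (s k) x \<partial>lborel))
    \<longlonglongrightarrow> (\<Sum>P\<in>AA. (e \<bullet> fst P) * (\<integral>z. g z * facet_sign P z \<partial>hyperplane_measure P))"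
proof -
  have [measurable]: "g \<in> borel_measurable borel" using g by (rule borel_measurable_continuous_onI)
  obtain R where R: "R > 0" "\<And>s x. 0 < s \<Longrightarrow> s \<le> 1 \<Longrightarrow> shift_diff e s x \<noteq> 0 \<Longrightarrow> norm x \<le> R"
    using shift_diff_bounded_support[OF e] by blast
  obtain C where C: "\<And>x. norm x \<le> R \<Longrightarrow> \<bar>g x\<bar> \<le> C"
    using continuous_bounded_cball[of g "R"] g by (metis real_norm_def)
  have C0: "C \<ge> 0" using C[of 0] R(1) by simp
  have int: "integrable lborel (\<lambda>x. g x * shift_diff e (s k) x * (near P (s k) x / mult_near (s k) x))"
    if "P \<in> AA" for k P
  proof (rule Bochner_Integration.integrable_bound[of lborel "\<lambda>x. C * indicator (cball 0 R) x :: real"])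
    show "integrable lborel (\<lambda>x. C * indicator (cball (0::'a) R) x :: real)"
      using emeasure_bounded_finite[OF bounded_cball, of "0::'a" R]
      by (intro integrable_mult_right integrable_real_indicator) auto
    show "AE x in lborel. norm (g x * shift_diff e (s k) x * (near P (s k) x / mult_near (s k) x))
        \<le> norm (C * indicator (cball 0 R) x :: real)"
    proof (rule AE_I2)
      fix x :: 'a
      show "norm (g x * shift_diff e (s k) x * (near P (s k) x / mult_near (s k) x))
        \<le> norm (C * indicator (cball 0 R) x :: real)"
      proof (cases "shift_diff e (s k) x = 0")
        case False
        then have x: "norm x \<le> R" using R(2)[OF s(1,2)] by blast
        have a: "\<bar>shift_diff e (s k) x\<bar> \<le> 1" by (auto simp: shift_diff_def indicator_def)
        have "\<bar>g x\<bar> * \<bar>shift_diff e (s k) x\<bar> * \<bar>near P (s k) x / mult_near (s k) x\<bar> \<le> C * 1 * 1"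
          using weight_bounds[OF that, of "s k" x] C[OF x] a C0 by (intro mult_mono) auto
        then show ?thesis using x C0 by (simp add: abs_mult)
      qed simp
    qed
  qed measurable
  have "(\<lambda>k. \<Sum>P\<in>AA. 1 / s k * (\<integral>x. g x * shift_diff e (s k) x * (near P (s k) x / mult_near (s k) x) \<partial>lborel))
    \<longlonglongrightarrow> (\<Sum>P\<in>AA. (e \<bullet> fst P) * (\<integral>z. g z * facet_sign P z \<partial>hyperplane_measure P))"
    by (intro tendsto_sum) (use tendsto_shift_diff_piece[OF _ e g s, of "fst P" "snd P" for P] in auto)
  moreover have "(\<Sum>P\<in>AA. 1 / s k * (\<integral>x. g x * shift_diff e (s k) x * (near P (s k) x / mult_near (s k) x) \<partial>lborel))
    = 1 / s k * (\<integral>x. g x * shift_diff e (s k) x \<partial>lborel)" for k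
    by (subst shift_diff_split[OF e s(1)], subst Bochner_Integration.integral_sum[OF int]) (auto simp: sum_distrib_left)
  ultimately show ?thesis by simp
qed

text \<open>With the translation moved from the indicator to \<open>g\<close>, the integrand is an
  ordinary difference quotient on \<open>\<Omega>\<close>. The mean value theorem bounds it by the
  maximum of the derivative on a ball of radius \<open>R + 1\<close>, which contains all segments
  because \<open>s k \<le> 1\<close>.\<close>

lemma tendsto_shift_diff_derivative:
  fixes g :: "'a \<Rightarrow> real"
  assumes e: "norm e \<le> 1" and g: "g differentiable_on UNIV"
    and g': "continuous_on UNIV (\<lambda>x. frechet_derivative g (at x) e)"
    and s: "\<And>k. 0 < s k" "\<And>k. s k \<le> 1" "s \<longlonglongrightarrow> 0"
  shows "(\<lambda>k. 1 / s k * (\<integral>x. g x * shift_diff e (s k) x \<partial>lborel))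
    \<longlonglongrightarrow> (\<integral>x. indicator \<Omega> x * frechet_derivative g (at x) e \<partial>lborel)"
proof -
  define D where "D x = frechet_derivative g (at x) e" for x
  have gc: "continuous_on UNIV g" by (rule differentiable_imp_continuous_on[OF g])
  have [measurable]: "g \<in> borel_measurable borel" "D \<in> borel_measurable borel"
    using gc g' by (auto simp: D_def intro: borel_measurable_continuous_onI)
  have [measurable]: "\<Omega> \<in> sets borel" using open_domain by simp
  have der: "((\<lambda>t. g (x + t *\<^sub>R e)) has_real_derivative D (x + t *\<^sub>R e)) (at t)" for x t
  proof -
    have "(g has_derivative frechet_derivative g (at (x + t *\<^sub>R e))) (at (x + t *\<^sub>R e))"
      using g by (simp add: differentiable_on_def frechet_derivative_works)
    then have "((\<lambda>t. g (x + t *\<^sub>R e)) has_derivative (\<lambda>h. frechet_derivative g (at (x + t *\<^sub>R e)) (0 + h *\<^sub>R e))) (at t)"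
      by (rule has_derivative_compose[rotated]) (auto intro!: derivative_eq_intros)
    moreover have "linear (frechet_derivative g (at (x + t *\<^sub>R e)))"
      using g by (simp add: differentiable_on_def linear_frechet_derivative)
    ultimately show ?thesis
      by (simp add: has_field_derivative_def D_def linear_scale mult.commute[of _ "frechet_derivative g _ _"])
  qed
  obtain R where R: "\<And>x. x \<in> \<Omega> \<Longrightarrow> norm x \<le> R" "R > 0"
    using bounded_domain by (auto simp: bounded_pos)
  obtain C where C: "\<And>x. norm x \<le> R + 1 \<Longrightarrow> \<bar>D x\<bar> \<le> C"
    using continuous_bounded_cball[of D "R + 1"] g'[folded D_def] by (metis real_norm_def)
  obtain B where B: "\<And>x. norm x \<le> R + 1 \<Longrightarrow> \<bar>g x\<bar> \<le> B"
    using continuous_bounded_cball[of g "R + 1"] gc by (metis real_norm_def)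
  have finO: "integrable lborel (\<lambda>x. K * indicator \<Omega> x :: real)" for K
    using emeasure_bounded_finite[OF bounded_domain]
    by (intro integrable_mult_right integrable_real_indicator) auto
  have small: "norm (x + t *\<^sub>R e) \<le> R + 1" if "x \<in> \<Omega>" "0 \<le> t" "t \<le> 1" for x t
    using norm_triangle_ineq[of x "t *\<^sub>R e"] R(1)[OF that(1)] mult_le_one[of t "norm e"] that e by simp
  have intg: "integrable lborel (\<lambda>x. indicator \<Omega> x * g (x + t *\<^sub>R e))" if "0 \<le> t" "t \<le> 1" for t
  proof (rule Bochner_Integration.integrable_bound[OF finO[of B]])
    show "AE x in lborel. norm (indicator \<Omega> x * g (x + t *\<^sub>R e)) \<le> norm (B * indicator \<Omega> x :: real)"
      using B[OF small[OF _ that]] by (intro AE_I2) (auto simp: indicator_def intro: order_trans[OF _ abs_ge_self])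
  qed measurable
  have eq: "1 / s k * (\<integral>x. g x * shift_diff e (s k) x \<partial>lborel) =
    (\<integral>x. indicator \<Omega> x * ((g (x + s k *\<^sub>R e) - g x) / s k) \<partial>lborel)" for k
  proof -
    have i1: "integrable lborel (\<lambda>x. indicator \<Omega> x * g (x + s k *\<^sub>R e))"
      using intg[of "s k"] s(1)[of k] s(2)[of k] by simp
    have i0: "integrable lborel (\<lambda>x. indicator \<Omega> x * g x)" using intg[of 0] by simp
    have tr: "(\<lambda>x. g x * indicator \<Omega> (x - s k *\<^sub>R e)) \<in> borel_measurable (borel :: 'a measure)" by measurable
    have "integrable (distr lborel borel ((+) (s k *\<^sub>R e))) (\<lambda>x. g x * indicator \<Omega> (x - s k *\<^sub>R e))
       \<longleftrightarrow> integrable lborel (\<lambda>x. g (s k *\<^sub>R e + x) * indicator \<Omega> (s k *\<^sub>R e + x - s k *\<^sub>R e))"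
      by (rule integrable_distr_eq) (use tr in auto)
    then have i2: "integrable lborel (\<lambda>x. g x * indicator \<Omega> (x - s k *\<^sub>R e))"
      using i1 by (simp add: lborel_distr_plus add.commute mult.commute)
    have "(\<integral>x. g x * indicator \<Omega> (x - s k *\<^sub>R e) \<partial>distr lborel borel ((+) (s k *\<^sub>R e)))
       = (\<integral>x. g (s k *\<^sub>R e + x) * indicator \<Omega> (s k *\<^sub>R e + x - s k *\<^sub>R e) \<partial>lborel)"
      by (rule integral_distr) (use tr in auto)
    then have t2: "(\<integral>x. g x * indicator \<Omega> (x - s k *\<^sub>R e) \<partial>lborel) = (\<integral>x. indicator \<Omega> x * g (x + s k *\<^sub>R e) \<partial>lborel)"
      by (simp add: lborel_distr_plus add.commute mult.commute)
    have "(\<integral>x. g x * shift_diff e (s k) x \<partial>lborel) =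
      (\<integral>x. g x * indicator \<Omega> (x - s k *\<^sub>R e) \<partial>lborel) - (\<integral>x. indicator \<Omega> x * g x \<partial>lborel)"
      using i2 i0 by (subst Bochner_Integration.integral_diff[symmetric]) (auto simp: shift_diff_def algebra_simps)
    also have "\<dots> = (\<integral>x. indicator \<Omega> x * g (x + s k *\<^sub>R e) - indicator \<Omega> x * g x \<partial>lborel)"
      unfolding t2 using i1 i0 by simp
    finally show ?thesis
      by (simp add: right_diff_distrib[symmetric])
  qed
  have "(\<lambda>k. \<integral>x. indicator \<Omega> x * ((g (x + s k *\<^sub>R e) - g x) / s k) \<partial>lborel) \<longlonglongrightarrow> (\<integral>x. indicator \<Omega> x * D x \<partial>lborel)"
  proof (rule integral_dominated_convergence[OF _ _ finO[of C]])
    show "AE x in lborel. (\<lambda>k. indicator \<Omega> x * ((g (x + s k *\<^sub>R e) - g x) / s k)) \<longlonglongrightarrow> indicator \<Omega> x * D x"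
    proof (intro AE_I2 tendsto_mult_left)
      fix x
      have "((\<lambda>h. (g (x + h *\<^sub>R e) - g x) / h) \<longlongrightarrow> D x) (at 0)"
        using der[of x 0] by (simp add: DERIV_def)
      moreover have "filterlim s (at 0) sequentially"
        using s(3) s(1) by (auto simp: filterlim_at less_imp_neq intro!: always_eventually) (metis less_irrefl)
      ultimately show "(\<lambda>k. (g (x + s k *\<^sub>R e) - g x) / s k) \<longlonglongrightarrow> D x"
        by (rule filterlim_compose)
    qed
    show "AE x in lborel. norm (indicator \<Omega> x * ((g (x + s k *\<^sub>R e) - g x) / s k)) \<le> C * indicator \<Omega> x" for k
    proof (rule AE_I2)
      fix x
      show "norm (indicator \<Omega> x * ((g (x + s k *\<^sub>R e) - g x) / s k)) \<le> C * indicator \<Omega> x"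
      proof (cases "x \<in> \<Omega>")
        case True
        obtain t where t: "0 < t" "t < s k" "g (x + s k *\<^sub>R e) - g (x + 0 *\<^sub>R e) = (s k - 0) * D (x + t *\<^sub>R e)"
          using MVT2[OF s(1)[of k], of "\<lambda>t. g (x + t *\<^sub>R e)" "\<lambda>t. D (x + t *\<^sub>R e)"] der by blast
        then have "(g (x + s k *\<^sub>R e) - g x) / s k = D (x + t *\<^sub>R e)" using s(1)[of k] by simp
        moreover have "\<bar>D (x + t *\<^sub>R e)\<bar> \<le> C"
          using C small[OF True, of t] t s(2)[of k] by simp
        ultimately show ?thesis using True by simp
      qed simp
    qed
  qed measurable
  then show ?thesis by (simp only: eq D_def)
qed

theorem integral_partial_eq_facets:
  fixes g :: "'a \<Rightarrow> real"
  assumes e: "norm e \<le> 1" and g: "g differentiable_on UNIV"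
    and g': "continuous_on UNIV (\<lambda>x. frechet_derivative g (at x) e)"
  shows "(\<integral>x. indicator \<Omega> x * frechet_derivative g (at x) e \<partial>lborel)
    = (\<Sum>P\<in>AA. (e \<bullet> fst P) * (\<integral>z. g z * facet_sign P z \<partial>hyperplane_measure P))"
proof -
  define s where "s k = inverse (real (Suc k))" for k
  have s: "\<And>k. 0 < s k" "\<And>k. s k \<le> 1" "s \<longlonglongrightarrow> 0"
    using LIMSEQ_inverse_real_of_nat by (auto simp: s_def[abs_def] inverse_le_1_iff)
  show ?thesis
    by (rule LIMSEQ_unique[OF tendsto_shift_diff_derivative[OF e g g' s]
          tendsto_shift_diff[OF e differentiable_imp_continuous_on[OF g] s]])
qed

end

section \<open>Surface measure and the divergence theorem\<close>

text \<open>Let \<open>v\<close> be the part of \<open>\<nu>\<close> orthogonal to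
  \<open>\<nu>'\<close>. Moving along \<open>v\<close> stays in the second hyperplane, hence in the
  first, so \<open>v \<bullet> \<nu> = 0\<close> and then \<open>v = 0\<close>: the unit normals are
  parallel.\<close>

lemma hyperplane_eq_imp:
  fixes P Q :: "'a::euclidean_space \<times> real"
  assumes "norm (fst P) = 1" "norm (fst Q) = 1" "hyperplane P = hyperplane Q"
  shows "P = Q \<or> P = (- fst Q, - snd Q)"
proof -
  obtain \<nu> c \<nu>' c' where PQ: "P = (\<nu>, c)" "Q = (\<nu>', c')" by (cases P; cases Q)
  have nn: "\<nu> \<bullet> \<nu> = 1" "\<nu>' \<bullet> \<nu>' = 1" using assms by (simp_all add: PQ norm_eq_1)
  have eq: "x \<bullet> \<nu> = c \<longleftrightarrow> x \<bullet> \<nu>' = c'" for x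
    using assms(3) by (auto simp: hyperplane_def PQ)
  define v where "v = \<nu> - (\<nu>' \<bullet> \<nu>) *\<^sub>R \<nu>'"
  have v: "v \<bullet> \<nu>' = 0" by (simp add: v_def inner_diff_left nn inner_commute[of \<nu> \<nu>'])
  have 0: "(c' *\<^sub>R \<nu>') \<bullet> \<nu> = c" using eq[of "c' *\<^sub>R \<nu>'"] by (simp add: nn)
  have "(c' *\<^sub>R \<nu>' + v) \<bullet> \<nu> = c" using eq[of "c' *\<^sub>R \<nu>' + v"] v by (simp add: inner_add_left nn)
  then have "v \<bullet> \<nu> = 0" using 0 by (simp add: inner_add_left)
  then have "v \<bullet> v = 0" using v by (simp add: v_def inner_diff_right)
  then have n: "\<nu> = (\<nu>' \<bullet> \<nu>) *\<^sub>R \<nu>'" by (simp add: v_def)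
  then have "norm \<nu> = \<bar>\<nu>' \<bullet> \<nu>\<bar> * norm \<nu>'" by (metis norm_scaleR)
  then have "\<nu>' \<bullet> \<nu> = 1 \<or> \<nu>' \<bullet> \<nu> = - 1" using assms by (auto simp: PQ abs_if split: if_splits)
  then show ?thesis
  proof
    assume "\<nu>' \<bullet> \<nu> = 1"
    then show ?thesis using n 0 by (simp add: PQ)
  next
    assume "\<nu>' \<bullet> \<nu> = - 1"
    then show ?thesis using n 0 by (simp add: PQ)
  qed
qed

text \<open>The points of the open slab that project into the ball form a nonempty open set, and
  such a set is not negligible.\<close>

lemma emeasure_hyperplane_measure_ball_pos:
  fixes \<nu> :: "'a::euclidean_space"
  assumes nu: "norm \<nu> = 1" and x: "x \<bullet> \<nu> = c" and r: "r > 0"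
  shows "emeasure (hyperplane_measure (\<nu>, c)) (ball x r) \<noteq> 0"
proof
  assume 0: "emeasure (hyperplane_measure (\<nu>, c)) (ball x r) = 0"
  have nn: "\<nu> \<bullet> \<nu> = 1" using nu by (simp add: norm_eq_1)
  define U where "U = {y. 0 < y \<bullet> \<nu> - c} \<inter> {y. y \<bullet> \<nu> - c < 1} \<inter> {y. dist x (y - (y \<bullet> \<nu> - c) *\<^sub>R \<nu>) < r}"
  have "open U" unfolding U_def
    by (intro open_Int open_Collect_less continuous_intros)
  then have [measurable]: "U \<in> sets borel" by simp
  have "x + (1 / 2) *\<^sub>R \<nu> \<in> U" using x r by (simp add: U_def inner_add_left nn)
  have "emeasure lborel U = (\<integral>\<^sup>+y. indicator U y \<partial>lborel)" by simp
  also have "\<dots> \<le> (\<integral>\<^sup>+y. indicator {0..1} (y \<bullet> \<nu> - c) * indicator (ball x r) (y - (y \<bullet> \<nu> - c) *\<^sub>R \<nu>) \<partial>lborel)"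
    by (rule nn_integral_mono) (auto simp: U_def indicator_def)
  also have "\<dots> = (\<integral>\<^sup>+z. indicator (ball x r) z \<partial>hyperplane_measure (\<nu>, c))"
    by (intro nn_integral_hyperplane_measure[symmetric] borel_measurable_indicator) simp
  also have "\<dots> = 0" using 0 by simp
  finally have "U \<in> null_sets lborel" by auto
  then have "negligible U" by (simp add: negligible_iff_null_sets null_sets_completionI)
  then show False using \<open>open U\<close> \<open>x + (1 / 2) *\<^sub>R \<nu> \<in> U\<close> open_not_negligible by blast
qed

lemma facet_norm: "facet \<Omega> P \<noteq> {} \<Longrightarrow> norm (fst P) = 1"
  by (auto simp: facet_def is_outward_normal_def)

lemma facet_disjoint:
  "x \<in> facet \<Omega> P \<Longrightarrow> x \<in> facet \<Omega> Q \<Longrightarrow> P = Q"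
  using is_outward_normal_unique[of \<Omega> x "fst P" "fst Q"] by (auto simp: facet_def prod_eq_iff)

context arrangement
begin

text \<open>A facet contains a disc of its hyperplane, and the arrangement covers this disc. If the
  hyperplane were not listed, the disc would be covered by finitely many null sets, although it has
  positive measure. Hence only finitely many of the pairs of a vector and a number carry a
  facet.\<close>

lemma facet_nonempty_AA:
  assumes "facet \<Omega> P \<noteq> {}"
  shows "P \<in> AA \<or> (- fst P, - snd P) \<in> AA"
proof (rule ccontr)
  assume no: "\<not> ?thesis"
  obtain \<nu> c where P: "P = (\<nu>, c)" by (cases P)
  obtain x where x: "x \<in> facet \<Omega> (\<nu>, c)" using assms P by auto
  have nu: "norm \<nu> = 1" using facet_norm[OF assms] P by simp
  obtain r where r: "r > 0" "ball x r \<inter> hyperplane (\<nu>, c) \<subseteq> facet \<Omega> (\<nu>, c)"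
    using facet_contains_disc[OF open_domain x] by blast
  have "facet \<Omega> (\<nu>, c) \<subseteq> frontier \<Omega>" by (auto simp: facet_def)
  then have cov: "ball x r \<inter> hyperplane (\<nu>, c) \<subseteq> (\<Union>Q\<in>AA. hyperplane Q)" using r(2) frontier_subset by blast
  have "AE z in hyperplane_measure (\<nu>, c). \<forall>Q\<in>AA. z \<notin> hyperplane Q"
  proof (rule AE_finite_allI[OF finite_AA])
    fix Q assume Q: "Q \<in> AA"
    have "hyperplane (\<nu>, c) \<noteq> hyperplane Q"
    proof
      assume "hyperplane (\<nu>, c) = hyperplane Q"
      then have "(\<nu>, c) = Q \<or> (\<nu>, c) = (- fst Q, - snd Q)"
        using hyperplane_eq_imp[of "(\<nu>, c)" Q] nu norm_fst[OF Q] by simp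
      then show False using no Q P by auto
    qed
    then show "AE z in hyperplane_measure (\<nu>, c). z \<notin> hyperplane Q"
      using AE_hyperplane_measure_other[OF nu, of c "fst Q" "snd Q"] norm_fst[OF Q]
      by (auto simp: hyperplane_def)
  qed
  then have "AE z in hyperplane_measure (\<nu>, c). z \<notin> ball x r"
    using AE_hyperplane_measure[OF nu, of c] by eventually_elim (use cov in \<open>auto simp: hyperplane_def\<close>)
  then have "ball x r \<in> null_sets (hyperplane_measure (\<nu>, c))" by (simp add: AE_iff_null_sets)
  moreover have "x \<bullet> \<nu> = c" using x by (simp add: facet_def)
  ultimately show False using emeasure_hyperplane_measure_ball_pos[OF nu _ r(1)] by blast
qed

section \<open>The surface measure as a finite sum over facets\<close>

definition facets :: "('a \<times> real) set" where "facets = {P. facet \<Omega> P \<noteq> {}}"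

lemma facets_subset: "facets \<subseteq> AA \<union> (\<lambda>P. (- fst P, - snd P)) ` AA"
proof
  fix P assume "P \<in> facets"
  then have "P \<in> AA \<or> (- fst P, - snd P) \<in> AA" using facet_nonempty_AA by (simp add: facets_def)
  then show "P \<in> AA \<union> (\<lambda>P. (- fst P, - snd P)) ` AA"
    by (auto intro: image_eqI[of _ _ "(- fst P, - snd P)"])
qed

text \<open>The sum that defines \<open>surface_measure\<close> runs over this set; over an infinite
  index set it would be 0 by default.\<close>

lemma finite_facets: "finite facets"
  using facets_subset finite_AA finite_subset by blast

lemma facet_measurable [measurable]: "facet \<Omega> P \<in> sets borel"
  by (rule facet_borel[OF open_domain])

lemma space_surface_measure [simp]: "space (surface_measure \<Omega>) = UNIV"
  and sets_surface_measure [simp, measurable_cong]: "sets (surface_measure \<Omega>) = sets borel"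
  by (simp_all add: surface_measure_def space_measure_of_conv sets.sigma_sets_eq[of borel, simplified])

text \<open>\<open>measure_of\<close> returns the given set function only once countable additivity
  is established. It holds here because a finite sum commutes with a series of nonnegative
  terms.\<close>

lemma emeasure_surface_measure:
  assumes "A \<in> sets borel"
  shows "emeasure (surface_measure \<Omega>) A = (\<Sum>P\<in>facets. emeasure (hyperplane_measure P) (A \<inter> facet \<Omega> P))"
proof (rule emeasure_measure_of[OF surface_measure_def[of \<Omega>, folded facets_def]])
  show "countably_additive (sets (surface_measure \<Omega>)) (\<lambda>A. \<Sum>P\<in>facets. emeasure (hyperplane_measure P) (A \<inter> facet \<Omega> P))"
  proof (rule countably_additiveI)
    fix A :: "nat \<Rightarrow> 'a set"
    assume A: "range A \<subseteq> sets (surface_measure \<Omega>)" "disjoint_family A"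
    have "(\<Sum>i. \<Sum>P\<in>facets. emeasure (hyperplane_measure P) (A i \<inter> facet \<Omega> P))
      = (\<Sum>P\<in>facets. \<Sum>i. emeasure (hyperplane_measure P) (A i \<inter> facet \<Omega> P))"
      by (rule suminf_sum) simp
    also have "\<dots> = (\<Sum>P\<in>facets. emeasure (hyperplane_measure P) ((\<Union>i. A i) \<inter> facet \<Omega> P))"
    proof (rule sum.cong[OF refl])
      fix P
      have "(\<Sum>i. emeasure (hyperplane_measure P) (A i \<inter> facet \<Omega> P)) = emeasure (hyperplane_measure P) (\<Union>i. A i \<inter> facet \<Omega> P)"
        using A by (intro suminf_emeasure) (auto simp: disjoint_family_on_def)
      then show "(\<Sum>i. emeasure (hyperplane_measure P) (A i \<inter> facet \<Omega> P)) = emeasure (hyperplane_measure P) ((\<Union>i. A i) \<inter> facet \<Omega> P)"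
        by simp
    qed
    finally show "(\<Sum>i. \<Sum>P\<in>facets. emeasure (hyperplane_measure P) (A i \<inter> facet \<Omega> P)) =
      (\<Sum>P\<in>facets. emeasure (hyperplane_measure P) (\<Union> (range A) \<inter> facet \<Omega> P))" .
  qed
qed (use assms in \<open>auto simp: positive_def\<close>)

lemma facet_bounded: "bounded (facet \<Omega> P)"
  by (rule bounded_subset[OF bounded_closure[OF bounded_domain]]) (auto simp: facet_def frontier_def)

lemma emeasure_facet_finite:
  assumes "P \<in> facets"
  shows "emeasure (hyperplane_measure P) (facet \<Omega> P) < \<infinity>"
  using emeasure_hyperplane_measure_bounded[of "fst P" "facet \<Omega> P" "snd P"] assms facet_bounded[of P] facet_norm[of \<Omega> P]
  by (auto simp: facets_def)

lemma finite_surface_measure: "finite_measure (surface_measure \<Omega>)"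
proof (rule finite_measureI)
  have "(\<Sum>P\<in>facets. emeasure (hyperplane_measure P) (facet \<Omega> P)) < \<infinity>"
    using emeasure_facet_finite finite_facets by simp
  then show "emeasure (surface_measure \<Omega>) (space (surface_measure \<Omega>)) \<noteq> \<infinity>"
    by (simp add: emeasure_surface_measure)
qed

lemma AE_surface_measure: "AE x in surface_measure \<Omega>. \<exists>P\<in>facets. x \<in> facet \<Omega> P"
proof -
  let ?N = "- (\<Union>P\<in>facets. facet \<Omega> P)"
  have N: "?N \<in> sets borel" by (intro borel_comp sets.finite_UN) (use finite_facets in auto)
  have "emeasure (hyperplane_measure P) (?N \<inter> facet \<Omega> P) = 0" if "P \<in> facets" for P
  proof -
    have "?N \<inter> facet \<Omega> P = {}" using that by blast
    then show ?thesis by simp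
  qed
  then have "emeasure (surface_measure \<Omega>) ?N = 0"
    unfolding emeasure_surface_measure[OF N] by (intro sum.neutral) blast
  then show ?thesis using N by (intro AE_I[where N = ?N]) auto
qed

text \<open>Facets are pairwise disjoint, by uniqueness of the normal, so only one summand survives
  the restriction.\<close>

lemma density_surface_measure_facet:
  assumes P: "P \<in> facets"
  shows "density (surface_measure \<Omega>) (indicator (facet \<Omega> P)) = density (hyperplane_measure P) (indicator (facet \<Omega> P))"
proof (rule measure_eqI)
  fix A assume "A \<in> sets (density (surface_measure \<Omega>) (indicator (facet \<Omega> P)))"
  then have A: "A \<in> sets borel" by simp
  have "(\<Sum>Q\<in>facets. emeasure (hyperplane_measure Q) (facet \<Omega> P \<inter> A \<inter> facet \<Omega> Q)) =
    (\<Sum>Q\<in>{P}. emeasure (hyperplane_measure Q) (facet \<Omega> P \<inter> A \<inter> facet \<Omega> Q))"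
  proof (rule sum.mono_neutral_right[OF finite_facets])
    show "\<forall>Q\<in>facets - {P}. emeasure (hyperplane_measure Q) (facet \<Omega> P \<inter> A \<inter> facet \<Omega> Q) = 0"
    proof
      fix Q assume "Q \<in> facets - {P}"
      then have "facet \<Omega> P \<inter> A \<inter> facet \<Omega> Q = {}" using facet_disjoint by blast
      then show "emeasure (hyperplane_measure Q) (facet \<Omega> P \<inter> A \<inter> facet \<Omega> Q) = 0" by simp
    qed
  qed (use P in auto)
  then show "emeasure (density (surface_measure \<Omega>) (indicator (facet \<Omega> P))) A = emeasure (density (hyperplane_measure P) (indicator (facet \<Omega> P))) A"
    using A by (simp add: emeasure_restricted emeasure_surface_measure Int_commute Int_left_commute)
qed simp

lemma integral_surface_measure_facet:
  fixes G :: "'a \<Rightarrow> real"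
  assumes P: "P \<in> facets" and [measurable]: "G \<in> borel_measurable borel"
  shows "(\<integral>x. indicator (facet \<Omega> P) x * G x \<partial>surface_measure \<Omega>) = (\<integral>x. indicator (facet \<Omega> P) x * G x \<partial>hyperplane_measure P)"
proof -
  have "(\<integral>x. indicator (facet \<Omega> P) x * G x \<partial>M) = (\<integral>x. G x \<partial>density M (indicator (facet \<Omega> P)))"
    if "sets M = sets borel" for M :: "'a measure"
  proof -
    have [measurable_cong]: "sets M = sets borel" by fact
    have "(\<integral>x. G x \<partial>density M (\<lambda>x. ennreal (indicator (facet \<Omega> P) x))) = (\<integral>x. indicator (facet \<Omega> P) x *\<^sub>R G x \<partial>M)"
      by (rule integral_density) auto
    then show ?thesis by (simp add: ennreal_indicator)
  qed
  then show ?thesis using density_surface_measure_facet[OF P] by simp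
qed

lemma outward_normal_facet: "x \<in> facet \<Omega> P \<Longrightarrow> outward_normal \<Omega> x = fst P"
  by (rule outward_normal_eq) (simp add: facet_def)

lemma measurable_outward_normal [measurable]: "outward_normal \<Omega> \<in> borel_measurable borel"
proof -
  \<comment> \<open>Where no normal exists, the defining predicate is constantly false and
    \<open>THE\<close> returns one and the same unspecified vector. The normal field therefore takes
    finitely many values, each on a Borel set.\<close>
  define n0 :: 'a where "n0 = (THE \<nu>. False)"
  have "outward_normal \<Omega> x = n0 + (\<Sum>P\<in>facets. indicator (facet \<Omega> P) x *\<^sub>R (fst P - n0))" for x
  proof (cases "\<exists>P. x \<in> facet \<Omega> P")
    case True
    then obtain P where P: "x \<in> facet \<Omega> P" by blast
    then have "P \<in> facets" by (auto simp: facets_def)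
    have "(\<Sum>Q\<in>facets. indicator (facet \<Omega> Q) x *\<^sub>R (fst Q - n0)) = (\<Sum>Q\<in>{P}. indicator (facet \<Omega> Q) x *\<^sub>R (fst Q - n0))"
      using \<open>P \<in> facets\<close> facet_disjoint[OF P] by (intro sum.mono_neutral_right[OF finite_facets]) (auto simp: indicator_def)
    then show ?thesis using P outward_normal_facet[OF P] by simp
  next
    case False
    then have "\<not> is_outward_normal \<Omega> x \<nu>" for \<nu> using facet_eq[OF open_domain, of \<nu> "x \<bullet> \<nu>"] by blast
    then have "outward_normal \<Omega> x = n0" by (simp add: outward_normal_def n0_def)
    then show ?thesis using False by (auto intro!: sum.neutral)
  qed
  then have "outward_normal \<Omega> = (\<lambda>x. n0 + (\<Sum>P\<in>facets. indicator (facet \<Omega> P) x *\<^sub>R (fst P - n0)))" by blast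
  moreover have "(\<lambda>x. n0 + (\<Sum>P\<in>facets. indicator (facet \<Omega> P) x *\<^sub>R (fst P - n0))) \<in> borel_measurable borel" by measurable
  ultimately show ?thesis by simp
qed

lemma AE_norm_outward_normal: "AE x in surface_measure \<Omega>. norm (outward_normal \<Omega> x) = 1"
  using AE_surface_measure
proof eventually_elim
  case (elim x)
  then obtain P where "x \<in> facet \<Omega> P" by blast
  then show ?case using facet_norm[of \<Omega> P] by (auto simp: outward_normal_facet)
qed

text \<open>Each \<open>P\<close> in the arrangement stands for two oriented hyperplanes, itself and
  its negative. The minus sign that \<open>facet_sign\<close> gives to the opposite facet is the
  sign of the reversed normal, so the sum over \<open>AA\<close> unfolds into a sum over oriented
  facets, which is the surface integral.\<close>

theorem integral_partial_eq_boundary: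
  fixes g :: "'a \<Rightarrow> real"
  assumes e: "norm e \<le> 1" and g: "g differentiable_on UNIV"
    and g': "continuous_on UNIV (\<lambda>x. frechet_derivative g (at x) e)"
  shows "(\<integral>x. indicator \<Omega> x * frechet_derivative g (at x) e \<partial>lborel)
    = (\<integral>x. g x * (outward_normal \<Omega> x \<bullet> e) \<partial>surface_measure \<Omega>)"
proof -
  let ?n = "\<lambda>P. (- fst P, - snd P) :: 'a \<times> real"
  define \<phi> where "\<phi> P = (e \<bullet> fst P) * (\<integral>z. indicator (facet \<Omega> P) z * g z \<partial>hyperplane_measure P)" for P
  have gc: "continuous_on UNIV g" by (rule differentiable_imp_continuous_on[OF g])
  then have [measurable]: "g \<in> borel_measurable borel" by (rule borel_measurable_continuous_onI)
  have cl: "compact (closure \<Omega>)" using bounded_domain by (simp add: compact_closure)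
  have "compact (g ` closure \<Omega>)" by (intro compact_continuous_image cl continuous_on_subset[OF gc]) auto
  then obtain B where "\<forall>y\<in>g ` closure \<Omega>. norm y \<le> B" using compact_imp_bounded bounded_iff by metis
  then have B: "\<bar>g x\<bar> \<le> B" if "x \<in> facet \<Omega> P" for x P
    using that by (auto simp: facet_def frontier_def)
  have int: "integrable (hyperplane_measure Q) (\<lambda>z. indicator (facet \<Omega> P) z * g z)" if "norm (fst Q) = 1" for P Q
  proof (rule Bochner_Integration.integrable_bound[of _ "\<lambda>z. B * indicator (facet \<Omega> P) z"])
    show "integrable (hyperplane_measure Q) (\<lambda>z. B * indicator (facet \<Omega> P) z :: real)"
      using emeasure_hyperplane_measure_bounded[of "fst Q" "facet \<Omega> P" "snd Q"] facet_bounded[of P] that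
      by (intro integrable_mult_right integrable_real_indicator) auto
    show "AE z in hyperplane_measure Q. norm (indicator (facet \<Omega> P) z * g z) \<le> norm (B * indicator (facet \<Omega> P) z :: real)"
      using B[of _ P] by (intro AE_I2) (auto simp: indicator_def intro: order_trans[OF _ abs_ge_self])
  qed measurable
  have n_inj: "inj_on ?n AA" by (auto simp: inj_on_def prod_eq_iff)
  \<comment> \<open>A common element would belong to \<open>AA\<close> together with its negative.
    These are different pairs for the same hyperplane, which \<open>hyperplane_inj\<close>
    forbids.\<close>
  have n_disj: "AA \<inter> ?n ` AA = {}"
  proof (rule ccontr)
    assume "AA \<inter> ?n ` AA \<noteq> {}"
    then obtain Q where Q: "Q \<in> AA" "?n Q \<in> AA" by auto
    have "?n Q \<noteq> Q"
    proof
      assume "?n Q = Q"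
      then have a: "- fst Q = fst Q" by (simp add: prod_eq_iff)
      have "fst Q + fst Q = fst Q + (- fst Q)" by (simp only: a)
      then have "fst Q + fst Q = 0" by simp
      then have "fst Q = 0" by (simp flip: scaleR_2)
      then show False using norm_fst[OF Q(1)] by simp
    qed
    moreover have "hyperplane (?n Q) = hyperplane Q" by (auto simp: hyperplane_def)
    ultimately show False using hyperplane_inj[OF Q(2,1)] by blast
  qed
  have "(\<integral>x. indicator \<Omega> x * frechet_derivative g (at x) e \<partial>lborel)
    = (\<Sum>P\<in>AA. (e \<bullet> fst P) * (\<integral>z. g z * facet_sign P z \<partial>hyperplane_measure P))"
    by (rule integral_partial_eq_facets[OF e g g'])
  also have "\<dots> = (\<Sum>P\<in>AA. \<phi> P + \<phi> (?n P))"
  proof (rule sum.cong[OF refl])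
    fix P assume P: "P \<in> AA"
    have H: "hyperplane_measure (?n P) = hyperplane_measure P"
      using hyperplane_measure_uminus[OF norm_fst[OF P], of "snd P"] by simp
    have "(\<integral>z. g z * facet_sign P z \<partial>hyperplane_measure P) =
      (\<integral>z. indicator (facet \<Omega> P) z * g z - indicator (facet \<Omega> (?n P)) z * g z \<partial>hyperplane_measure P)"
      by (intro Bochner_Integration.integral_cong) (auto simp: facet_sign_def algebra_simps)
    also have "\<dots> = (\<integral>z. indicator (facet \<Omega> P) z * g z \<partial>hyperplane_measure P) - (\<integral>z. indicator (facet \<Omega> (?n P)) z * g z \<partial>hyperplane_measure P)"
      by (rule Bochner_Integration.integral_diff) (rule int[OF norm_fst[OF P]])+
    finally show "(e \<bullet> fst P) * (\<integral>z. g z * facet_sign P z \<partial>hyperplane_measure P) = \<phi> P + \<phi> (?n P)"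
      by (simp add: \<phi>_def H right_diff_distrib)
  qed
  also have "\<dots> = (\<Sum>P\<in>AA \<union> ?n ` AA. \<phi> P)"
    using finite_AA n_disj by (simp add: sum.distrib sum.union_disjoint sum.reindex[OF n_inj])
  also have "\<dots> = (\<Sum>P\<in>facets. \<phi> P)"
    using finite_AA facets_subset by (intro sum.mono_neutral_right) (auto simp: \<phi>_def facets_def)
  also have "\<dots> = (\<Sum>P\<in>facets. \<integral>x. indicator (facet \<Omega> P) x * (g x * (fst P \<bullet> e)) \<partial>surface_measure \<Omega>)"
  proof (rule sum.cong[OF refl])
    fix P assume P: "P \<in> facets"
    have "(\<integral>x. indicator (facet \<Omega> P) x * (g x * (fst P \<bullet> e)) \<partial>surface_measure \<Omega>) = (\<integral>x. (e \<bullet> fst P) * (indicator (facet \<Omega> P) x * g x) \<partial>hyperplane_measure P)"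
      by (subst integral_surface_measure_facet[OF P]) (auto simp: inner_commute mult_ac)
    then show "\<phi> P = (\<integral>x. indicator (facet \<Omega> P) x * (g x * (fst P \<bullet> e)) \<partial>surface_measure \<Omega>)"
      by (simp add: \<phi>_def)
  qed
  also have "\<dots> = (\<integral>x. (\<Sum>P\<in>facets. indicator (facet \<Omega> P) x * (g x * (fst P \<bullet> e))) \<partial>surface_measure \<Omega>)"
  proof (rule Bochner_Integration.integral_sum[symmetric])
    fix P assume "P \<in> facets"
    interpret finite_measure "surface_measure \<Omega>" by (rule finite_surface_measure)
    show "integrable (surface_measure \<Omega>) (\<lambda>x. indicator (facet \<Omega> P) x * (g x * (fst P \<bullet> e)))"
    proof (rule integrable_const_bound[of _ "\<bar>B\<bar> * \<bar>fst P \<bullet> e\<bar>"])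
      show "AE x in surface_measure \<Omega>. norm (indicator (facet \<Omega> P) x * (g x * (fst P \<bullet> e))) \<le> \<bar>B\<bar> * \<bar>fst P \<bullet> e\<bar>"
        using B[of _ P] by (intro AE_I2) (auto simp: indicator_def abs_mult intro!: mult_right_mono intro: order_trans[OF _ abs_ge_self])
    qed measurable
  qed
  also have "\<dots> = (\<integral>x. g x * (outward_normal \<Omega> x \<bullet> e) \<partial>surface_measure \<Omega>)"
  proof (rule integral_cong_AE)
    show "AE x in surface_measure \<Omega>. (\<Sum>P\<in>facets. indicator (facet \<Omega> P) x * (g x * (fst P \<bullet> e))) = g x * (outward_normal \<Omega> x \<bullet> e)"
      using AE_surface_measure
    proof eventually_elim
      case (elim x)
      then obtain P where P: "P \<in> facets" "x \<in> facet \<Omega> P" by blast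
      have "(\<Sum>Q\<in>facets. indicator (facet \<Omega> Q) x * (g x * (fst Q \<bullet> e))) = (\<Sum>Q\<in>{P}. indicator (facet \<Omega> Q) x * (g x * (fst Q \<bullet> e)))"
      proof (rule sum.mono_neutral_right[OF finite_facets])
        have "\<forall>Q\<in>facets - {P}. x \<notin> facet \<Omega> Q" using facet_disjoint[OF P(2)] by blast
        then show "\<forall>Q\<in>facets - {P}. indicator (facet \<Omega> Q) x * (g x * (fst Q \<bullet> e)) = 0" by simp
      qed (use P in simp)
      then show ?case using P by (simp add: outward_normal_facet)
    qed
  qed measurable
  finally show ?thesis .
qed

end

section \<open>Smooth functions and bumps\<close>

lemma Ck_SucI:
  assumes "\<And>x. (f has_derivative f' x) (at x)" "\<And>b. b \<in> Basis \<Longrightarrow> Ck k (\<lambda>x. f' x b)"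
  shows "Ck (Suc k) f"
proof -
  have "frechet_derivative f (at x) = f' x" for x
    using frechet_derivative_at[OF assms(1)] by simp
  moreover have "f differentiable_on UNIV"
    using assms(1) by (auto simp: differentiable_on_def differentiable_def)
  ultimately show ?thesis using assms(2) by simp
qed

lemma Ck_Suc_has_derivative:
  assumes "Ck (Suc k) f"
  shows "(f has_derivative frechet_derivative f (at x)) (at x)"
  using assms by (simp add: differentiable_on_def frechet_derivative_works)

lemma Ck_SucD: "Ck (Suc k) f \<Longrightarrow> Ck k f"
proof (induction k arbitrary: f)
  case 0
  then show ?case by (simp add: differentiable_imp_continuous_on)
next
  case (Suc k)
  then show ?case by (metis Ck.simps(2))
qed

lemma Ck_const: "Ck k (\<lambda>x. c)"
proof (induction k arbitrary: c)
  case (Suc k)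
  show ?case by (rule Ck_SucI[where f' = "\<lambda>x h. 0"]) (auto intro: Suc derivative_eq_intros)
qed simp

lemma Ck_add: "Ck k f \<Longrightarrow> Ck k g \<Longrightarrow> Ck k (\<lambda>x. f x + g x)"
proof (induction k arbitrary: f g)
  case (Suc k)
  show ?case
    by (rule Ck_SucI[OF has_derivative_add[OF Ck_Suc_has_derivative[OF Suc.prems(1)] Ck_Suc_has_derivative[OF Suc.prems(2)]]])
      (use Suc in auto)
qed (simp add: continuous_on_add)

lemma Ck_scaleR: "Ck k f \<Longrightarrow> Ck k g \<Longrightarrow> Ck k (\<lambda>x. f x *\<^sub>R g x)"
proof (induction k arbitrary: f g)
  case (Suc k)
  note fg = Ck_SucD[OF Suc.prems(1)] Ck_SucD[OF Suc.prems(2)]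
  show ?case
    by (rule Ck_SucI[OF has_derivative_scaleR[OF Ck_Suc_has_derivative[OF Suc.prems(1)] Ck_Suc_has_derivative[OF Suc.prems(2)]]])
      (use Suc.prems in \<open>auto intro!: Ck_add Suc.IH fg\<close>)
qed (simp add: continuous_on_scaleR)

lemma Ck_mult:
  fixes f g :: "_ \<Rightarrow> real"
  shows "Ck k f \<Longrightarrow> Ck k g \<Longrightarrow> Ck k (\<lambda>x. f x * g x)"
  using Ck_scaleR[of k f g] by simp

lemma Ck_bounded_linear:
  assumes "bounded_linear h" shows "Ck k h"
proof (cases k)
  case 0
  then show ?thesis using assms by (simp add: linear_continuous_on)
next
  case (Suc j)
  then show ?thesis
    using Ck_SucI[of h "\<lambda>x. h" j] bounded_linear_imp_has_derivative[OF assms] Ck_const by blast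
qed

text \<open>For affine inner maps the chain rule reproduces its own form: in each fixed direction
  the derivative is that of \<open>f\<close> at the same affine argument times a constant. So the
  induction closes.\<close>

lemma Ck_compose_affine:
  fixes f :: "real \<Rightarrow> real" and v :: "'a::euclidean_space"
  shows "Ck k f \<Longrightarrow> Ck k (\<lambda>x. f (a + x \<bullet> v))"
proof (induction k arbitrary: f)
  case 0
  then show ?case by (simp add: continuous_on_compose2[of UNIV f] continuous_intros)
next
  case (Suc k)
  have lin: "linear (frechet_derivative f (at y))" for y
    using Ck_Suc_has_derivative[OF Suc.prems] has_derivative_linear by blast
  have d: "((\<lambda>x. f (a + x \<bullet> v)) has_derivative (\<lambda>h. (h \<bullet> v) *\<^sub>R frechet_derivative f (at (a + x \<bullet> v)) 1)) (at x)" for x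
  proof -
    have "((\<lambda>x. f (a + x \<bullet> v)) has_derivative (\<lambda>h. frechet_derivative f (at (a + x \<bullet> v)) (0 + h \<bullet> v))) (at x)"
      by (rule has_derivative_compose[OF _ Ck_Suc_has_derivative[OF Suc.prems]]) (auto intro!: derivative_eq_intros)
    moreover have "frechet_derivative f (at (a + x \<bullet> v)) (0 + h \<bullet> v) = (h \<bullet> v) *\<^sub>R frechet_derivative f (at (a + x \<bullet> v)) 1" for h
      using linear_scale[OF lin, of "a + x \<bullet> v" "h \<bullet> v" 1] by simp
    ultimately show ?thesis by simp
  qed
  have "Ck k (\<lambda>y. frechet_derivative f (at y) 1)" using Suc.prems by simp
  then have "Ck k (\<lambda>x. frechet_derivative f (at (a + x \<bullet> v)) 1)" by (rule Suc.IH)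
  then show ?case by (intro Ck_SucI[OF d] Ck_scaleR Ck_const)
qed

lemma Ck_prod:
  fixes f :: "'i \<Rightarrow> _ \<Rightarrow> real"
  assumes "\<And>i. i \<in> I \<Longrightarrow> Ck k (f i)"
  shows "Ck k (\<lambda>x. \<Prod>i\<in>I. f i x)"
  using assms by (induction I rule: infinite_finite_induct) (auto intro: Ck_const Ck_mult)

text \<open>For \<open>j = 0\<close> this is the classical flat function
  \<open>exp (- 1 / t)\<close>. With the powers of \<open>inverse t\<close>, derivatives are linear
  combinations of members of the same family, and smoothness follows by induction.\<close>

definition flat_exp :: "nat \<Rightarrow> real \<Rightarrow> real" where
  "flat_exp j t = (if t > 0 then exp (- inverse t) * inverse t ^ j else 0)"

lemma flat_exp_tendsto_0: "(flat_exp j \<longlongrightarrow> 0) (at 0)"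
proof -
  have "((\<lambda>u. exp (- u) * u ^ j) \<longlongrightarrow> 0) (at_top :: real filter)"
    using tendsto_power_div_exp_0[of j] by (simp add: exp_minus field_simps)
  then have "((\<lambda>t. exp (- inverse t) * inverse t ^ j) \<longlongrightarrow> 0) (at_right (0::real))"
    by (subst filterlim_at_right_to_top) (simp add: power_inverse)
  then have "(flat_exp j \<longlongrightarrow> 0) (at_right 0)"
    by (rule Lim_transform_eventually) (auto simp: flat_exp_def eventually_at_right_field intro: exI[of _ 1])
  moreover have "(flat_exp j \<longlongrightarrow> 0) (at_left 0)"
    by (rule Lim_transform_eventually[OF tendsto_const]) (auto simp: flat_exp_def eventually_at_left_field intro: exI[of _ "-1"])
  ultimately show ?thesis by (simp add: filterlim_split_at)
qed

lemma flat_exp_has_derivative: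
  "(flat_exp j has_real_derivative (flat_exp (j + 2) t - real j * flat_exp (j + 1) t)) (at t)"
proof -
  consider "t > 0" | "t < 0" | "t = 0" by linarith
  then show ?thesis
  proof cases
    case 1
    have d: "(inverse has_real_derivative - (inverse t ^ 2)) (at t)"
      using DERIV_inverse[of t] 1 by (simp add: numeral_2_eq_2)
    have "((\<lambda>t. exp (- inverse t)) has_real_derivative exp (- inverse t) * inverse t ^ 2) (at t)"
      using DERIV_fun_exp[OF DERIV_minus[OF d]] by simp
    note DERIV_mult[OF this DERIV_power[OF d, of j]]
    moreover have "exp (- inverse t) * inverse t ^ 2 * inverse t ^ j +
        real j * (- (inverse t ^ 2) * inverse t ^ (j - Suc 0)) * exp (- inverse t)
      = flat_exp (j + 2) t - real j * flat_exp (j + 1) t"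
      using 1 by (cases j) (auto simp: flat_exp_def power2_eq_square algebra_simps)
    ultimately have "((\<lambda>t. exp (- inverse t) * inverse t ^ j) has_real_derivative (flat_exp (j + 2) t - real j * flat_exp (j + 1) t)) (at t)"
      by simp
    then show ?thesis
      by (rule has_field_derivative_transform_within_open[of _ _ _ "{0<..}"]) (use 1 in \<open>auto simp: flat_exp_def\<close>)
  next
    case 2
    have "((\<lambda>t::real. 0::real) has_real_derivative 0) (at t)" by simp
    then have "(flat_exp j has_real_derivative 0) (at t)"
      by (rule has_field_derivative_transform_within_open[of _ _ _ "{..<0}"]) (use 2 in \<open>auto simp: flat_exp_def\<close>)
    then show ?thesis using 2 by (simp add: flat_exp_def)
  next
    case 3
    \<comment> \<open>At 0 the difference quotient of \<open>flat_exp j\<close> is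
      \<open>flat_exp (Suc j)\<close>, whose limit is known.\<close>
    have "((\<lambda>h. (flat_exp j (0 + h) - flat_exp j 0) / h) \<longlongrightarrow> 0) (at 0)"
      by (rule Lim_transform_eventually[OF flat_exp_tendsto_0[of "Suc j"]])
        (auto simp: flat_exp_def eventually_at_filter field_simps intro!: always_eventually)
    then show ?thesis using 3 by (simp add: DERIV_def flat_exp_def)
  qed
qed

lemma Ck_flat_exp: "Ck k (flat_exp j)"
proof (induction k arbitrary: j)
  case 0
  have "continuous_on UNIV (flat_exp j)"
    using flat_exp_has_derivative DERIV_isCont by (intro continuous_at_imp_continuous_on) blast
  then show ?case by simp
next
  case (Suc k)
  have "(flat_exp j has_derivative (\<lambda>h. (flat_exp (j + 2) t - real j * flat_exp (j + 1) t) * h)) (at t)" for t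
    using flat_exp_has_derivative by (simp add: has_field_derivative_def)
  moreover have "Ck k (\<lambda>t. (flat_exp (j + 2) t + (- real j) * flat_exp (j + 1) t) * b)" for b
    by (intro Ck_mult Ck_add Ck_const Suc)
  ultimately show ?case by (intro Ck_SucI) (auto simp: algebra_simps)
qed

text \<open>A larger \<open>n\<close> only steepens the flanks: the support stays in the closed box
  while the bumps tend to the indicator of the open box. \<open>Suc n\<close> keeps the scaling
  factor positive.\<close>

definition box_bump :: "'a::euclidean_space \<Rightarrow> 'a \<Rightarrow> nat \<Rightarrow> 'a \<Rightarrow> real" where
  "box_bump a b n x = (\<Prod>i\<in>Basis. flat_exp 0 (real (Suc n) * (x \<bullet> i - a \<bullet> i)) * flat_exp 0 (real (Suc n) * (b \<bullet> i - x \<bullet> i)))"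

lemma flat_exp_0_bounds: "0 \<le> flat_exp 0 t" "flat_exp 0 t \<le> 1"
  by (auto simp: flat_exp_def)

lemma box_bump_bounds: "0 \<le> box_bump a b n x" "box_bump a b n x \<le> 1"
  unfolding box_bump_def
  by (auto intro!: prod_nonneg prod_le_1 mult_nonneg_nonneg mult_le_one flat_exp_0_bounds)

lemma box_bump_eq_0: "x \<notin> box a b \<Longrightarrow> box_bump a b n x = 0"
proof -
  assume "x \<notin> box a b"
  then obtain i where i: "i \<in> Basis" "\<not> (a \<bullet> i < x \<bullet> i \<and> x \<bullet> i < b \<bullet> i)" by (auto simp: mem_box)
  then have "x \<bullet> i - a \<bullet> i \<le> 0 \<or> b \<bullet> i - x \<bullet> i \<le> 0" by linarith
  then have "real (Suc n) * (x \<bullet> i - a \<bullet> i) \<le> 0 \<or> real (Suc n) * (b \<bullet> i - x \<bullet> i) \<le> 0"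
    by (simp only: mult_le_0_iff) auto
  then have "flat_exp 0 (real (Suc n) * (x \<bullet> i - a \<bullet> i)) * flat_exp 0 (real (Suc n) * (b \<bullet> i - x \<bullet> i)) = 0"
    by (auto simp: flat_exp_def)
  then show ?thesis unfolding box_bump_def using i(1) by (intro prod_zero) auto
qed

lemma smooth_box_bump: "smooth (box_bump a b n)"
  unfolding smooth_def
proof
  fix k
  have 1: "Ck k (\<lambda>x. flat_exp 0 (real (Suc n) * (x \<bullet> i - a \<bullet> i)))" for i
    using Ck_compose_affine[OF Ck_flat_exp, of k 0 "- (real (Suc n) * (a \<bullet> i))" "real (Suc n) *\<^sub>R i"]
    by (simp add: algebra_simps)
  have 2: "Ck k (\<lambda>x. flat_exp 0 (real (Suc n) * (b \<bullet> i - x \<bullet> i)))" for i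
    using Ck_compose_affine[OF Ck_flat_exp, of k 0 "real (Suc n) * (b \<bullet> i)" "- real (Suc n) *\<^sub>R i"]
    by (simp add: algebra_simps)
  show "Ck k (box_bump a b n)" unfolding box_bump_def[abs_def]
    by (intro Ck_prod Ck_mult 1 2)
qed

lemma test_functionI:
  assumes "smooth \<phi>" "\<And>x. x \<notin> K \<Longrightarrow> \<phi> x = 0" "compact K" "K \<subseteq> S"
  shows "test_function S \<phi>"
proof -
  have "closure {x. \<phi> x \<noteq> 0} \<subseteq> K"
    using assms(2,3) by (intro closure_minimal) (auto simp: compact_imp_closed)
  then show ?thesis
    using assms bounded_subset[OF compact_imp_bounded[OF assms(3)], of "{x. \<phi> x \<noteq> 0}"]
    unfolding test_function_def by (auto simp: compact_closure)
qed

lemma test_function_box_bump: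
  assumes "cbox a b \<subseteq> S" shows "test_function S (box_bump a b n)"
  using assms box_subset_cbox[of a b] by (intro test_functionI[of _ "cbox a b"] smooth_box_bump box_bump_eq_0) auto

lemma box_bump_tendsto: "(\<lambda>n. box_bump a b n x) \<longlonglongrightarrow> indicator (box a b) x"
proof (cases "x \<in> box a b")
  case True
  have lim: "(\<lambda>n. flat_exp 0 (real (Suc n) * t)) \<longlonglongrightarrow> 1" if "t > 0" for t
  proof -
    have "(\<lambda>n. exp (- (inverse (real (Suc n)) * inverse t))) \<longlonglongrightarrow> exp (- (0 * inverse t))"
      by (intro tendsto_intros LIMSEQ_inverse_real_of_nat)
    moreover have "flat_exp 0 (real (Suc n) * t) = exp (- (inverse (real (Suc n)) * inverse t))" for n
      using that by (simp add: flat_exp_def inverse_mult_distrib del: of_nat_Suc)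
    ultimately show ?thesis by simp
  qed
  have "(\<lambda>n. box_bump a b n x) \<longlonglongrightarrow> (\<Prod>i\<in>(Basis :: 'a set). 1 * 1)"
    unfolding box_bump_def by (intro tendsto_prod tendsto_mult lim) (use True in \<open>auto simp: mem_box\<close>)
  then show ?thesis using True by simp
qed (simp add: box_bump_eq_0)

lemma open_countable_boxes:
  fixes S :: "'a::euclidean_space set"
  assumes "open S"
  obtains a b :: "nat \<Rightarrow> 'a" where "\<And>k. cbox (a k) (b k) \<subseteq> S" "(\<Union>k. box (a k) (b k)) = S"
proof -
  let ?F = "{box a b | a b. cbox a b \<subseteq> S}"
  have "\<Union>?F = S"
  proof
    show "\<Union>?F \<subseteq> S" using box_subset_cbox by blast
    show "S \<subseteq> \<Union>?F"
    proof
      fix x assume "x \<in> S"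
      then obtain a b where "x \<in> box a b" "cbox a b \<subseteq> S" using open_contains_cbox[OF assms] by metis
      then show "x \<in> \<Union>?F" by blast
    qed
  qed
  note S = this
  obtain F' where F': "F' \<subseteq> ?F" "countable F'" "\<Union>F' = \<Union>?F"
    by (rule Lindelof[of ?F]) auto
  \<comment> \<open>Adding the empty box makes the family nonempty, as an enumeration by
    \<open>nat\<close> requires.\<close>
  have "box One (0::'a) = {}" "cbox One (0::'a) = {}" by (auto simp: box_eq_empty intro: SOME_Basis)
  then have "{} \<in> ?F" by (intro CollectI exI[of _ One] exI[of _ 0]) simp
  then have "insert {} F' \<subseteq> ?F" using F'(1) by blast
  define U where "U = from_nat_into (insert {} F')"
  have r: "range U = insert {} F'" unfolding U_def using F'(2) by (intro range_from_nat_into) auto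
  have "\<exists>a b. U k = box a b \<and> cbox a b \<subseteq> S" for k
  proof -
    have "U k \<in> insert {} F'" using r rangeI[of U k] by simp
    then have "U k \<in> ?F" using \<open>insert {} F' \<subseteq> ?F\<close> by (rule rev_subsetD)
    then show ?thesis by simp
  qed
  then obtain a b where ab: "\<And>k. U k = box (a k) (b k) \<and> cbox (a k) (b k) \<subseteq> S" by metis
  have "(\<Union>k. box (a k) (b k)) = \<Union>(range U)" using ab by simp
  also have "\<dots> = S" using r F'(3) S by simp
  finally show thesis by (intro that[of a b]) (use ab in auto)
qed

lemma exhausting_test_functions:
  fixes S :: "'a::euclidean_space set"
  assumes "open S"
  obtains \<psi> :: "nat \<Rightarrow> 'a \<Rightarrow> real" where "\<And>k. test_function S (\<psi> k)"
    "\<And>k x. 0 \<le> \<psi> k x" "\<And>k x. \<psi> k x \<le> 1" "\<And>x. x \<in> S \<Longrightarrow> (\<lambda>k. \<psi> k x) \<longlonglongrightarrow> 1"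
proof -
  obtain a b :: "nat \<Rightarrow> 'a" where ab: "\<And>k. cbox (a k) (b k) \<subseteq> S" "(\<Union>k. box (a k) (b k)) = S"
    using open_countable_boxes[OF assms] by metis
  \<comment> \<open>One minus the product of the complements is a smooth substitute for the maximum
    of the first \<open>k\<close> bumps: it lies in \<open>{0..1}\<close>, vanishes outside their
    boxes and dominates each of them. The index \<open>k\<close> also steepens the bumps, which
    drives \<open>\<psi> k\<close> to 1 on every box.\<close>
  define \<psi> where "\<psi> k x = 1 + (- 1) * (\<Prod>j<k. 1 + (- 1) * box_bump (a j) (b j) k x)" for k x
  have p: "0 \<le> (\<Prod>j<k. 1 + (- 1) * box_bump (a j) (b j) k x)" "(\<Prod>j<k. 1 + (- 1) * box_bump (a j) (b j) k x) \<le> 1" for k x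
    by (auto intro!: prod_nonneg prod_le_1 simp: box_bump_bounds)
  show thesis
  proof (rule that)
    show "0 \<le> \<psi> k x" "\<psi> k x \<le> 1" for k x unfolding \<psi>_def using p[of k x] by auto
    show "test_function S (\<psi> k)" for k
    proof (rule test_functionI)
      have "Ck m (box_bump (a j) (b j) k)" for m j using smooth_box_bump[of "a j" "b j" k] by (simp add: smooth_def)
      then have "Ck m (\<psi> k)" for m unfolding \<psi>_def[abs_def] by (intro Ck_add Ck_const Ck_mult Ck_prod)
      then show "smooth (\<psi> k)" by (simp add: smooth_def)
      show "\<psi> k x = 0" if "x \<notin> (\<Union>j<k. cbox (a j) (b j))" for x
      proof -
        have "box_bump (a j) (b j) k x = 0" if "j < k" for j
          using that \<open>x \<notin> _\<close> box_subset_cbox by (intro box_bump_eq_0) blast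
        then show ?thesis by (simp add: \<psi>_def)
      qed
      show "compact (\<Union>j<k. cbox (a j) (b j))" by auto
      show "(\<Union>j<k. cbox (a j) (b j)) \<subseteq> S" using ab(1) by blast
    qed
    show "(\<lambda>k. \<psi> k x) \<longlonglongrightarrow> 1" if "x \<in> S" for x
    proof -
      obtain j where j: "x \<in> box (a j) (b j)" using ab(2) \<open>x \<in> S\<close> by blast
      have "(\<lambda>k. box_bump (a j) (b j) k x) \<longlonglongrightarrow> 1" using box_bump_tendsto[of "a j" "b j" x] j by simp
      moreover have "\<forall>\<^sub>F k in sequentially. box_bump (a j) (b j) k x \<le> \<psi> k x"
        using eventually_gt_at_top[of j]
      proof eventually_elim
        case (elim k)
        let ?f = "\<lambda>j. 1 + (- 1) * box_bump (a j) (b j) k x"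
        have "prod ?f {..<k} = ?f j * prod ?f ({..<k} - {j})" using elim by (intro prod.remove) auto
        also have "\<dots> \<le> ?f j * 1"
          by (intro mult_left_mono prod_le_1) (auto simp: box_bump_bounds)
        finally show ?case by (simp add: \<psi>_def)
      qed
      moreover have "\<forall>\<^sub>F k in sequentially. \<psi> k x \<le> 1"
        unfolding \<psi>_def using p by (intro always_eventually) auto
      ultimately show ?thesis 
        by (intro tendsto_sandwich[of "\<lambda>k. box_bump (a j) (b j) k x" "\<lambda>k. \<psi> k x" sequentially "\<lambda>_. 1"]) auto
    qed
  qed
qed

section \<open>The fundamental lemma of the calculus of variations\<close>

lemma L2_inner_Cauchy_Schwarz:
  fixes v w :: "'a \<Rightarrow> 'b::euclidean_space"
  assumes v: "v \<in> L2 M" and w: "w \<in> L2 M"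
  shows "integrable M (\<lambda>x. v x \<bullet> w x)" "\<bar>L2_inner M v w\<bar> \<le> L2_norm M v * L2_norm M w"
proof -
  have [measurable]: "v \<in> borel_measurable M" "w \<in> borel_measurable M" using v w by (auto simp: L2_def)
  have iv: "integrable M (\<lambda>x. (norm (v x))\<^sup>2)" and iw: "integrable M (\<lambda>x. (norm (w x))\<^sup>2)"
    using v w by (auto simp: L2_def)
  have am: "norm (v x) * norm (w x) \<le> (norm (v x))\<^sup>2 + (norm (w x))\<^sup>2" for x
  proof -
    have "0 \<le> norm (v x) * norm (w x)" by simp
    then show ?thesis using sum_squares_bound[of "norm (v x)" "norm (w x)"] by linarith
  qed
  have ivw: "integrable M (\<lambda>x. norm (v x) * norm (w x))"
    by (rule Bochner_Integration.integrable_bound[OF Bochner_Integration.integrable_add[OF iv iw]])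
      (use am in \<open>auto simp: abs_mult\<close>)
  show int: "integrable M (\<lambda>x. v x \<bullet> w x)"
    by (rule Bochner_Integration.integrable_bound[OF ivw]) (auto simp: Cauchy_Schwarz_ineq2)
  define a b c where "a = (\<integral>x. (norm (v x))\<^sup>2 \<partial>M)" and "b = (\<integral>x. (norm (w x))\<^sup>2 \<partial>M)"
    and "c = (\<integral>x. norm (v x) * norm (w x) \<partial>M)"
  have nn: "a \<ge> 0" "b \<ge> 0" "c \<ge> 0" by (auto simp: a_def b_def c_def)
  \<comment> \<open>The inequality is read off from this nonnegative polynomial at its minimiser
    \<open>c / a\<close>. If \<open>a = 0\<close> it is linear in \<open>t\<close>, and a nonzero
    \<open>c\<close> would make it -1 at \<open>(b + 1) / (2 * c)\<close>.\<close>
  have q: "0 \<le> t\<^sup>2 * a - 2 * t * c + b" for t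
  proof -
    have "0 \<le> (\<integral>x. (t * norm (v x) - norm (w x))\<^sup>2 \<partial>M)" by simp
    also have "\<dots> = (\<integral>x. t\<^sup>2 * (norm (v x))\<^sup>2 - 2 * t * (norm (v x) * norm (w x)) + (norm (w x))\<^sup>2 \<partial>M)"
      by (intro Bochner_Integration.integral_cong) (auto simp: power2_eq_square algebra_simps)
    also have "\<dots> = t\<^sup>2 * a - 2 * t * c + b"
      using iv iw ivw by (simp add: a_def b_def c_def)
    finally show ?thesis .
  qed
  have "c\<^sup>2 \<le> a * b"
  proof (cases "a = 0")
    case True
    have "c = 0"
    proof (rule ccontr)
      assume "c \<noteq> 0"
      then have "2 * ((b + 1) / (2 * c)) * c = b + 1" by simp
      then show False using q[of "(b + 1) / (2 * c)"] True by simp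
    qed
    then show ?thesis using True by simp
  next
    case False
    have "(c / a)\<^sup>2 * a - 2 * (c / a) * c + b = b - c\<^sup>2 / a"
      using False by (simp add: power2_eq_square field_simps)
    then have "c\<^sup>2 / a \<le> b" using q[of "c / a"] by simp
    then show ?thesis using False nn by (simp add: divide_le_eq mult.commute)
  qed
  then have "c \<le> sqrt (a * b)" by (rule real_le_rsqrt)
  moreover have "\<bar>L2_inner M v w\<bar> \<le> c"
    unfolding L2_inner_def c_def
    by (rule order_trans[OF integral_abs_bound integral_mono]) (use int ivw in \<open>auto simp: Cauchy_Schwarz_ineq2\<close>)
  ultimately show "\<bar>L2_inner M v w\<bar> \<le> L2_norm M v * L2_norm M w"
    by (simp add: L2_norm_def a_def b_def real_sqrt_mult)
qed

lemma L2_norm_nonneg [simp]: "L2_norm M v \<ge> 0"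
  by (simp add: L2_norm_def)

lemma L2_diff:
  assumes v: "v \<in> L2 M" and w: "w \<in> L2 M"
  shows "(\<lambda>x. v x - w x) \<in> L2 M"
proof -
  have [measurable]: "v \<in> borel_measurable M" "w \<in> borel_measurable M" using v w by (auto simp: L2_def)
  have iv: "integrable M (\<lambda>x. (norm (v x))\<^sup>2)" and iw: "integrable M (\<lambda>x. (norm (w x))\<^sup>2)"
    using v w by (auto simp: L2_def)
  have le: "(norm (v x - w x))\<^sup>2 \<le> 2 * (norm (v x))\<^sup>2 + 2 * (norm (w x))\<^sup>2" for x
  proof -
    have "(norm (v x - w x))\<^sup>2 \<le> (norm (v x) + norm (w x))\<^sup>2"
      by (intro power_mono norm_triangle_ineq4) simp
    also have "\<dots> \<le> 2 * (norm (v x))\<^sup>2 + 2 * (norm (w x))\<^sup>2"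
      using sum_squares_bound[of "norm (v x)" "norm (w x)"] by (simp add: power2_sum)
    finally show ?thesis .
  qed
  have "integrable M (\<lambda>x. (norm (v x - w x))\<^sup>2)"
  proof (rule Bochner_Integration.integrable_bound)
    show "integrable M (\<lambda>x. 2 * (norm (v x))\<^sup>2 + 2 * (norm (w x))\<^sup>2)" using iv iw by simp
    show "AE x in M. norm ((norm (v x - w x))\<^sup>2) \<le> norm (2 * (norm (v x))\<^sup>2 + 2 * (norm (w x))\<^sup>2)"
    proof (rule AE_I2)
      fix x
      show "norm ((norm (v x - w x))\<^sup>2) \<le> norm (2 * (norm (v x))\<^sup>2 + 2 * (norm (w x))\<^sup>2)"
        using order_trans[OF le[of x] abs_ge_self] by (simp only: real_norm_def abs_power2)
    qed
  qed measurable
  then show ?thesis by (simp add: L2_def)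
qed

lemma (in finite_measure) L2_integrable:
  assumes "v \<in> L2 M" shows "integrable M v"
proof -
  have [measurable]: "v \<in> borel_measurable M" using assms by (auto simp: L2_def)
  have le: "norm (v x) \<le> 1 + (norm (v x))\<^sup>2" for x
    using sum_squares_bound[of "norm (v x)" 1] zero_le_power2[of "norm (v x)"] norm_ge_zero[of "v x"]
    unfolding power_one by linarith
  show ?thesis
  proof (rule Bochner_Integration.integrable_bound)
    show "integrable M (\<lambda>x. 1 + (norm (v x))\<^sup>2)" using assms by (simp add: L2_def)
    show "AE x in M. norm (v x) \<le> norm (1 + (norm (v x))\<^sup>2)"
      using order_trans[OF le abs_ge_self] by (intro AE_I2) (simp only: real_norm_def)
  qed measurable
qed

lemma (in finite_measure) L2_bounded:
  assumes [measurable]: "v \<in> borel_measurable M" and "AE x in M. norm (v x) \<le> C"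
  shows "v \<in> L2 M"
proof -
  have "AE x in M. norm ((norm (v x))\<^sup>2) \<le> C\<^sup>2"
    using assms(2) by eventually_elim (simp add: power_mono)
  then have "integrable M (\<lambda>x. (norm (v x))\<^sup>2)" by (intro integrable_const_bound) auto
  then show ?thesis by (simp add: L2_def)
qed

lemma test_function_continuous: "test_function S \<phi> \<Longrightarrow> continuous_on UNIV \<phi>"
  unfolding test_function_def smooth_def using Ck.simps(1) by blast

lemma test_function_bounded:
  assumes "test_function S \<phi>"
  obtains C where "\<And>x. \<bar>\<phi> x\<bar> \<le> C"
proof -
  have c: "compact (closure {x. \<phi> x \<noteq> 0})" using assms by (simp add: test_function_def)
  have "compact (\<phi> ` closure {x. \<phi> x \<noteq> 0})"
    by (intro compact_continuous_image continuous_on_subset[OF test_function_continuous[OF assms]] c) auto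
  then have "bounded (\<phi> ` closure {x. \<phi> x \<noteq> 0})" by (rule compact_imp_bounded)
  then obtain C where C: "\<forall>y\<in>\<phi> ` closure {x. \<phi> x \<noteq> 0}. norm y \<le> C" unfolding bounded_iff by blast
  have "\<bar>\<phi> x\<bar> \<le> \<bar>C\<bar>" for x
  proof (cases "\<phi> x = 0")
    case False
    then have "x \<in> closure {x. \<phi> x \<noteq> 0}" by (intro subsetD[OF closure_subset]) simp
    then have "norm (\<phi> x) \<le> C" using C by blast
    then show ?thesis by simp
  qed simp
  then show thesis by (rule that)
qed

text \<open>Bumps tend to indicators of boxes, so the integral of \<open>g\<close> vanishes over
  every box whose closure is in \<open>S\<close>. Boxes form an intersection-stable generator of the
  Borel sets; hence within one such box all integrals over Borel sets vanish and \<open>g\<close> is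
  0 a.e. there. Countably many of these boxes cover \<open>S\<close>.\<close>

lemma fundamental_lemma:
  fixes g :: "'a::euclidean_space \<Rightarrow> real"
  assumes "open S" and g: "integrable (lebesgue_on S) g"
    and 0: "\<And>\<phi>. test_function S \<phi> \<Longrightarrow> (\<integral>x. \<phi> x * g x \<partial>lebesgue_on S) = 0"
  shows "AE x in lebesgue_on S. g x = 0"
proof -
  have S: "S \<inter> space lebesgue \<in> sets lebesgue" using assms(1) by simp
  have G: "integrable lebesgue (\<lambda>x. indicator S x * g x)"
    using g integrable_restrict_space[OF S, of g] by simp
  \<comment> \<open>A Borel representative lets the generator argument run over
    \<open>lborel\<close> instead of the completed sigma-algebra.\<close>
  then obtain G' where G'm [measurable]: "G' \<in> borel_measurable lborel"
    and G': "AE x in lborel. indicator S x * g x = G' x"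
    using completion_ex_borel_measurable_real[of "\<lambda>x. indicator S x * g x" lborel] by blast
  have AEG: "AE x in lebesgue. G' x = indicator S x * g x"
    using AE_completion[OF G'] by (rule AE_mp) auto
  have Gl: "G' \<in> borel_measurable lebesgue" by (rule measurable_completion) measurable
  have "integrable lebesgue G'"
    using G AEG Gl by (subst integrable_cong_AE[of _ _ "\<lambda>x. indicator S x * g x"]) auto
  then have int: "integrable lborel G'" using integrable_completion[of G' lborel] by simp
  have test: "(\<integral>x. \<phi> x * G' x \<partial>lborel) = 0" if t: "test_function S \<phi>" for \<phi>
  proof -
    have [measurable]: "\<phi> \<in> borel_measurable borel"
      using test_function_continuous[OF t] by (rule borel_measurable_continuous_onI)
    have pl: "\<phi> \<in> borel_measurable lebesgue" by (rule measurable_completion) measurable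
    have "(\<integral>x. \<phi> x * G' x \<partial>lborel) = (\<integral>x. \<phi> x * G' x \<partial>lebesgue)"
      by (rule integral_completion[symmetric]) measurable
    also have "\<dots> = (\<integral>x. \<phi> x * (indicator S x * g x) \<partial>lebesgue)"
    proof (rule integral_cong_AE[OF borel_measurable_times[OF pl Gl] borel_measurable_times[OF pl borel_measurable_integrable[OF G]]])
      show "AE x in lebesgue. \<phi> x * G' x = \<phi> x * (indicator S x * g x)"
        using AEG by eventually_elim simp
    qed
    also have "\<dots> = (\<integral>x. \<phi> x * g x \<partial>lebesgue_on S)"
      unfolding integral_restrict_space[OF S] by (simp add: mult.left_commute)
    finally show ?thesis using 0[OF t] by simp
  qed
  have box0: "(\<integral>x. indicator (box a b) x * G' x \<partial>lborel) = 0" if ab: "cbox a b \<subseteq> S" for a b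
  proof -
    have "(\<lambda>n. \<integral>x. box_bump a b n x * G' x \<partial>lborel) \<longlonglongrightarrow> (\<integral>x. indicator (box a b) x * G' x \<partial>lborel)"
    proof (rule integral_dominated_convergence[where w = "\<lambda>x. norm (G' x)"])
      show "(\<lambda>x. box_bump a b n x * G' x) \<in> borel_measurable lborel" for n
      proof -
        have [measurable]: "box_bump a b n \<in> borel_measurable borel"
          using test_function_continuous[OF test_function_box_bump[OF ab]] by (rule borel_measurable_continuous_onI)
        show ?thesis by measurable
      qed
      show "AE x in lborel. (\<lambda>n. box_bump a b n x * G' x) \<longlonglongrightarrow> indicator (box a b) x * G' x"
        by (intro AE_I2 tendsto_mult_right box_bump_tendsto)
      show "AE x in lborel. norm (box_bump a b n x * G' x) \<le> norm (G' x)" for n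
        using box_bump_bounds[of a b n] by (intro AE_I2) (auto simp: abs_mult intro!: mult_left_le_one_le)
    qed (use int in auto)
    moreover have "(\<lambda>n. \<integral>x. box_bump a b n x * G' x \<partial>lborel) = (\<lambda>n. 0)"
      using test[OF test_function_box_bump[OF ab]] by auto
    ultimately show ?thesis by (simp add: LIMSEQ_const_iff)
  qed
  have local: "AE x in lborel. indicator (box a b) x * G' x = 0" if ab: "cbox a b \<subseteq> S" for a b
  proof -
    let ?f = "\<lambda>x. indicator (box a b) x * G' x"
    have fi: "integrable lborel ?f"
      using integrable_mult_indicator[of "box a b" lborel G'] int by simp
    have "(\<integral>x\<in>A. ?f x \<partial>lborel) = 0" if "A \<in> sets borel" for A :: "'a set"
    proof -
      have st: "Int_stable (range (\<lambda>(a, b). box a b :: 'a set))"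
      proof (rule Int_stableI)
        fix A B assume "A \<in> range (\<lambda>(a, b). box a b :: 'a set)" "B \<in> range (\<lambda>(a, b). box a b :: 'a set)"
        then obtain a b c d where "A = box a b" "B = box c d" by auto
        then have "\<exists>p r. A \<inter> B = box p r" using box_Int_box by blast
        then show "A \<inter> B \<in> range (\<lambda>(a, b). box a b :: 'a set)" by auto
      qed
      have eq: "sets borel = sigma_sets UNIV (range (\<lambda>(a, b). box a b :: 'a set))"
        by (subst borel_eq_box) simp
      have A: "A \<in> sigma_sets UNIV (range (\<lambda>(a, b). box a b :: 'a set))" using that eq by simp
      have P: "range (\<lambda>(a, b). box a b :: 'a set) \<subseteq> Pow UNIV" by simp
      from st P A show ?thesis
      proof (induction rule: sigma_sets_induct_disjoint)
        case (basic A)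
        then obtain c d where A: "A = box c d" by auto
        obtain p r where pr: "box c d \<inter> box a b = box p r" using box_Int_box by blast
        have "(\<integral>x. indicator (box p r) x * G' x \<partial>lborel) = 0"
        proof (cases "box p r = {}")
          case False
          \<comment> \<open>\<open>box0\<close> asks for the closed box to lie in \<open>S\<close>;
            for a nonempty box it is the closure of the open one, which is contained in
            \<open>box a b\<close>.\<close>
          then have "cbox p r = closure (box p r)" by (simp add: closure_box)
          also have "\<dots> \<subseteq> closure (box a b)" using pr by (intro closure_mono) blast
          also have "\<dots> \<subseteq> cbox a b" by (intro closure_minimal box_subset_cbox closed_cbox)
          finally show ?thesis using ab by (intro box0) blast
        qed simp
        then have "(\<integral>x. indicator (box c d \<inter> box a b) x * G' x \<partial>lborel) = 0"
          using pr by simp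
        then show ?case unfolding A set_lebesgue_integral_def by (simp add: indicator_inter_arith mult.assoc)
      next
        case empty
        then show ?case by (simp add: set_lebesgue_integral_def)
      next
        case (compl A)
        then have [measurable]: "A \<in> sets borel" using eq by simp
        have ia: "integrable lborel (\<lambda>x. indicator A x *\<^sub>R ?f x)"
          by (rule integrable_mult_indicator[OF _ fi]) simp
        have "(\<lambda>x. indicator (UNIV - A) x *\<^sub>R ?f x) = (\<lambda>x. ?f x - indicator A x *\<^sub>R ?f x)"
          by (auto simp: indicator_def fun_eq_iff)
        then have "(\<integral>x\<in>UNIV - A. ?f x \<partial>lborel) = (\<integral>x. ?f x \<partial>lborel) - (\<integral>x\<in>A. ?f x \<partial>lborel)"
          unfolding set_lebesgue_integral_def using fi ia by (simp only: Bochner_Integration.integral_diff)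
        then show ?case using compl box0[OF ab] by simp
      next
        case (union A)
        have m: "A i \<in> sets lborel" for i
        proof -
          have "A i \<in> sigma_sets UNIV (range (\<lambda>(a, b). box a b :: 'a set))" using union(2) by blast
          then show ?thesis using eq by simp
        qed
        have "(\<integral>x\<in>(\<Union>i. A i). ?f x \<partial>lborel) = (\<Sum>i. \<integral>x\<in>A i. ?f x \<partial>lborel)"
        proof (rule lebesgue_integral_countable_add[OF m])
          show "A i \<inter> A j = {}" if "i \<noteq> j" for i j
            using union(1) that by (auto simp: disjoint_family_on_def)
          show "set_integrable lborel (\<Union>i. A i) ?f"
            unfolding set_integrable_def using m fi by (intro integrable_mult_indicator) auto
        qed
        then show ?case using union by simp
      qed
    qed
    then have z: "(\<integral>x\<in>A. ?f x \<partial>lborel) = (\<integral>x\<in>A. 0 \<partial>lborel)" if "A \<in> sets lborel" for A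
      using that by simp
    show ?thesis by (rule density_unique_real[OF fi _ z]) simp_all
  qed
  obtain a b :: "nat \<Rightarrow> 'a" where ab: "\<And>k. cbox (a k) (b k) \<subseteq> S" "(\<Union>k. box (a k) (b k)) = S"
    using open_countable_boxes[OF assms(1)] by metis
  have "AE x in lborel. \<forall>k. indicator (box (a k) (b k)) x * G' x = 0"
    unfolding AE_all_countable using local[OF ab(1)] by blast
  then have "AE x in lborel. x \<in> S \<longrightarrow> g x = 0"
    using G'
  proof eventually_elim
    case (elim x)
    show ?case
    proof
      assume "x \<in> S"
      then obtain k where k: "x \<in> box (a k) (b k)" using ab(2) by blast
      have "indicator (box (a k) (b k)) x * G' x = 0" using elim(1) by blast
      then have "G' x = 0" using k by simp
      then show "g x = 0" using elim(2) \<open>x \<in> S\<close> by simp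
    qed
  qed
  then have "AE x in lebesgue. x \<in> S \<longrightarrow> g x = 0" by (rule AE_completion)
  then show ?thesis using AE_restrict_space_iff[OF S] by simp
qed

section \<open>Sobolev functions and traces\<close>

lemma integrable_bounded_scaleR:
  fixes f :: "'a \<Rightarrow> 'b::euclidean_space"
  assumes f: "integrable M f" and c: "c \<in> borel_measurable M" and C: "AE x in M. \<bar>c x\<bar> \<le> C"
  shows "integrable M (\<lambda>x. c x *\<^sub>R f x)"
proof (rule Bochner_Integration.integrable_bound)
  show "integrable M (\<lambda>x. C * norm (f x))" using f by simp
  show "AE x in M. norm (c x *\<^sub>R f x) \<le> norm (C * norm (f x))"
    using C
  proof eventually_elim
    case (elim x)
    have "norm (c x *\<^sub>R f x) \<le> C * norm (f x)"
      using mult_right_mono[OF elim norm_ge_zero[of "f x"]] by simp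
    also have "\<dots> \<le> norm (C * norm (f x))" by (simp only: real_norm_def abs_ge_self)
    finally show ?case .
  qed
qed (use f c in measurable)

lemma test_function_scaleR_integrable:
  fixes g :: "'a::euclidean_space \<Rightarrow> 'b::euclidean_space"
  assumes "open S" and g: "integrable (lebesgue_on S) g" and t: "test_function S \<phi>"
  shows "integrable (lebesgue_on S) (\<lambda>x. \<phi> x *\<^sub>R g x)"
proof -
  obtain C where C: "\<And>x. \<bar>\<phi> x\<bar> \<le> C" using test_function_bounded[OF t] by blast
  have "\<phi> \<in> borel_measurable borel"
    using test_function_continuous[OF t] by (rule borel_measurable_continuous_onI)
  then have "\<phi> \<in> borel_measurable lborel" by simp
  then have "\<phi> \<in> borel_measurable (lebesgue_on S)"
    by (intro measurable_restrict_space1 measurable_completion)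
  then show ?thesis
    using C by (intro integrable_bounded_scaleR[OF g] AE_I2)
qed

text \<open>The geometry so far holds in any Euclidean space, whereas the Sobolev notions are given
  in coordinates, on \<open>real^'n\<close>.\<close>

locale polygonal_arrangement = arrangement \<Omega> AA
  for \<Omega> :: "(real^'n) set" and AA :: "((real^'n) \<times> real) set"
begin

lemma domain_lebesgue [simp]: "\<Omega> \<in> sets lebesgue" "\<Omega> \<inter> space lebesgue \<in> sets lebesgue"
  using open_domain by auto

sublocale D: finite_measure "lebesgue_on \<Omega>"
proof (rule finite_measureI)
  have "emeasure lebesgue \<Omega> < \<infinity>"
    using emeasure_bounded_finite[OF bounded_domain] open_domain by simp
  then show "emeasure (lebesgue_on \<Omega>) (space (lebesgue_on \<Omega>)) \<noteq> \<infinity>"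
    by (simp add: emeasure_restrict_space)
qed

sublocale S: finite_measure "surface_measure \<Omega>"
  by (rule finite_surface_measure)

lemma borel_measurable_domain:
  "f \<in> borel_measurable borel \<Longrightarrow> f \<in> borel_measurable (lebesgue_on \<Omega>)"
  by (intro measurable_restrict_space1 measurable_completion) simp

lemma integral_domain:
  fixes f :: "real^'n \<Rightarrow> real"
  assumes "f \<in> borel_measurable borel"
  shows "(\<integral>x. f x \<partial>lebesgue_on \<Omega>) = (\<integral>x. indicator \<Omega> x * f x \<partial>lborel)"
proof -
  have [measurable]: "\<Omega> \<in> sets borel" using open_domain by simp
  have [measurable]: "f \<in> borel_measurable borel" by fact
  show ?thesis
    by (subst integral_restrict_space) (simp_all add: integral_completion)
qed

lemma bounded_on_closure:
  fixes f :: "real^'n \<Rightarrow> 'b::euclidean_space"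
  assumes "continuous_on UNIV f"
  obtains C where "\<And>x. x \<in> closure \<Omega> \<Longrightarrow> norm (f x) \<le> C"
proof -
  have "compact (closure \<Omega>)" using bounded_domain by (simp add: compact_closure)
  then have "compact (f ` closure \<Omega>)" by (intro compact_continuous_image continuous_on_subset[OF assms]) auto
  then have "bounded (f ` closure \<Omega>)" by (rule compact_imp_bounded)
  then obtain C where "\<forall>y\<in>f ` closure \<Omega>. norm y \<le> C" unfolding bounded_iff by blast
  then show thesis by (intro that[of C]) simp
qed

lemma continuous_L2:
  fixes f :: "real^'n \<Rightarrow> 'b::euclidean_space"
  assumes f: "continuous_on UNIV f"
  shows "f \<in> L2 (lebesgue_on \<Omega>)" "f \<in> L2 (surface_measure \<Omega>)"
proof -
  obtain C where C: "\<And>x. x \<in> closure \<Omega> \<Longrightarrow> norm (f x) \<le> C" using bounded_on_closure[OF f] by blast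
  have m: "f \<in> borel_measurable borel" using f by (rule borel_measurable_continuous_onI)
  show "f \<in> L2 (lebesgue_on \<Omega>)"
  proof (rule D.L2_bounded[OF borel_measurable_domain[OF m]])
    show "AE x in lebesgue_on \<Omega>. norm (f x) \<le> C"
      using C subsetD[OF closure_subset, of _ \<Omega>] by (intro AE_I2) simp
  qed
  show "f \<in> L2 (surface_measure \<Omega>)"
  proof (rule S.L2_bounded[of _ C])
    show "AE x in surface_measure \<Omega>. norm (f x) \<le> C"
      using AE_surface_measure by eventually_elim (auto simp: facet_def frontier_def intro!: C)
  qed (use m in simp)
qed

text \<open>On the bounded domain \<open>L2\<close> functions are integrable, and the fundamental
  lemma applies to each component of the difference. This is what allows the arbitrary choice
  \<open>wpartial\<close> to be identified with a concrete derivative.\<close>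

lemma is_weak_partial_unique:
  fixes v :: "real^'n \<Rightarrow> 'b::euclidean_space"
  assumes g: "g \<in> L2 (lebesgue_on \<Omega>)" "is_weak_partial \<Omega> i v g"
    and h: "h \<in> L2 (lebesgue_on \<Omega>)" "is_weak_partial \<Omega> i v h"
  shows "AE x in lebesgue_on \<Omega>. g x = h x"
proof -
  have gi: "integrable (lebesgue_on \<Omega>) g" and hi: "integrable (lebesgue_on \<Omega>) h"
    using D.L2_integrable g h by auto
  have "AE x in lebesgue_on \<Omega>. (g x - h x) \<bullet> b = 0" for b
  proof (rule fundamental_lemma[OF open_domain])
    show "integrable (lebesgue_on \<Omega>) (\<lambda>x. (g x - h x) \<bullet> b)"
      using gi hi by (intro integrable_inner_left Bochner_Integration.integrable_diff) auto
    fix \<phi> assume t: "test_function \<Omega> \<phi>"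
    have p: "integrable (lebesgue_on \<Omega>) (\<lambda>x. \<phi> x *\<^sub>R g x)" "integrable (lebesgue_on \<Omega>) (\<lambda>x. \<phi> x *\<^sub>R h x)"
      using test_function_scaleR_integrable[OF open_domain _ t] gi hi by auto
    have "(\<integral>x. \<phi> x * ((g x - h x) \<bullet> b) \<partial>lebesgue_on \<Omega>) = (\<integral>x. (\<phi> x *\<^sub>R g x - \<phi> x *\<^sub>R h x) \<bullet> b \<partial>lebesgue_on \<Omega>)"
      by (simp add: inner_diff_left right_diff_distrib)
    also have "\<dots> = ((\<integral>x. \<phi> x *\<^sub>R g x \<partial>lebesgue_on \<Omega>) - (\<integral>x. \<phi> x *\<^sub>R h x \<partial>lebesgue_on \<Omega>)) \<bullet> b"
      using p by (subst integral_inner_left) (auto simp: Bochner_Integration.integral_diff)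
    also have "(\<integral>x. \<phi> x *\<^sub>R g x \<partial>lebesgue_on \<Omega>) = (\<integral>x. \<phi> x *\<^sub>R h x \<partial>lebesgue_on \<Omega>)"
      using g(2)[unfolded is_weak_partial_def, rule_format, OF t] h(2)[unfolded is_weak_partial_def, rule_format, OF t]
      by simp
    finally show "(\<integral>x. \<phi> x * ((g x - h x) \<bullet> b) \<partial>lebesgue_on \<Omega>) = 0" by simp
  qed
  then have "AE x in lebesgue_on \<Omega>. \<forall>b\<in>Basis. (g x - h x) \<bullet> b = 0"
    by (intro AE_finite_allI) auto
  then show ?thesis
  proof eventually_elim
    case (elim x)
    then have "g x - h x = 0" by (simp only: euclidean_all_zero_iff)
    then show ?case by simp
  qed
qed

lemma wpartial_props:
  assumes "v \<in> H1 \<Omega>"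
  shows "wpartial \<Omega> i v \<in> L2 (lebesgue_on \<Omega>)" "is_weak_partial \<Omega> i v (wpartial \<Omega> i v)"
proof -
  have "\<exists>g. g \<in> L2 (lebesgue_on \<Omega>) \<and> is_weak_partial \<Omega> i v g"
    using assms by (auto simp: H1_def)
  from someI_ex[OF this]
  show "wpartial \<Omega> i v \<in> L2 (lebesgue_on \<Omega>)" "is_weak_partial \<Omega> i v (wpartial \<Omega> i v)"
    by (auto simp: wpartial_def)
qed

lemma wpartial_eq:
  assumes g: "g \<in> L2 (lebesgue_on \<Omega>)" "is_weak_partial \<Omega> i v g"
  shows "AE x in lebesgue_on \<Omega>. wpartial \<Omega> i v x = g x"
proof -
  from someI_ex[of "\<lambda>g. g \<in> L2 (lebesgue_on \<Omega>) \<and> is_weak_partial \<Omega> i v g"] g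
  have "wpartial \<Omega> i v \<in> L2 (lebesgue_on \<Omega>)" "is_weak_partial \<Omega> i v (wpartial \<Omega> i v)"
    by (auto simp: wpartial_def)
  then show ?thesis by (rule is_weak_partial_unique[OF _ _ g])
qed

lemma smooth_frechet_derivative:
  fixes s :: "real^'n \<Rightarrow> 'b::euclidean_space"
  assumes "smooth s"
  shows "(s has_derivative frechet_derivative s (at x)) (at x)"
    "continuous_on UNIV (\<lambda>x. frechet_derivative s (at x) (axis i 1))" "continuous_on UNIV s"
proof -
  have C: "Ck (Suc 0) s" "Ck 0 s" using assms unfolding smooth_def by blast+
  show "(s has_derivative frechet_derivative s (at x)) (at x)"
    by (rule Ck_Suc_has_derivative[OF C(1)])
  show "continuous_on UNIV s" using C(2) by simp
  show "continuous_on UNIV (\<lambda>x. frechet_derivative s (at x) (axis i 1))"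
    using C(1) by simp
qed

text \<open>The boundary identity is applied to \<open>\<phi> x * (s x \<bullet> b)\<close> for each
  \<open>b\<close>. The boundary integral vanishes because \<open>\<phi>\<close> is 0 on the
  frontier of \<open>\<Omega>\<close>, and what remains is integration by parts.\<close>

lemma smooth_is_weak_partial:
  fixes s :: "real^'n \<Rightarrow> 'b::euclidean_space"
  assumes s: "smooth s"
  shows "is_weak_partial \<Omega> i s (\<lambda>x. frechet_derivative s (at x) (axis i 1))"
  unfolding is_weak_partial_def
proof (intro allI impI)
  fix \<phi> assume t: "test_function \<Omega> \<phi>"
  let ?e = "axis i 1 :: real^'n"
  let ?M = "lebesgue_on \<Omega>"
  define d\<phi> where "d\<phi> x = frechet_derivative \<phi> (at x) ?e" for x
  define ds where "ds x = frechet_derivative s (at x) ?e" for x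
  have ph: "smooth \<phi>" using t by (simp add: test_function_def)
  have c: "continuous_on UNIV d\<phi>" "continuous_on UNIV ds" "continuous_on UNIV \<phi>" "continuous_on UNIV s"
    using smooth_frechet_derivative[OF ph] smooth_frechet_derivative[OF s] by (auto simp: d\<phi>_def[abs_def] ds_def[abs_def])
  have i: "integrable ?M (\<lambda>x. d\<phi> x *\<^sub>R s x)" "integrable ?M (\<lambda>x. \<phi> x *\<^sub>R ds x)"
    using c by (auto intro!: D.L2_integrable continuous_L2 continuous_on_scaleR)
  have "(\<integral>x. d\<phi> x *\<^sub>R s x + \<phi> x *\<^sub>R ds x \<partial>?M) = 0"
  proof (rule euclidean_eqI)
    fix b :: 'b
    let ?g = "\<lambda>x. \<phi> x * (s x \<bullet> b)"
    have d: "(?g has_derivative (\<lambda>h. \<phi> x * (frechet_derivative s (at x) h \<bullet> b) + frechet_derivative \<phi> (at x) h * (s x \<bullet> b))) (at x)" for x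
      by (intro has_derivative_mult has_derivative_inner_left smooth_frechet_derivative(1)[OF ph] smooth_frechet_derivative(1)[OF s])
    have fd: "frechet_derivative ?g (at x) ?e = (d\<phi> x *\<^sub>R s x + \<phi> x *\<^sub>R ds x) \<bullet> b" for x
      unfolding frechet_derivative_at[OF d, symmetric] by (simp add: d\<phi>_def ds_def inner_add_left)
    have cc: "continuous_on UNIV (\<lambda>x. (d\<phi> x *\<^sub>R s x + \<phi> x *\<^sub>R ds x) \<bullet> b)"
      using c by (intro continuous_intros)
    have "(\<integral>x. d\<phi> x *\<^sub>R s x + \<phi> x *\<^sub>R ds x \<partial>?M) \<bullet> b = (\<integral>x. (d\<phi> x *\<^sub>R s x + \<phi> x *\<^sub>R ds x) \<bullet> b \<partial>?M)"
      using i by (intro integral_inner_left[symmetric] Bochner_Integration.integrable_add) auto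
    also have "\<dots> = (\<integral>x. indicator \<Omega> x * frechet_derivative ?g (at x) ?e \<partial>lborel)"
      unfolding fd by (intro integral_domain borel_measurable_continuous_onI cc)
    also have "\<dots> = (\<integral>x. ?g x * (outward_normal \<Omega> x \<bullet> ?e) \<partial>surface_measure \<Omega>)"
      by (rule integral_partial_eq_boundary)
        (use d cc fd in \<open>auto simp: norm_axis_1 differentiable_on_def differentiable_def\<close>)
    also have "\<dots> = 0"
    proof (rule integral_eq_zero_AE)
      show "AE x in surface_measure \<Omega>. ?g x * (outward_normal \<Omega> x \<bullet> ?e) = 0"
        using AE_surface_measure
      proof eventually_elim
        case (elim x)
        then have "x \<in> frontier \<Omega>" by (auto simp: facet_def)
        then have "x \<notin> \<Omega>" using open_domain by (simp add: frontier_def interior_open)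
        moreover have "{x. \<phi> x \<noteq> 0} \<subseteq> \<Omega>"
          using t closure_subset[of "{x. \<phi> x \<noteq> 0}"] by (auto simp: test_function_def)
        ultimately have "\<phi> x = 0" by blast
        then show ?case by simp
      qed
    qed
    finally show "(\<integral>x. d\<phi> x *\<^sub>R s x + \<phi> x *\<^sub>R ds x \<partial>?M) \<bullet> b = 0 \<bullet> b" by simp
  qed
  then have "(\<integral>x. d\<phi> x *\<^sub>R s x \<partial>?M) + (\<integral>x. \<phi> x *\<^sub>R ds x \<partial>?M) = 0" using i by simp
  then show "(\<integral>x. frechet_derivative \<phi> (at x) ?e *\<^sub>R s x \<partial>?M) = - (\<integral>x. \<phi> x *\<^sub>R frechet_derivative s (at x) ?e \<partial>?M)"
    by (simp add: d\<phi>_def ds_def add_eq_0_iff2)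
qed

lemma smooth_H1:
  fixes s :: "real^'n \<Rightarrow> 'b::euclidean_space"
  assumes s: "smooth s"
  shows "s \<in> H1 \<Omega>" "AE x in lebesgue_on \<Omega>. wpartial \<Omega> i s x = frechet_derivative s (at x) (axis i 1)"
proof -
  have 1: "s \<in> L2 (lebesgue_on \<Omega>)" "(\<lambda>x. frechet_derivative s (at x) (axis i 1)) \<in> L2 (lebesgue_on \<Omega>)" for i
    using smooth_frechet_derivative[OF s] by (auto intro: continuous_L2)
  show "s \<in> H1 \<Omega>" using 1 smooth_is_weak_partial[OF s] unfolding H1_def by blast
  show "AE x in lebesgue_on \<Omega>. wpartial \<Omega> i s x = frechet_derivative s (at x) (axis i 1)"
    by (rule wpartial_eq[OF 1(2) smooth_is_weak_partial[OF s]])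
qed

text \<open>\<open>has_trace\<close> measures \<open>s k - v\<close> in the \<open>H1\<close> norm,
  for which \<open>wpartial\<close> makes a choice of its own. The second claim ties that choice to
  those made for the two functions separately.\<close>

lemma H1_diff:
  fixes v w :: "real^'n \<Rightarrow> 'b::euclidean_space"
  assumes v: "v \<in> H1 \<Omega>" and w: "w \<in> H1 \<Omega>"
  shows "(\<lambda>x. v x - w x) \<in> H1 \<Omega>"
    "AE x in lebesgue_on \<Omega>. wpartial \<Omega> i (\<lambda>x. v x - w x) x = wpartial \<Omega> i v x - wpartial \<Omega> i w x"
proof -
  have L: "v \<in> L2 (lebesgue_on \<Omega>)" "w \<in> L2 (lebesgue_on \<Omega>)" using v w by (auto simp: H1_def)
  have weak: "is_weak_partial \<Omega> i (\<lambda>x. v x - w x) (\<lambda>x. wpartial \<Omega> i v x - wpartial \<Omega> i w x)" for i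
    unfolding is_weak_partial_def
  proof (intro allI impI)
    fix \<phi> assume t: "test_function \<Omega> \<phi>"
    have ph: "smooth \<phi>" using t by (simp add: test_function_def)
    let ?d = "\<lambda>x. frechet_derivative \<phi> (at x) (axis i 1)"
    have dt: "?d \<in> borel_measurable (lebesgue_on \<Omega>)"
      by (intro borel_measurable_domain borel_measurable_continuous_onI smooth_frechet_derivative(2)[OF ph])
    obtain C where C: "\<And>x. x \<in> closure \<Omega> \<Longrightarrow> norm (?d x) \<le> C"
      using bounded_on_closure[OF smooth_frechet_derivative(2)[OF ph]] by blast
    have di: "integrable (lebesgue_on \<Omega>) (\<lambda>x. ?d x *\<^sub>R f x)" if f: "f \<in> L2 (lebesgue_on \<Omega>)" for f :: "real^'n \<Rightarrow> 'b"
    proof (rule integrable_bounded_scaleR[OF D.L2_integrable[OF f] dt])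
      show "AE x in lebesgue_on \<Omega>. \<bar>?d x\<bar> \<le> C"
      proof (rule AE_I2)
        fix x assume "x \<in> space (lebesgue_on \<Omega>)"
        then have "x \<in> closure \<Omega>" using subsetD[OF closure_subset, of x \<Omega>] by simp
        then show "\<bar>?d x\<bar> \<le> C" using C[of x] by simp
      qed
    qed
    have pi: "integrable (lebesgue_on \<Omega>) (\<lambda>x. \<phi> x *\<^sub>R wpartial \<Omega> i v x)" "integrable (lebesgue_on \<Omega>) (\<lambda>x. \<phi> x *\<^sub>R wpartial \<Omega> i w x)"
      using test_function_scaleR_integrable[OF open_domain D.L2_integrable[OF wpartial_props(1)] t] v w by auto
    have "(\<integral>x. ?d x *\<^sub>R (v x - w x) \<partial>lebesgue_on \<Omega>) = (\<integral>x. ?d x *\<^sub>R v x \<partial>lebesgue_on \<Omega>) - (\<integral>x. ?d x *\<^sub>R w x \<partial>lebesgue_on \<Omega>)"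
      using di L by (simp add: scaleR_diff_right)
    also have "\<dots> = - (\<integral>x. \<phi> x *\<^sub>R wpartial \<Omega> i v x \<partial>lebesgue_on \<Omega>) + (\<integral>x. \<phi> x *\<^sub>R wpartial \<Omega> i w x \<partial>lebesgue_on \<Omega>)"
      using wpartial_props(2)[OF v, of i, unfolded is_weak_partial_def, rule_format, OF t]
        wpartial_props(2)[OF w, of i, unfolded is_weak_partial_def, rule_format, OF t] by simp
    also have "\<dots> = - (\<integral>x. \<phi> x *\<^sub>R (wpartial \<Omega> i v x - wpartial \<Omega> i w x) \<partial>lebesgue_on \<Omega>)"
      using pi by (simp add: scaleR_diff_right)
    finally show "(\<integral>x. ?d x *\<^sub>R (v x - w x) \<partial>lebesgue_on \<Omega>) = - (\<integral>x. \<phi> x *\<^sub>R (wpartial \<Omega> i v x - wpartial \<Omega> i w x) \<partial>lebesgue_on \<Omega>)" .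
  qed
  have "(\<lambda>x. wpartial \<Omega> i v x - wpartial \<Omega> i w x) \<in> L2 (lebesgue_on \<Omega>)" for i
    by (intro L2_diff wpartial_props v w)
  note mem = this
  show "(\<lambda>x. v x - w x) \<in> H1 \<Omega>"
    unfolding H1_def using L2_diff[OF L] weak mem by blast
  show "AE x in lebesgue_on \<Omega>. wpartial \<Omega> i (\<lambda>x. v x - w x) x = wpartial \<Omega> i v x - wpartial \<Omega> i w x"
    by (rule wpartial_eq[OF mem weak])
qed

lemma L2_norm_le_H1_norm:
  "L2_norm (lebesgue_on \<Omega>) v \<le> H1_norm \<Omega> v"
  "L2_norm (lebesgue_on \<Omega>) (wpartial \<Omega> i v) \<le> H1_norm \<Omega> v"
proof -
  show "L2_norm (lebesgue_on \<Omega>) v \<le> H1_norm \<Omega> v"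
    unfolding H1_norm_def by (rule real_le_rsqrt) (simp add: sum_nonneg)
  have "(L2_norm (lebesgue_on \<Omega>) (wpartial \<Omega> i v))\<^sup>2 \<le> (\<Sum>i\<in>UNIV. (L2_norm (lebesgue_on \<Omega>) (wpartial \<Omega> i v))\<^sup>2)"
    by (rule member_le_sum) auto
  then show "L2_norm (lebesgue_on \<Omega>) (wpartial \<Omega> i v) \<le> H1_norm \<Omega> v"
    unfolding H1_norm_def by (intro real_le_rsqrt) (simp add: add_increasing)
qed

lemma H1_norm_nonneg: "H1_norm \<Omega> v \<ge> 0"
  using L2_norm_le_H1_norm(1)[of v] L2_norm_nonneg order_trans by blast

lemma wdiv_integral:
  fixes v :: "real^'n \<Rightarrow> real^'n"
  assumes "v \<in> H1 \<Omega>"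
  shows "(\<integral>x. wdiv \<Omega> v x \<partial>lebesgue_on \<Omega>) = (\<Sum>i\<in>UNIV. L2_inner (lebesgue_on \<Omega>) (wpartial \<Omega> i v) (\<lambda>_. axis i 1))"
proof -
  have "integrable (lebesgue_on \<Omega>) (\<lambda>x. wpartial \<Omega> i v x \<bullet> axis i 1)" for i
    by (intro L2_inner_Cauchy_Schwarz(1) wpartial_props(1) assms continuous_L2(1)) auto
  then show ?thesis
    unfolding wdiv_def L2_inner_def by (subst Bochner_Integration.integral_sum) (auto simp: inner_axis)
qed

lemma divergence_smooth:
  fixes s :: "real^'n \<Rightarrow> real^'n"
  assumes s: "smooth s"
  shows "(\<integral>x. wdiv \<Omega> s x \<partial>lebesgue_on \<Omega>) = (\<integral>x. s x \<bullet> outward_normal \<Omega> x \<partial>surface_measure \<Omega>)"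
proof -
  have "L2_inner (lebesgue_on \<Omega>) (wpartial \<Omega> i s) (\<lambda>_. axis i 1) = (\<integral>x. (s x \<bullet> axis i 1) * (outward_normal \<Omega> x \<bullet> axis i 1) \<partial>surface_measure \<Omega>)" for i
  proof -
    let ?e = "axis i 1 :: real^'n"
    have d: "((\<lambda>x. s x \<bullet> ?e) has_derivative (\<lambda>h. frechet_derivative s (at x) h \<bullet> ?e)) (at x)" for x
      by (intro has_derivative_inner_left smooth_frechet_derivative(1)[OF s])
    have fd: "frechet_derivative (\<lambda>x. s x \<bullet> ?e) (at x) ?e = frechet_derivative s (at x) ?e \<bullet> ?e" for x
      unfolding frechet_derivative_at[OF d, symmetric] ..
    have cc: "continuous_on UNIV (\<lambda>x. frechet_derivative s (at x) ?e \<bullet> ?e)"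
      by (intro continuous_intros smooth_frechet_derivative(2)[OF s])
    have "L2_inner (lebesgue_on \<Omega>) (wpartial \<Omega> i s) (\<lambda>_. ?e) = (\<integral>x. frechet_derivative s (at x) ?e \<bullet> ?e \<partial>lebesgue_on \<Omega>)"
      unfolding L2_inner_def
      by (rule integral_cong_AE_lebesgue_on) (use smooth_H1(2)[OF s, of i] in \<open>auto elim: AE_mp\<close>)
    also have "\<dots> = (\<integral>x. indicator \<Omega> x * frechet_derivative (\<lambda>x. s x \<bullet> ?e) (at x) ?e \<partial>lborel)"
      unfolding fd by (intro integral_domain borel_measurable_continuous_onI cc)
    also have "\<dots> = (\<integral>x. (s x \<bullet> ?e) * (outward_normal \<Omega> x \<bullet> ?e) \<partial>surface_measure \<Omega>)"
      by (rule integral_partial_eq_boundary)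
        (use d cc fd in \<open>auto simp: norm_axis_1 differentiable_on_def differentiable_def\<close>)
    finally show ?thesis .
  qed
  moreover have "integrable (surface_measure \<Omega>) (\<lambda>x. (s x \<bullet> axis i 1) * (outward_normal \<Omega> x \<bullet> axis i 1))" for i
  proof -
    have "(\<lambda>x. s x \<bullet> axis i 1) \<in> L2 (surface_measure \<Omega>)"
      by (intro continuous_L2 continuous_intros smooth_frechet_derivative(3)[OF s])
    moreover have "(\<lambda>x. outward_normal \<Omega> x \<bullet> axis i 1) \<in> L2 (surface_measure \<Omega>)"
    proof (rule S.L2_bounded[of _ 1])
      show "AE x in surface_measure \<Omega>. norm (outward_normal \<Omega> x \<bullet> axis i 1) \<le> 1"
        using AE_norm_outward_normal
      proof eventually_elim
        case (elim x)
        then show ?case using Cauchy_Schwarz_ineq2[of "outward_normal \<Omega> x" "axis i 1"] by (simp add: norm_axis_1)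
      qed
    qed measurable
    ultimately show ?thesis using L2_inner_Cauchy_Schwarz(1) by fastforce
  qed
  ultimately have "(\<Sum>i\<in>UNIV. L2_inner (lebesgue_on \<Omega>) (wpartial \<Omega> i s) (\<lambda>_. axis i 1)) =
      (\<integral>x. (\<Sum>i\<in>UNIV. (s x \<bullet> axis i 1) * (outward_normal \<Omega> x \<bullet> axis i 1)) \<partial>surface_measure \<Omega>)"
    by (subst Bochner_Integration.integral_sum) auto
  moreover have "(\<Sum>i\<in>UNIV. (s x \<bullet> axis i 1) * (outward_normal \<Omega> x \<bullet> axis i 1)) = s x \<bullet> outward_normal \<Omega> x" for x
  proof -
    have "(\<Sum>i\<in>UNIV. (s x \<bullet> axis i 1) * (outward_normal \<Omega> x \<bullet> axis i 1)) = (\<Sum>i\<in>UNIV. s x $ i * outward_normal \<Omega> x $ i)"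
      by (simp add: inner_axis)
    then show ?thesis by (simp add: inner_vec_def)
  qed
  ultimately show ?thesis
    unfolding wdiv_integral[OF smooth_H1(1)[OF s]] by simp
qed

lemma outward_normal_L2: "outward_normal \<Omega> \<in> L2 (surface_measure \<Omega>)"
  by (rule S.L2_bounded[of _ 1]) (use AE_norm_outward_normal in \<open>auto elim: AE_mp\<close>)

text \<open>Along the approximating sequence of \<open>has_trace\<close> the boundary integrals
  converge by the \<open>L2\<close> convergence on the boundary, the normal being in
  \<open>L2\<close> there, and the divergence integrals by the \<open>H1\<close> convergence. So the
  identity for smooth fields passes to the limit.\<close>

theorem trace_divergence:
  fixes v w :: "real^'n \<Rightarrow> real^'n"
  assumes "has_trace \<Omega> v w"
  shows "(\<integral>x. w x \<bullet> outward_normal \<Omega> x \<partial>surface_measure \<Omega>) = (\<integral>x. wdiv \<Omega> v x \<partial>lebesgue_on \<Omega>)"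
proof -
  let ?M = "lebesgue_on \<Omega>" and ?S = "surface_measure \<Omega>" and ?n = "outward_normal \<Omega>"
  obtain s where v: "v \<in> H1 \<Omega>" and w: "w \<in> L2 ?S" and s: "\<And>k. smooth (s k)"
    and lv: "(\<lambda>k. H1_norm \<Omega> (\<lambda>x. s k x - v x)) \<longlonglongrightarrow> 0"
    and lw: "(\<lambda>k. L2_norm ?S (\<lambda>x. s k x - w x)) \<longlonglongrightarrow> 0"
    using assms unfolding has_trace_def by blast
  have sS: "s k \<in> L2 ?S" for k by (intro continuous_L2 smooth_frechet_derivative(3)[OF s])
  have "(\<lambda>k. L2_inner ?S (s k) ?n) \<longlonglongrightarrow> L2_inner ?S w ?n"
  proof (rule Lim_null[THEN iffD2], rule Lim_null_comparison)
    show "\<forall>\<^sub>F k in sequentially. norm (L2_inner ?S (s k) ?n - L2_inner ?S w ?n) \<le> L2_norm ?S (\<lambda>x. s k x - w x) * L2_norm ?S ?n"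
    proof (intro always_eventually allI)
      fix k
      have "L2_inner ?S (s k) ?n - L2_inner ?S w ?n = L2_inner ?S (\<lambda>x. s k x - w x) ?n"
        using L2_inner_Cauchy_Schwarz(1)[OF sS outward_normal_L2] L2_inner_Cauchy_Schwarz(1)[OF w outward_normal_L2]
        by (simp add: L2_inner_def inner_diff_left)
      then show "norm (L2_inner ?S (s k) ?n - L2_inner ?S w ?n) \<le> L2_norm ?S (\<lambda>x. s k x - w x) * L2_norm ?S ?n"
        using L2_inner_Cauchy_Schwarz(2)[OF L2_diff[OF sS w] outward_normal_L2] by simp
    qed
    show "(\<lambda>k. L2_norm ?S (\<lambda>x. s k x - w x) * L2_norm ?S ?n) \<longlonglongrightarrow> 0"
      using tendsto_mult_right[OF lw] by simp
  qed
  moreover have "(\<lambda>k. (\<integral>x. wdiv \<Omega> (s k) x \<partial>?M)) \<longlonglongrightarrow> (\<integral>x. wdiv \<Omega> v x \<partial>?M)"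
    unfolding wdiv_integral[OF v] wdiv_integral[OF smooth_H1(1)[OF s]]
  proof (rule tendsto_sum)
    fix i
    let ?e = "\<lambda>_. axis i 1 :: real^'n"
    have e: "?e \<in> L2 ?M" by (intro continuous_L2) auto
    show "(\<lambda>k. L2_inner ?M (wpartial \<Omega> i (s k)) ?e) \<longlonglongrightarrow> L2_inner ?M (wpartial \<Omega> i v) ?e"
    proof (rule Lim_null[THEN iffD2], rule Lim_null_comparison)
      show "\<forall>\<^sub>F k in sequentially. norm (L2_inner ?M (wpartial \<Omega> i (s k)) ?e - L2_inner ?M (wpartial \<Omega> i v) ?e)
          \<le> H1_norm \<Omega> (\<lambda>x. s k x - v x) * L2_norm ?M ?e"
      proof (intro always_eventually allI)
        fix k
        note H = H1_diff[OF smooth_H1(1)[OF s[of k]] v]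
        have "L2_inner ?M (wpartial \<Omega> i (s k)) ?e - L2_inner ?M (wpartial \<Omega> i v) ?e
          = L2_inner ?M (\<lambda>x. wpartial \<Omega> i (s k) x - wpartial \<Omega> i v x) ?e"
          using L2_inner_Cauchy_Schwarz(1)[OF wpartial_props(1)[OF smooth_H1(1)[OF s]] e] L2_inner_Cauchy_Schwarz(1)[OF wpartial_props(1)[OF v] e]
          by (simp add: L2_inner_def inner_diff_left)
        also have "\<dots> = L2_inner ?M (wpartial \<Omega> i (\<lambda>x. s k x - v x)) ?e"
          unfolding L2_inner_def by (rule integral_cong_AE_lebesgue_on) (use H(2)[of i] in \<open>auto elim: AE_mp\<close>)
        finally have "norm (L2_inner ?M (wpartial \<Omega> i (s k)) ?e - L2_inner ?M (wpartial \<Omega> i v) ?e)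
          \<le> L2_norm ?M (wpartial \<Omega> i (\<lambda>x. s k x - v x)) * L2_norm ?M ?e"
          using L2_inner_Cauchy_Schwarz(2)[OF wpartial_props(1)[OF H(1)] e] by simp
        also have "\<dots> \<le> H1_norm \<Omega> (\<lambda>x. s k x - v x) * L2_norm ?M ?e"
          by (intro mult_right_mono L2_norm_le_H1_norm) auto
        finally show "norm (L2_inner ?M (wpartial \<Omega> i (s k)) ?e - L2_inner ?M (wpartial \<Omega> i v) ?e)
          \<le> H1_norm \<Omega> (\<lambda>x. s k x - v x) * L2_norm ?M ?e" .
      qed
      show "(\<lambda>k. H1_norm \<Omega> (\<lambda>x. s k x - v x) * L2_norm ?M ?e) \<longlonglongrightarrow> 0"
        using tendsto_mult_right[OF lv] by simp
    qed
  qed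
  ultimately show ?thesis
    unfolding divergence_smooth[OF s] L2_inner_def by (rule LIMSEQ_unique)
qed

end

section \<open>Weak time derivatives\<close>

text \<open>In the open interval the set where \<open>g\<close> is not 0 is open and negligible,
  hence empty; the endpoints follow by continuity.\<close>

lemma continuous_AE_zero_interval:
  fixes g :: "real \<Rightarrow> real"
  assumes T: "T > 0" and g: "continuous_on {0..T} g"
    and ae: "AE t in lebesgue_on {0<..<T}. g t = 0" and t: "t \<in> {0..T}"
  shows "g t = 0"
proof -
  define U where "U = {x \<in> {0<..<T}. g x \<noteq> 0}"
  have "continuous_on {0<..<T} g" using g by (rule continuous_on_subset) auto
  then have "open ({0<..<T} \<inter> g -` (- {0}))"
    by (rule continuous_open_preimage) (simp_all add: open_Compl)
  moreover have "{0<..<T} \<inter> g -` (- {0}) = U" by (auto simp: U_def)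
  ultimately have "open U" by simp
  have "AE x in lebesgue. x \<in> {0<..<T} \<longrightarrow> g x = 0"
    using ae AE_restrict_space_iff[of "{0<..<T}" lebesgue] by simp
  then have "AE x in lebesgue. x \<notin> U" by eventually_elim (simp add: U_def)
  then have "negligible U"
    using \<open>open U\<close> by (simp add: negligible_iff_null_sets AE_iff_null_sets)
  then have "U = {}" using \<open>open U\<close> open_not_negligible by blast
  then have 0: "g x = 0" if "x \<in> {0<..<T}" for x using that by (auto simp: U_def)
  have cl: "closure {0<..<T} = {0..T}" using T by simp
  show ?thesis
    by (rule continuous_constant_on_closure[of "{0<..<T}" g 0]) (use g t 0 cl in auto)
qed

lemma AE_lebesgue_on_open_interval:
  assumes "AE t in lebesgue_on {0..T}. P t"
  shows "AE t in lebesgue_on {0<..<T::real}. P t"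
proof -
  have "AE t in lebesgue. t \<in> {0..T} \<longrightarrow> P t"
    using assms AE_restrict_space_iff[of "{0..T}" lebesgue] by simp
  then have "AE t in lebesgue. t \<in> {0<..<T} \<longrightarrow> P t" by eventually_elim auto
  then show ?thesis using AE_restrict_space_iff[of "{0<..<T}" lebesgue] by simp
qed

lemma continuous_AE_le_interval:
  fixes g :: "real \<Rightarrow> real"
  assumes T: "T > 0" and g: "continuous_on {0..T} g"
    and ae: "AE t in lebesgue_on {0..T}. g t \<le> B" and t: "t \<in> {0..T}"
  shows "g t \<le> B"
proof -
  \<comment> \<open>The positive part of \<open>g t - B\<close> turns the inequality into the
    vanishing of a continuous function.\<close>
  have "max 0 (g t - B) = 0"
  proof (rule continuous_AE_zero_interval[OF T _ _ t])
    show "continuous_on {0..T} (\<lambda>t. max 0 (g t - B))" using g by (intro continuous_intros)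
    show "AE t in lebesgue_on {0<..<T}. max 0 (g t - B) = 0"
      using AE_lebesgue_on_open_interval[OF ae] by eventually_elim simp
  qed
  then show ?thesis by simp
qed

lemma test_function_outside: "test_function S \<phi> \<Longrightarrow> x \<notin> S \<Longrightarrow> \<phi> x = 0"
  using closure_subset[of "{x. \<phi> x \<noteq> 0}"] by (auto simp: test_function_def)

text \<open>Weak time derivatives are integrated over the closed interval, while
  \<open>fundamental_lemma\<close> works on an open set.\<close>

lemma integral_test_function_interval:
  fixes \<phi> f :: "real \<Rightarrow> real"
  assumes "test_function {0<..<T} \<phi>"
  shows "(\<integral>t. \<phi> t * f t \<partial>lebesgue_on {0<..<T}) = (\<integral>t. \<phi> t * f t \<partial>lebesgue_on {0..T})"
proof -
  have eq: "indicator {0<..<T} t *\<^sub>R (\<phi> t * f t) = indicator {0..T} t *\<^sub>R (\<phi> t * f t)" for t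
    using test_function_outside[OF assms, of t] by (cases "t \<in> {0<..<T}") (auto simp: indicator_def)
  have "(\<integral>t. \<phi> t * f t \<partial>lebesgue_on {0<..<T}) = (\<integral>t. indicator {0<..<T} t *\<^sub>R (\<phi> t * f t) \<partial>lebesgue)"
    by (rule integral_restrict_space) simp
  also have "\<dots> = (\<integral>t. indicator {0..T} t *\<^sub>R (\<phi> t * f t) \<partial>lebesgue)"
    by (simp only: eq)
  also have "\<dots> = (\<integral>t. \<phi> t * f t \<partial>lebesgue_on {0..T})"
    by (rule integral_restrict_space[symmetric]) simp
  finally show ?thesis .
qed

lemma test_function_interval_support:
  fixes \<phi> :: "real \<Rightarrow> real"
  assumes T: "T > 0" and "test_function {0<..<T} \<phi>"
  obtains a b where "0 < a" "a \<le> b" "b < T" "\<And>t. t \<notin> {a..b} \<Longrightarrow> \<phi> t = 0"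
proof -
  let ?K = "closure {x. \<phi> x \<noteq> 0}"
  have K: "compact ?K" "?K \<subseteq> {0<..<T}" using assms by (auto simp: test_function_def)
  show thesis
  proof (cases "?K = {}")
    case True
    then have "\<phi> t = 0" for t by auto
    then show thesis using that[of "T / 2" "T / 2"] T by auto
  next
    case False
    obtain a where a: "a \<in> ?K" "\<And>t. t \<in> ?K \<Longrightarrow> a \<le> t" using compact_attains_inf[OF K(1) False] by blast
    obtain b where b: "b \<in> ?K" "\<And>t. t \<in> ?K \<Longrightarrow> t \<le> b" using compact_attains_sup[OF K(1) False] by blast
    have "\<phi> t = 0" if "t \<notin> {a..b}" for t
    proof (rule ccontr)
      assume "\<phi> t \<noteq> 0"
      then have "t \<in> ?K" by (intro subsetD[OF closure_subset]) simp
      then show False using a b that by auto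
    qed
    moreover have "0 < a" "a \<le> b" "b < T" using a b K(2) by auto
    ultimately show thesis using that by blast
  qed
qed

text \<open>The primitive that starts at 0 vanishes before the support of \<open>\<rho>\<close>, and
  after it because the total integral is 0. So it has compact support in the open interval.\<close>

lemma test_function_primitive:
  fixes \<rho> :: "real \<Rightarrow> real"
  assumes T: "T > 0" and r: "test_function {0<..<T} \<rho>" and 0: "(\<integral>t. \<rho> t \<partial>lebesgue_on {0..T}) = 0"
  obtains \<zeta> where "test_function {0<..<T} \<zeta>" "\<And>t. (\<zeta> has_real_derivative \<rho> t) (at t)"
proof -
  obtain a b where ab: "0 < a" "a \<le> b" "b < T" "\<And>t. t \<notin> {a..b} \<Longrightarrow> \<rho> t = 0"
    using test_function_interval_support[OF T r] by metis
  have c: "continuous_on UNIV \<rho>" by (rule test_function_continuous[OF r])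
  have ci: "continuous_on A \<rho>" for A by (rule continuous_on_subset[OF c]) simp
  define \<zeta> where "\<zeta> t = integral {0..t} \<rho>" for t
  have z0: "\<zeta> t = 0" if "t < a" for t
    unfolding \<zeta>_def by (rule integral_unique, rule has_integral_is_0) (use ab that in auto)
  have zT: "\<zeta> T = 0"
  proof -
    have "integrable (lebesgue_on {0..T}) \<rho>" by (rule continuous_imp_integrable_real[OF ci])
    then have "(\<rho> has_integral 0) {0..T}" using has_integral_integral_lebesgue_on[of "{0..T}" \<rho>] 0 by simp
    then show ?thesis unfolding \<zeta>_def by (rule integral_unique)
  qed
  have z1: "\<zeta> t = 0" if "t > b" for t
  proof (cases "t \<le> T")
    case True
    have "integral {0..t} \<rho> + integral {t..T} \<rho> = integral {0..T} \<rho>"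
      using True that ab by (intro Henstock_Kurzweil_Integration.integral_combine integrable_continuous_real ci) auto
    moreover have "integral {t..T} \<rho> = 0"
      by (rule integral_unique, rule has_integral_is_0) (use ab that in auto)
    ultimately show ?thesis using zT by (simp add: \<zeta>_def)
  next
    case False
    have "integral {0..T} \<rho> + integral {T..t} \<rho> = integral {0..t} \<rho>"
      using False T by (intro Henstock_Kurzweil_Integration.integral_combine integrable_continuous_real ci) auto
    moreover have "integral {T..t} \<rho> = 0"
      by (rule integral_unique, rule has_integral_is_0) (use ab that in auto)
    ultimately show ?thesis using zT by (simp add: \<zeta>_def)
  qed
  \<comment> \<open>Below \<open>a\<close>, including negative times where the integral is over an
    empty interval, \<open>\<zeta>\<close> is locally 0. Any other \<open>t\<close> is interior to
    \<open>{0..t + 1}\<close>, where the fundamental theorem of calculus applies.\<close>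
  have der: "(\<zeta> has_real_derivative \<rho> t) (at t)" for t
  proof (cases "t < a")
    case True
    have "((\<lambda>t. 0) has_real_derivative \<rho> t) (at t)" using ab(4)[of t] True by simp
    then show ?thesis
      by (rule has_field_derivative_transform_within_open[of _ _ _ "{..<a}"]) (use True z0 in auto)
  next
    case False
    then have t: "0 < t" using ab by simp
    have "(\<zeta> has_real_derivative \<rho> t) (at t within {0..t + 1})"
      unfolding \<zeta>_def[abs_def] by (rule integral_has_real_derivative[OF ci]) (use t in auto)
    then have "(\<zeta> has_real_derivative \<rho> t) (at t within {0<..<t + 1})"
      by (rule DERIV_subset) auto
    then show ?thesis using t at_within_open[of t "{0<..<t + 1}"] by simp
  qed
  have "test_function {0<..<T} \<zeta>"
  proof (rule test_functionI[where K = "{a..b}"])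
    have rs: "Ck k \<rho>" for k using r by (simp add: test_function_def smooth_def)
    have "Ck (Suc k) \<zeta>" for k
      by (rule Ck_SucI[OF der[unfolded has_field_derivative_def]]) (auto intro!: Ck_mult rs Ck_const)
    then show "smooth \<zeta>" unfolding smooth_def using Ck_SucD by blast
    show "\<zeta> x = 0" if "x \<notin> {a..b}" for x using that z0[of x] z1[of x] by force
  qed (use ab in auto)
  then show thesis using der by (rule that)
qed

lemma smooth_diff_scaled:
  fixes f g :: "'a::euclidean_space \<Rightarrow> real"
  assumes "smooth f" "smooth g"
  shows "smooth (\<lambda>x. f x - c * g x)"
proof -
  have "Ck k (\<lambda>x. f x + (- c) * g x)" for k
    using assms unfolding smooth_def by (intro Ck_add Ck_mult Ck_const) auto
  then show ?thesis unfolding smooth_def by simp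
qed

text \<open>Du Bois-Reymond: test functions with mean zero are exactly the derivatives of test functions.\<close>

lemma weak_derivative_zero_imp_constant:
  fixes c :: "real \<Rightarrow> real"
  assumes T: "T > 0" and c: "continuous_on {0..T} c"
    and w: "\<And>\<zeta>. test_function {0<..<T} \<zeta> \<Longrightarrow> (\<integral>t. deriv \<zeta> t * c t \<partial>lebesgue_on {0..T}) = 0"
    and t: "t \<in> {0..T}"
  shows "c t = c 0"
proof -
  let ?I = "lebesgue_on {0..T}"
  have ti: "integrable ?I (\<lambda>t. \<phi> t * f t)" if "test_function {0<..<T} \<phi>" "continuous_on {0..T} f" for \<phi> f :: "real \<Rightarrow> real"
    using that continuous_on_subset[OF test_function_continuous[OF that(1)], of "{0..T}"]
    by (intro continuous_imp_integrable_real continuous_on_mult) auto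
  \<comment> \<open>If all test functions had integral 0, the fundamental lemma would make the
    constant 1 vanish.\<close>
  have "\<exists>\<phi>0. test_function {0<..<T} \<phi>0 \<and> (\<integral>t. \<phi>0 t \<partial>?I) \<noteq> 0"
  proof (rule ccontr)
    assume no: "\<not> ?thesis"
    have all: "(\<integral>t. \<phi> t * 1 \<partial>lebesgue_on {0<..<T}) = 0" if p: "test_function {0<..<T} \<phi>" for \<phi>
    proof -
      have "(\<integral>t. \<phi> t \<partial>?I) = 0" using no p by blast
      then show ?thesis using integral_test_function_interval[OF p, of "\<lambda>_. 1"] by simp
    qed
    have "integrable (lebesgue_on {0<..<T}) (\<lambda>t. 1::real)"
      by (subst integrable_restrict_space) (use T in \<open>auto intro!: integrable_real_indicator\<close>)
    then have "AE t in lebesgue_on {0<..<T}. (1::real) = 0"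
      by (rule fundamental_lemma[OF open_greaterThanLessThan _ all])
    then have "(1::real) = 0"
      using continuous_AE_zero_interval[OF T, of "\<lambda>_. 1" 0] T by simp
    then show False by simp
  qed
  then obtain \<phi>0 where p0: "test_function {0<..<T} \<phi>0" and m0: "(\<integral>t. \<phi>0 t \<partial>?I) \<noteq> 0" by blast
  define m where "m = (\<integral>t. \<phi>0 t * c t \<partial>?I) / (\<integral>t. \<phi>0 t \<partial>?I)"
  have "AE t in lebesgue_on {0<..<T}. c t - m = 0"
  proof (rule fundamental_lemma[OF open_greaterThanLessThan])
    have "integrable ?I (\<lambda>t. c t - m)" using c by (intro continuous_imp_integrable_real continuous_intros)
    then have "integrable lebesgue (\<lambda>t. indicator {0..T} t *\<^sub>R (c t - m))"
      by (subst (asm) integrable_restrict_space) auto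
    then have "integrable lebesgue (\<lambda>t. indicator {0<..<T} t *\<^sub>R indicator {0..T} t *\<^sub>R (c t - m))"
      by (rule integrable_mult_indicator[rotated]) simp
    moreover have eq: "indicator {0<..<T} t *\<^sub>R indicator {0..T} t *\<^sub>R (c t - m) = indicator {0<..<T} t *\<^sub>R (c t - m)" for t
      by (simp add: indicator_def)
    ultimately have "integrable lebesgue (\<lambda>t. indicator {0<..<T} t *\<^sub>R (c t - m))" by (simp only: eq)
    then show "integrable (lebesgue_on {0<..<T}) (\<lambda>t. c t - m)"
      by (subst integrable_restrict_space) simp_all
    fix \<phi> assume p: "test_function {0<..<T} \<phi>"
    \<comment> \<open>This multiple of \<open>\<phi>0\<close> makes the integral of
      \<open>\<rho>\<close> zero, so that \<open>\<rho>\<close> is the derivative of a test function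
      and integrates to 0 against \<open>c\<close>. Solving for the integral of
      \<open>\<phi> t * c t\<close> leaves \<open>m\<close> times the integral of
      \<open>\<phi>\<close>.\<close>
    define A where "A = (\<integral>t. \<phi> t \<partial>?I) / (\<integral>t. \<phi>0 t \<partial>?I)"
    define \<rho> where "\<rho> t = \<phi> t - A * \<phi>0 t" for t
    obtain a b where ab: "0 < a" "a \<le> b" "b < T" "\<And>t. t \<notin> {a..b} \<Longrightarrow> \<phi> t = 0"
      using test_function_interval_support[OF T p] by metis
    obtain a0 b0 where ab0: "0 < a0" "a0 \<le> b0" "b0 < T" "\<And>t. t \<notin> {a0..b0} \<Longrightarrow> \<phi>0 t = 0"
      using test_function_interval_support[OF T p0] by metis
    have r: "test_function {0<..<T} \<rho>"
    proof (rule test_functionI[where K = "{a..b} \<union> {a0..b0}"])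
      show "smooth \<rho>" unfolding \<rho>_def[abs_def] using p p0 by (intro smooth_diff_scaled) (auto simp: test_function_def)
      show "\<rho> x = 0" if "x \<notin> {a..b} \<union> {a0..b0}" for x using that ab(4)[of x] ab0(4)[of x] by (simp add: \<rho>_def)
    qed (use ab ab0 in auto)
    have i: "integrable ?I \<phi>" "integrable ?I \<phi>0" using ti[OF p, of "\<lambda>_. 1"] ti[OF p0, of "\<lambda>_. 1"] by auto
    have "(\<integral>t. \<rho> t \<partial>?I) = (\<integral>t. \<phi> t \<partial>?I) - A * (\<integral>t. \<phi>0 t \<partial>?I)"
      unfolding \<rho>_def using i by simp
    then have "(\<integral>t. \<rho> t \<partial>?I) = 0" using m0 by (simp add: A_def)
    then obtain \<zeta> where z: "test_function {0<..<T} \<zeta>" "\<And>t. (\<zeta> has_real_derivative \<rho> t) (at t)"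
      using test_function_primitive[OF T r] by metis
    have "0 = (\<integral>t. \<rho> t * c t \<partial>?I)" using w[OF z(1)] DERIV_imp_deriv[OF z(2)] by simp
    also have "\<dots> = (\<integral>t. \<phi> t * c t - A * (\<phi>0 t * c t) \<partial>?I)"
      by (simp add: \<rho>_def algebra_simps)
    also have "\<dots> = (\<integral>t. \<phi> t * c t \<partial>?I) - A * (\<integral>t. \<phi>0 t * c t \<partial>?I)"
      using ti[OF p c] ti[OF p0 c] by simp
    also have "A * (\<integral>t. \<phi>0 t * c t \<partial>?I) = m * (\<integral>t. \<phi> t \<partial>?I)" by (simp add: A_def m_def)
    also have "(\<integral>t. \<phi> t * c t \<partial>?I) - m * (\<integral>t. \<phi> t \<partial>?I) = (\<integral>t. \<phi> t * (c t - m) \<partial>?I)"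
      using ti[OF p c] i by (simp add: algebra_simps)
    finally show "(\<integral>t. \<phi> t * (c t - m) \<partial>lebesgue_on {0<..<T}) = 0"
      unfolding integral_test_function_interval[OF p] by simp
  qed
  note ae = this
  have "continuous_on {0..T} (\<lambda>t. c t - m)" using c by (intro continuous_intros)
  note z = continuous_AE_zero_interval[OF T this ae]
  have "c t - m = 0" using t by (rule z)
  moreover have "c 0 - m = 0" using T by (intro z) simp
  ultimately show ?thesis by simp
qed

lemma weak_derivative_constant_imp_affine:
  fixes h :: "real \<Rightarrow> real"
  assumes T: "T > 0" and h: "continuous_on {0..T} h"
    and w: "\<And>\<zeta>. test_function {0<..<T} \<zeta> \<Longrightarrow> (\<integral>t. deriv \<zeta> t * h t \<partial>lebesgue_on {0..T}) = - (\<integral>t. \<zeta> t * D \<partial>lebesgue_on {0..T})"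
    and t: "t \<in> {0..T}"
  shows "h t = h 0 + D * t"
proof -
  let ?I = "lebesgue_on {0..T}"
  have "h t - D * t = h 0 - D * 0"
  proof (rule weak_derivative_zero_imp_constant[OF T _ _ t])
    show "continuous_on {0..T} (\<lambda>t. h t - D * t)" using h by (intro continuous_intros)
    fix \<zeta> assume z: "test_function {0<..<T} \<zeta>"
    have s: "Ck (Suc 0) \<zeta>" using z by (simp only: test_function_def smooth_def)
    have d: "(\<zeta> has_real_derivative deriv \<zeta> t) (at t)" for t
      using s by (simp add: differentiable_on_def DERIV_deriv_iff_real_differentiable)
    have "deriv \<zeta> t = frechet_derivative \<zeta> (at t) 1" for t
      using frechet_derivative_at[OF d[unfolded has_field_derivative_def], symmetric] by simp
    then have dc: "continuous_on UNIV (deriv \<zeta>)" using s by simp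
    have c: "continuous_on {0..T} (deriv \<zeta>)" "continuous_on {0..T} \<zeta>"
      using continuous_on_subset[OF dc] continuous_on_subset[OF test_function_continuous[OF z]] by auto
    have i: "integrable ?I (\<lambda>t. deriv \<zeta> t * h t)" "integrable ?I (\<lambda>t. deriv \<zeta> t * t)" "integrable ?I \<zeta>"
      using c h by (auto intro!: continuous_imp_integrable_real continuous_intros)
    \<comment> \<open>The product \<open>\<zeta> t * t\<close> vanishes at both ends: at 0 through
      the factor \<open>t\<close>, at \<open>T\<close> through \<open>\<zeta>\<close>. This is the
      integration by parts that the subtraction of \<open>D * t\<close> calls for.\<close>
    have "((\<lambda>t. deriv \<zeta> t * t + \<zeta> t) has_integral (\<zeta> T * T - \<zeta> 0 * 0)) {0..T}"
    proof (rule fundamental_theorem_of_calculus)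
      fix x
      have "((\<lambda>t. \<zeta> t * t) has_real_derivative deriv \<zeta> x * x + \<zeta> x) (at x within {0..T})"
        using has_field_derivative_at_within[OF d[of x], of "{0..T}"] by (auto intro!: derivative_eq_intros)
      then show "((\<lambda>t. \<zeta> t * t) has_vector_derivative deriv \<zeta> x * x + \<zeta> x) (at x within {0..T})"
        by (simp add: has_real_derivative_iff_has_vector_derivative)
    qed (use T in simp)
    moreover have "\<zeta> T = 0" using test_function_outside[OF z, of T] by simp
    ultimately have "((\<lambda>t. deriv \<zeta> t * t + \<zeta> t) has_integral 0) {0..T}" by simp
    moreover have "((\<lambda>t. deriv \<zeta> t * t + \<zeta> t) has_integral (\<integral>t. deriv \<zeta> t * t + \<zeta> t \<partial>?I)) {0..T}"
      using i by (intro has_integral_integral_lebesgue_on) auto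
    ultimately have "(\<integral>t. deriv \<zeta> t * t + \<zeta> t \<partial>?I) = 0" using has_integral_unique by blast
    then have ibp: "(\<integral>t. deriv \<zeta> t * t \<partial>?I) = - (\<integral>t. \<zeta> t \<partial>?I)" using i by simp
    have "(\<integral>t. deriv \<zeta> t * (h t - D * t) \<partial>?I) = (\<integral>t. deriv \<zeta> t * h t - D * (deriv \<zeta> t * t) \<partial>?I)"
      by (simp add: algebra_simps)
    also have "\<dots> = (\<integral>t. deriv \<zeta> t * h t \<partial>?I) - D * (\<integral>t. deriv \<zeta> t * t \<partial>?I)"
      using i by simp
    finally show "(\<integral>t. deriv \<zeta> t * (h t - D * t) \<partial>?I) = 0"
      unfolding ibp w[OF z] by simp
  qed
  then show ?thesis by simp
qed

section \<open>Mean values\<close>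

lemma smooth_const: "smooth (\<lambda>x. c)"
  by (simp add: smooth_def Ck_const)

lemma smooth_ident: "smooth (\<lambda>x. x)"
  by (simp add: smooth_def Ck_bounded_linear bounded_linear_ident)

context polygonal_arrangement
begin

lemma L2_norm_cong_AE:
  assumes "AE x in lebesgue_on \<Omega>. norm (f x) = norm (g x)"
  shows "L2_norm (lebesgue_on \<Omega>) f = L2_norm (lebesgue_on \<Omega>) g"
proof -
  have "(\<integral>x. (norm (f x))\<^sup>2 \<partial>lebesgue_on \<Omega>) = (\<integral>x. (norm (g x))\<^sup>2 \<partial>lebesgue_on \<Omega>)"
    by (rule integral_cong_AE_lebesgue_on[OF domain_lebesgue(1)]) (use assms in \<open>eventually_elim, simp\<close>)
  then show ?thesis by (simp add: L2_norm_def)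
qed

lemma wpartial_const: "AE x in lebesgue_on \<Omega>. wpartial \<Omega> i (\<lambda>_. c) x = 0"
  using smooth_H1(2)[OF smooth_const[of c], of i] by (simp add: frechet_derivative_const)

lemma wpartial_ident: "AE x in lebesgue_on \<Omega>. wpartial \<Omega> i (\<lambda>x. x) x = axis i 1"
proof -
  have "frechet_derivative (\<lambda>x. x) (at x) = (\<lambda>h. h)" for x :: "real^'n"
    by (rule frechet_derivative_at[OF has_derivative_ident, symmetric])
  then show ?thesis using smooth_H1(2)[OF smooth_ident, of i] by simp
qed

lemma H1_norm_scaleR:
  fixes s :: "real^'n \<Rightarrow> real"
  assumes s: "smooth s"
  shows "H1_norm \<Omega> (\<lambda>x. c * s x) = \<bar>c\<bar> * H1_norm \<Omega> s"
proof -
  have cs: "smooth (\<lambda>x. c * s x)"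
    using s unfolding smooth_def by (auto intro!: Ck_mult Ck_const)
  have sc: "L2_norm (lebesgue_on \<Omega>) (\<lambda>x. c * f x) = \<bar>c\<bar> * L2_norm (lebesgue_on \<Omega>) f" for f :: "real^'n \<Rightarrow> real"
    by (simp add: L2_norm_def power_mult_distrib real_sqrt_mult)
  have "L2_norm (lebesgue_on \<Omega>) (wpartial \<Omega> i (\<lambda>x. c * s x)) = \<bar>c\<bar> * L2_norm (lebesgue_on \<Omega>) (wpartial \<Omega> i s)" for i
  proof -
    have d: "((\<lambda>x. c * s x) has_derivative (\<lambda>h. c * frechet_derivative s (at x) h)) (at x)" for x
      by (intro has_derivative_mult_right smooth_frechet_derivative(1)[OF s])
    have fd: "frechet_derivative (\<lambda>x. c * s x) (at x) (axis i 1) = c * frechet_derivative s (at x) (axis i 1)" for x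
      unfolding frechet_derivative_at[OF d, symmetric] ..
    have "AE x in lebesgue_on \<Omega>. norm (wpartial \<Omega> i (\<lambda>x. c * s x) x) = norm (c * wpartial \<Omega> i s x)"
      using smooth_H1(2)[OF cs, of i] smooth_H1(2)[OF s, of i] by eventually_elim (simp add: fd)
    from L2_norm_cong_AE[OF this] show ?thesis by (simp only: sc)
  qed
  then have "H1_norm \<Omega> (\<lambda>x. c * s x) = sqrt (c\<^sup>2 * ((L2_norm (lebesgue_on \<Omega>) s)\<^sup>2 + (\<Sum>i\<in>UNIV. (L2_norm (lebesgue_on \<Omega>) (wpartial \<Omega> i s))\<^sup>2)))"
    by (simp add: H1_norm_def sc power_mult_distrib sum_distrib_left distrib_left)
  then show ?thesis by (simp add: H1_norm_def real_sqrt_mult)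
qed

text \<open>The partial derivatives of the zero function are chosen representatives too, and they
  are known to vanish only almost everywhere.\<close>

lemma H1_norm_zero: "H1_norm \<Omega> (\<lambda>x. 0 :: 'b::euclidean_space) = 0"
proof -
  have "L2_norm (lebesgue_on \<Omega>) (wpartial \<Omega> i (\<lambda>x. 0 :: 'b)) = L2_norm (lebesgue_on \<Omega>) (\<lambda>x. 0 :: 'b)" for i
    by (rule L2_norm_cong_AE) (use wpartial_const[of i "0::'b"] in \<open>eventually_elim, simp\<close>)
  then show ?thesis by (simp add: H1_norm_def L2_norm_def)
qed

lemma smooth_has_trace:
  assumes s: "smooth s" shows "has_trace \<Omega> s s"
  unfolding has_trace_def
  using s smooth_H1(1)[OF s] continuous_L2(2)[OF smooth_frechet_derivative(3)[OF s]]
  by (auto simp: L2_norm_def H1_norm_zero intro!: exI[of _ "\<lambda>_. s"])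

lemma test_function_H10: "test_function \<Omega> \<psi> \<Longrightarrow> \<psi> \<in> H10 \<Omega>"
  unfolding H10_def using smooth_H1(1)[of \<psi>]
  by (auto simp: test_function_def H1_norm_zero intro!: exI[of _ "\<lambda>_. \<psi>"])

lemma H10_L2: "v \<in> H10 \<Omega> \<Longrightarrow> v \<in> L2 (lebesgue_on \<Omega>)"
  by (simp add: H10_def H1_def)

text \<open>Continuity in time is given in \<open>dual_norm\<close>; this turns it into continuity
  of the pairing with one fixed test function.\<close>

lemma dual_norm_bound:
  assumes a: "a \<in> L2 (lebesgue_on \<Omega>)" and b: "b \<in> L2 (lebesgue_on \<Omega>)" and t: "test_function \<Omega> \<psi>"
  shows "\<bar>L2_inner (lebesgue_on \<Omega>) a \<psi> - L2_inner (lebesgue_on \<Omega>) b \<psi>\<bar> \<le>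
    dual_norm (H10 \<Omega>) (H1_norm \<Omega>) (\<lambda>\<psi>. L2_inner (lebesgue_on \<Omega>) a \<psi> - L2_inner (lebesgue_on \<Omega>) b \<psi>) * (H1_norm \<Omega> \<psi> + 1)"
proof -
  let ?M = "lebesgue_on \<Omega>"
  let ?F = "\<lambda>\<psi>. L2_inner ?M a \<psi> - L2_inner ?M b \<psi>"
  \<comment> \<open>The 1 avoids a division by 0 when the norm vanishes and still brings the scaled
    function into the unit ball.\<close>
  define c where "c = inverse (H1_norm \<Omega> \<psi> + 1)"
  have n: "H1_norm \<Omega> \<psi> + 1 > 0" using H1_norm_nonneg[of \<psi>] by simp
  then have c: "c > 0" by (simp add: c_def)
  have s: "smooth \<psi>" using t by (simp add: test_function_def)
  have ct: "test_function \<Omega> (\<lambda>x. c * \<psi> x)"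
  proof (rule test_functionI[where K = "closure {x. \<psi> x \<noteq> 0}"])
    show "smooth (\<lambda>x. c * \<psi> x)" using s unfolding smooth_def by (auto intro!: Ck_mult Ck_const)
    show "c * \<psi> x = 0" if "x \<notin> closure {x. \<psi> x \<noteq> 0}" for x
      using that subsetD[OF closure_subset, of x "{x. \<psi> x \<noteq> 0}"] by auto
  qed (use t in \<open>auto simp: test_function_def\<close>)
  have "H1_norm \<Omega> (\<lambda>x. c * \<psi> x) \<le> 1"
    unfolding H1_norm_scaleR[OF s] using c n by (simp add: c_def field_simps)
  then have mem: "(\<lambda>x. c * \<psi> x) \<in> {v \<in> H10 \<Omega>. H1_norm \<Omega> v \<le> 1}"
    using test_function_H10[OF ct] by simp
  \<comment> \<open>A real supremum bounds its set only if the set is bounded above; here the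
    \<open>H1\<close> norm dominates the \<open>L2\<close> norm, and Cauchy-Schwarz applies.\<close>
  have "bdd_above ((\<lambda>v. \<bar>?F v\<bar>) ` {v \<in> H10 \<Omega>. H1_norm \<Omega> v \<le> 1})"
  proof (rule bdd_aboveI2)
    fix v assume v: "v \<in> {v \<in> H10 \<Omega>. H1_norm \<Omega> v \<le> 1}"
    then have "v \<in> L2 ?M" "L2_norm ?M v \<le> 1"
      using H10_L2 L2_norm_le_H1_norm(1)[of v] by auto
    then have "\<bar>L2_inner ?M a v\<bar> \<le> L2_norm ?M a * 1" "\<bar>L2_inner ?M b v\<bar> \<le> L2_norm ?M b * 1"
      using L2_inner_Cauchy_Schwarz(2)[OF a] L2_inner_Cauchy_Schwarz(2)[OF b]
      by (meson L2_norm_nonneg mult_left_mono order_trans)+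
    then show "\<bar>?F v\<bar> \<le> L2_norm ?M a + L2_norm ?M b" by linarith
  qed
  then have "\<bar>?F (\<lambda>x. c * \<psi> x)\<bar> \<le> dual_norm (H10 \<Omega>) (H1_norm \<Omega>) ?F"
    unfolding dual_norm_def using mem by (intro cSUP_upper) auto
  moreover have "?F (\<lambda>x. c * \<psi> x) = c * ?F \<psi>"
    by (simp add: L2_inner_def mult.left_commute right_diff_distrib)
  ultimately have "c * \<bar>?F \<psi>\<bar> \<le> dual_norm (H10 \<Omega>) (H1_norm \<Omega>) ?F"
    using c by (simp add: abs_mult)
  then show ?thesis using n by (simp add: c_def field_simps)
qed

lemma L2_inner_diff_right:
  assumes "a \<in> L2 M" "v \<in> L2 M" "w \<in> L2 M"
  shows "L2_inner M a (\<lambda>x. v x - w x) = L2_inner M a v - L2_inner M a w"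
  using L2_inner_Cauchy_Schwarz(1)[OF assms(1,2)] L2_inner_Cauchy_Schwarz(1)[OF assms(1,3)]
  by (simp add: L2_inner_def inner_diff_right)

text \<open>The constant 1 is not in \<open>H10\<close>. It is an \<open>L2\<close> limit of test functions, and the mean values
  are a uniform limit of pairings with test functions because \<open>\<eta>\<close> is bounded in \<open>L2\<close>.\<close>

lemma mean_continuous:
  fixes \<eta> :: "real \<Rightarrow> real^'n \<Rightarrow> real"
  assumes T: "T > 0"
    and eta: "\<And>t. t \<in> {0..T} \<Longrightarrow> \<eta> t \<in> L2 (lebesgue_on \<Omega>)"
    and bd: "AE t in lebesgue_on {0..T}. L2_norm (lebesgue_on \<Omega>) (\<eta> t) \<le> C"
    and cont: "\<And>t. t \<in> {0..T} \<Longrightarrow>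
      ((\<lambda>s. dual_norm (H10 \<Omega>) (H1_norm \<Omega>) (\<lambda>\<psi>. L2_inner (lebesgue_on \<Omega>) (\<eta> s) \<psi> - L2_inner (lebesgue_on \<Omega>) (\<eta> t) \<psi>))
        \<longlongrightarrow> 0) (at t within {0..T})"
  shows "continuous_on {0..T} (\<lambda>t. L2_inner (lebesgue_on \<Omega>) (\<eta> t) (\<lambda>_. 1))"
proof -
  let ?M = "lebesgue_on \<Omega>"
  obtain \<psi> :: "nat \<Rightarrow> real^'n \<Rightarrow> real" where p: "\<And>k. test_function \<Omega> (\<psi> k)"
    "\<And>k x. 0 \<le> \<psi> k x" "\<And>k x. \<psi> k x \<le> 1" "\<And>x. x \<in> \<Omega> \<Longrightarrow> (\<lambda>k. \<psi> k x) \<longlonglongrightarrow> 1"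
    using exhausting_test_functions[OF open_domain] by metis
  have one: "(\<lambda>_. 1::real) \<in> L2 ?M" by (intro continuous_L2) auto
  have pL: "\<psi> k \<in> L2 ?M" for k by (intro H10_L2 test_function_H10 p)
  define \<delta> where "\<delta> k = L2_norm ?M (\<lambda>x. \<psi> k x - 1)" for k
  have d0: "\<delta> \<longlonglongrightarrow> 0"
  proof -
    have "(\<lambda>k. \<integral>x. (norm (\<psi> k x - 1))\<^sup>2 \<partial>?M) \<longlonglongrightarrow> (\<integral>x. 0 \<partial>?M)"
    proof (rule integral_dominated_convergence[where w = "\<lambda>_. 1"])
      show "(\<lambda>x. (norm (\<psi> k x - 1))\<^sup>2) \<in> borel_measurable ?M" for k
        using pL[of k] by (auto simp: L2_def)
      show "AE x in ?M. (\<lambda>k. (norm (\<psi> k x - 1))\<^sup>2) \<longlonglongrightarrow> 0"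
      proof (rule AE_I2)
        fix x assume "x \<in> space ?M"
        then have "(\<lambda>k. \<psi> k x) \<longlonglongrightarrow> 1" using p(4) by simp
        then have "(\<lambda>k. (norm (\<psi> k x - 1))\<^sup>2) \<longlonglongrightarrow> (norm (1 - 1 :: real))\<^sup>2" by (intro tendsto_intros)
        then show "(\<lambda>k. (norm (\<psi> k x - 1))\<^sup>2) \<longlonglongrightarrow> 0" by simp
      qed
      show "AE x in ?M. norm ((norm (\<psi> k x - 1))\<^sup>2) \<le> 1" for k
      proof (rule AE_I2)
        fix x
        have "\<bar>\<psi> k x - 1\<bar> \<le> 1" using p(2,3)[of k x] by simp
        then have "\<bar>\<psi> k x - 1\<bar>\<^sup>2 \<le> 1" by (intro power_le_one) auto
        then show "norm ((norm (\<psi> k x - 1))\<^sup>2) \<le> 1" by simp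
      qed
    qed auto
    then have "(\<lambda>k. sqrt (\<integral>x. (norm (\<psi> k x - 1))\<^sup>2 \<partial>?M)) \<longlonglongrightarrow> sqrt 0" by (intro tendsto_real_sqrt) simp
    then show ?thesis by (simp add: \<delta>_def[abs_def] L2_norm_def)
  qed
  define h where "h k t = L2_inner ?M (\<eta> t) (\<psi> k)" for k t
  define J where "J t = L2_inner ?M (\<eta> t) (\<lambda>_. 1)" for t
  have hJ: "\<bar>h k t - J t\<bar> \<le> L2_norm ?M (\<eta> t) * \<delta> k" if "t \<in> {0..T}" for k t
    unfolding h_def J_def \<delta>_def L2_inner_diff_right[OF eta[OF that] pL one, symmetric]
    by (rule L2_inner_Cauchy_Schwarz(2)[OF eta[OF that] L2_diff[OF pL one]])
  have hc: "continuous_on {0..T} (h k)" for k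
    unfolding continuous_on_def
  proof
    fix t assume t: "t \<in> {0..T}"
    show "(h k \<longlongrightarrow> h k t) (at t within {0..T})"
    proof (rule Lim_null[THEN iffD2], rule Lim_null_comparison)
      let ?d = "\<lambda>s. dual_norm (H10 \<Omega>) (H1_norm \<Omega>) (\<lambda>\<psi>. L2_inner ?M (\<eta> s) \<psi> - L2_inner ?M (\<eta> t) \<psi>)"
      show "\<forall>\<^sub>F s in at t within {0..T}. norm (h k s - h k t) \<le> ?d s * (H1_norm \<Omega> (\<psi> k) + 1)"
        unfolding eventually_at_filter
        using dual_norm_bound[OF eta eta[OF t] p(1)[of k]] by (intro always_eventually) (simp add: h_def)
      show "((\<lambda>s. ?d s * (H1_norm \<Omega> (\<psi> k) + 1)) \<longlongrightarrow> 0) (at t within {0..T})"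
        using tendsto_mult_right[OF cont[OF t]] by simp
    qed
  qed
  \<comment> \<open>The bound on \<open>\<eta> t\<close> holds only for almost every
    \<open>t\<close>, so \<open>hJ\<close> is not yet uniform in time. The difference of two
    pairings, however, is continuous in \<open>t\<close>, and an a.e. bound on it holds at every
    time.\<close>
  have cauchy: "\<bar>h k t - h l t\<bar> \<le> \<bar>C\<bar> * (\<delta> k + \<delta> l)" if t: "t \<in> {0..T}" for k l t
  proof (rule continuous_AE_le_interval[OF T _ _ t])
    show "continuous_on {0..T} (\<lambda>t. \<bar>h k t - h l t\<bar>)" by (intro continuous_intros hc)
    have "AE t in lebesgue_on {0..T}. t \<in> {0..T}" by (rule AE_I2) simp
    with bd show "AE t in lebesgue_on {0..T}. \<bar>h k t - h l t\<bar> \<le> \<bar>C\<bar> * (\<delta> k + \<delta> l)"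
    proof eventually_elim
      case (elim t)
      have b: "L2_norm ?M (\<eta> t) * \<delta> k \<le> \<bar>C\<bar> * \<delta> k" for k
        using elim by (intro mult_right_mono) (auto simp: \<delta>_def)
      have "\<bar>h k t - h l t\<bar> \<le> \<bar>h k t - J t\<bar> + \<bar>h l t - J t\<bar>" by linarith
      also have "\<dots> \<le> \<bar>C\<bar> * \<delta> k + \<bar>C\<bar> * \<delta> l"
        using hJ[OF elim(2), of k] hJ[OF elim(2), of l] b[of k] b[of l] by linarith
      finally show ?case by (simp add: distrib_left)
    qed
  qed
  \<comment> \<open>Letting \<open>l\<close> tend to infinity at a fixed time makes the Cauchy
    estimate a uniform one. For this limit it is enough that \<open>L2_norm ?M (\<eta> t)\<close>
    does not depend on \<open>l\<close>.\<close>
  have unif: "\<bar>h k t - J t\<bar> \<le> \<bar>C\<bar> * \<delta> k" if t: "t \<in> {0..T}" for k t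
  proof -
    have "(\<lambda>l. h l t - J t) \<longlonglongrightarrow> 0"
    proof (rule Lim_null_comparison)
      show "\<forall>\<^sub>F l in sequentially. norm (h l t - J t) \<le> L2_norm ?M (\<eta> t) * \<delta> l"
        using hJ[OF t] by (intro always_eventually) simp
      show "(\<lambda>l. L2_norm ?M (\<eta> t) * \<delta> l) \<longlonglongrightarrow> 0" using tendsto_mult_left[OF d0] by simp
    qed
    then have lim: "(\<lambda>l. h l t) \<longlonglongrightarrow> J t" by (simp add: Lim_null[symmetric])
    have "(\<lambda>l. \<bar>h k t - h l t\<bar>) \<longlonglongrightarrow> \<bar>h k t - J t\<bar>" by (intro tendsto_intros lim)
    moreover have "(\<lambda>l. \<bar>C\<bar> * (\<delta> k + \<delta> l)) \<longlonglongrightarrow> \<bar>C\<bar> * (\<delta> k + 0)" by (intro tendsto_intros d0)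
    ultimately have "\<bar>h k t - J t\<bar> \<le> \<bar>C\<bar> * (\<delta> k + 0)"
      by (rule LIMSEQ_le) (use cauchy[OF t, of k] in auto)
    then show ?thesis by simp
  qed
  have "uniform_limit {0..T} h J sequentially"
  proof (rule uniform_limitI)
    fix e :: real assume "e > 0"
    have "(\<lambda>k. \<bar>C\<bar> * \<delta> k) \<longlonglongrightarrow> 0" using tendsto_mult_left[OF d0] by simp
    then have "\<forall>\<^sub>F k in sequentially. \<bar>C\<bar> * \<delta> k < e" using \<open>e > 0\<close> by (rule order_tendstoD(2))
    then show "\<forall>\<^sub>F k in sequentially. \<forall>t\<in>{0..T}. dist (h k t) (J t) < e"
    proof eventually_elim
      case (elim k)
      show ?case
      proof
        fix t assume t: "t \<in> {0..T}"
        show "dist (h k t) (J t) < e" using unif[OF t, of k] elim by (simp add: dist_real_def)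
      qed
    qed
  qed
  then have "continuous_on {0..T} J"
    by (rule uniform_limit_theorem[rotated]) (auto intro!: always_eventually hc)
  then show ?thesis by (simp add: J_def[abs_def])
qed

text \<open>Pairing with the identity matrix takes the trace, which symmetrisation does not
  change.\<close>

lemma sym_grad_inner_ident:
  "AE x in lebesgue_on \<Omega>. sym_grad \<Omega> v x \<bullet> sym_grad \<Omega> (\<lambda>x. x) x = wdiv \<Omega> v x"
proof -
  have "AE x in lebesgue_on \<Omega>. \<forall>i\<in>UNIV. wpartial \<Omega> i (\<lambda>x. x) x = axis i 1"
    by (intro AE_finite_allI) (auto intro: wpartial_ident)
  then show ?thesis
  proof eventually_elim
    case (elim x)
    have "wjacobian \<Omega> (\<lambda>x. x) x = mat 1"
      using elim by (simp add: wjacobian_def vec_eq_iff mat_def axis_def)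
    then have "sym_grad \<Omega> (\<lambda>x. x) x = mat 1"
      by (simp add: sym_grad_def transpose_mat flip: scaleR_2)
    moreover have "A \<bullet> mat 1 = (\<Sum>i\<in>UNIV. A $ i $ i)" for A :: "real^'n^'n"
      by (simp add: inner_vec_def mat_def if_distrib cong: if_cong)
    ultimately show ?case
      by (simp add: sym_grad_def wjacobian_def transpose_def wdiv_def)
  qed
qed

lemma wdiv_ident: "AE x in lebesgue_on \<Omega>. wdiv \<Omega> (\<lambda>x. x) x = real CARD('n)"
proof -
  have "AE x in lebesgue_on \<Omega>. \<forall>i\<in>UNIV. wpartial \<Omega> i (\<lambda>x. x) x = axis i 1"
    by (intro AE_finite_allI) (auto intro: wpartial_ident)
  then show ?thesis
    by eventually_elim (simp add: wdiv_def)
qed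

lemma wgrad_const: "AE x in lebesgue_on \<Omega>. wgrad \<Omega> (\<lambda>_. c) x = 0"
proof -
  have "AE x in lebesgue_on \<Omega>. \<forall>i\<in>UNIV. wpartial \<Omega> i (\<lambda>_. c) x = 0"
    by (intro AE_finite_allI) (auto intro: wpartial_const)
  then show ?thesis
    by eventually_elim (simp add: wgrad_def vec_eq_iff)
qed

end

text \<open>The relation for \<open>\<eta>\<close> holds at every time because \<open>\<eta>\<close>
  is the continuous representative; the other unknowns are determined only up to null sets of times.
  A trace is determined up to null sets of the surface measure, hence the flux is taken for every
  trace \<open>w\<close> of \<open>u t\<close>.\<close>

theorem lemma2p7:
  fixes \<Omega> :: "(real^'n) set"
    and T lam \<mu> \<alpha> c0 \<mu>f :: real
    and K :: "real^'n \<Rightarrow> real^'n^'n"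
    and \<rho>f \<phi> \<phi>1 p0 :: "real^'n \<Rightarrow> real"
    and grav f f1 u0 :: "real^'n \<Rightarrow> real^'n"
    and u :: "real \<Rightarrow> real^'n \<Rightarrow> real^'n"
    and \<xi> \<eta> p q :: "real \<Rightarrow> real^'n \<Rightarrow> real"
  assumes dim: "CARD('n) \<in> {1, 2, 3}"
    and dom: "polygonal_domain \<Omega>" "laplacian_isomorphism \<Omega>"
    and T: "T > 0"
    and params: "lam > 0" "\<mu> > 0" "\<alpha> > 0" "c0 \<ge> 0" "\<mu>f > 0"
    and K_meas: "K \<in> borel_measurable (lebesgue_on \<Omega>)" "\<exists>B. \<forall>x\<in>\<Omega>. norm (K x) \<le> B"
    and K_spd: "\<And>x. x \<in> \<Omega> \<Longrightarrow> transpose (K x) = K x"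
      "\<And>x z. x \<in> \<Omega> \<Longrightarrow> z \<noteq> 0 \<Longrightarrow> (K x *v z) \<bullet> z > 0"
    and rho: "\<not> (AE x in lebesgue_on \<Omega>. \<rho>f x = 0)"
      "(\<lambda>x. \<rho>f x *\<^sub>R grav x) \<in> L2 (lebesgue_on \<Omega>)"
    and data: "f \<in> L2 (lebesgue_on \<Omega>)" "f1 \<in> L2 (surface_measure \<Omega>)"
      "\<phi> \<in> L2 (lebesgue_on \<Omega>)" "\<phi>1 \<in> L2 (surface_measure \<Omega>)"
      "u0 \<in> H1 \<Omega>" "p0 \<in> L2 (lebesgue_on \<Omega>)"
    and compat: "\<And>v. v \<in> RM \<Longrightarrow>
      L2_inner (lebesgue_on \<Omega>) f v + L2_inner (surface_measure \<Omega>) f1 v = 0"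
    and sol: "weak_solution \<Omega> T lam \<mu> \<alpha> c0 \<mu>f K \<rho>f grav f f1 \<phi> \<phi>1 u0 p0 u \<xi> \<eta> p q"
  shows "let M = lebesgue_on \<Omega>; S = surface_measure \<Omega>; d = real CARD('n);
             \<kappa>1 = kappa1 \<alpha> lam c0; \<kappa>2 = kappa2 \<alpha> lam c0; \<kappa>3 = kappa3 \<alpha> lam c0;
             \<eta>0 = (\<lambda>x. c0 * p0 x + \<alpha> * wdiv \<Omega> u0 x);
             C\<eta> = (\<lambda>t. L2_inner M (\<eta> t) (\<lambda>_. 1));
             C\<xi> = (\<lambda>t. L2_inner M (\<xi> t) (\<lambda>_. 1));
             Cq = (\<lambda>t. L2_inner M (q t) (\<lambda>_. 1));
             Cp = (\<lambda>t. L2_inner M (p t) (\<lambda>_. 1))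
         in
           (\<forall>t\<in>{0..T}. C\<eta> t = L2_inner M \<eta>0 (\<lambda>_. 1)
              + (L2_inner M \<phi> (\<lambda>_. 1) + L2_inner S \<phi>1 (\<lambda>_. 1)) * t) \<and>
           (AE t in lebesgue_on {0..T}.
              C\<xi> t = 1 / (d + \<mu> * \<kappa>3) *
                (\<mu> * \<kappa>1 * C\<eta> t - L2_inner M f (\<lambda>x. x) - L2_inner S f1 (\<lambda>x. x)) \<and>
              Cq t = \<kappa>1 * C\<eta> t - \<kappa>3 * C\<xi> t \<and>
              Cp t = \<kappa>1 * C\<xi> t + \<kappa>2 * C\<eta> t \<and>
              (\<forall>w. has_trace \<Omega> (u t) w \<longrightarrow>
                 L2_inner S (\<lambda>x. w x \<bullet> outward_normal \<Omega> x) (\<lambda>_. 1) = Cq t))"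
proof -
  obtain AA where "arrangement \<Omega> AA" using polygonal_domain_arrangement[OF dom(1)] by blast
  then interpret polygonal_arrangement \<Omega> AA by (simp add: polygonal_arrangement_def)
  define M where "M = lebesgue_on \<Omega>"
  define S where "S = surface_measure \<Omega>"
  define J where "J = lebesgue_on {0..T}"
  define \<kappa>1 \<kappa>2 \<kappa>3 where "\<kappa>1 = kappa1 \<alpha> lam c0" and "\<kappa>2 = kappa2 \<alpha> lam c0" and "\<kappa>3 = kappa3 \<alpha> lam c0"
  define one :: "real^'n \<Rightarrow> real" where "one = (\<lambda>_. 1)"
  define pos :: "real^'n \<Rightarrow> real^'n" where "pos = (\<lambda>x. x)"
  note defs = M_def[symmetric] S_def[symmetric] J_def[symmetric] \<kappa>1_def[symmetric] \<kappa>2_def[symmetric]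
    \<kappa>3_def[symmetric] one_def[symmetric] pos_def[symmetric]
  note s1 = sol[unfolded weak_solution_def Let_def defs]
  note u_in = s1[THEN conjunct1] note s2 = s1[THEN conjunct2]
  note xi_in = s2[THEN conjunct1] note s3 = s2[THEN conjunct2]
  note eta_in = s3[THEN conjunct1] note s4 = s3[THEN conjunct2, THEN conjunct2]
  note eta_cont = s4[THEN conjunct1] note s5 = s4[THEN conjunct2, THEN conjunct2, THEN conjunct2]
  note eq1 = s5[THEN conjunct1] note s6 = s5[THEN conjunct2]
  note eq2 = s6[THEN conjunct1] note s7 = s6[THEN conjunct2]
  note eq3 = s7[THEN conjunct1] note s8 = s7[THEN conjunct2]
  note p_eq = s8[THEN conjunct1] note s9 = s8[THEN conjunct2]
  note q_eq = s9[THEN conjunct1]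
  note eta_0 = s9[THEN conjunct2, THEN conjunct2, THEN conjunct2, THEN conjunct2]
  have dl: "\<Omega> \<in> sets lebesgue" by simp
  have one_tr: "has_trace \<Omega> one one" "one \<in> H1 \<Omega>" "one \<in> L2 M"
    using smooth_has_trace[OF smooth_const[of "1::real"]] by (auto simp: one_def has_trace_def H1_def M_def)
  have pos_tr: "has_trace \<Omega> pos pos" "pos \<in> H1 \<Omega>"
    using smooth_has_trace[OF smooth_ident] by (auto simp: pos_def has_trace_def)
  have inner_one: "L2_inner N g one = (\<integral>x. g x \<partial>N)" for N g
    by (simp add: L2_inner_def one_def)
  define D where "D = L2_inner M \<phi> one + L2_inner S \<phi>1 one"
  have eta_L2: "\<eta> t \<in> L2 M" if "t \<in> {0..T}" for t using eta_cont that by blast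
  have C\<eta>: "L2_inner M (\<eta> t) one = L2_inner M (\<eta> 0) one + D * t" if t: "t \<in> {0..T}" for t
  proof (rule weak_derivative_constant_imp_affine[OF T _ _ t])
    have "\<exists>C. AE t in J. L2_norm M (\<eta> t) \<le> C"
      using eta_in unfolding Linf_time_def J_def by blast
    then obtain C where C: "AE t in J. L2_norm M (\<eta> t) \<le> C" by blast
    show "continuous_on {0..T} (\<lambda>t. L2_inner M (\<eta> t) one)"
      unfolding M_def one_def
    proof (rule mean_continuous[OF T])
      show "\<eta> t \<in> L2 (lebesgue_on \<Omega>)" if "t \<in> {0..T}" for t using eta_L2[OF that] by (simp only: M_def)
      show "AE t in lebesgue_on {0..T}. L2_norm (lebesgue_on \<Omega>) (\<eta> t) \<le> C" using C unfolding J_def M_def .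
    qed (use eta_cont in \<open>unfold M_def, blast\<close>)
    obtain \<eta>t where wk: "weak_time_deriv T (H1 \<Omega>) (\<lambda>t. L2_inner M (\<eta> t)) \<eta>t"
      and ae: "AE t in J. \<forall>\<psi>\<in>H1 \<Omega>. \<forall>t\<psi>. has_trace \<Omega> \<psi> t\<psi> \<longrightarrow>
            \<eta>t t \<psi> + 1 / \<mu>f * L2_inner M
              (\<lambda>x. K x *v (wgrad \<Omega> (\<lambda>y. \<kappa>1 * \<xi> t y + \<kappa>2 * \<eta> t y) x - \<rho>f x *\<^sub>R grav x))
              (wgrad \<Omega> \<psi>)
            = L2_inner M \<phi> \<psi> + L2_inner S \<phi>1 t\<psi>"
      using eq3 by blast
    \<comment> \<open>The gradient of 1 is a chosen representative that is 0 almost everywhere,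
      which is enough for the diffusion term to drop out.\<close>
    have g0: "L2_inner M F (wgrad \<Omega> one) = 0" for F
      unfolding L2_inner_def M_def
      by (rule integral_eq_zero_AE) (use wgrad_const[of 1] in \<open>eventually_elim, simp add: one_def\<close>)
    have aeD: "AE t in J. \<eta>t t one = D"
      using ae
    proof eventually_elim
      case (elim t)
      from elim[rule_format, OF one_tr(2,1)] show ?case by (simp add: g0 D_def)
    qed
    fix \<zeta> assume z: "test_function {0<..<T} \<zeta>"
    have "(\<integral>t. deriv \<zeta> t * L2_inner M (\<eta> t) one \<partial>J) = - (\<integral>t. \<zeta> t * \<eta>t t one \<partial>J)"
      using wk one_tr(2) z unfolding weak_time_deriv_def J_def by blast
    also have "(\<integral>t. \<zeta> t * \<eta>t t one \<partial>J) = (\<integral>t. \<zeta> t * D \<partial>J)"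
      unfolding J_def
    proof (rule integral_cong_AE_lebesgue_on)
      show "AE t in lebesgue_on {0..T}. \<zeta> t * \<eta>t t one = \<zeta> t * D"
        using aeD unfolding J_def by eventually_elim simp
    qed simp
    finally show "(\<integral>t. deriv \<zeta> t * L2_inner M (\<eta> t) one \<partial>lebesgue_on {0..T}) = - (\<integral>t. \<zeta> t * D \<partial>lebesgue_on {0..T})"
      by (simp only: J_def)
  qed
  have C\<eta>0: "L2_inner M (\<eta> 0) one = L2_inner M (\<lambda>x. c0 * p0 x + \<alpha> * wdiv \<Omega> u0 x) one"
    unfolding inner_one using eta_0 unfolding M_def by (rule integral_cong_AE_lebesgue_on[OF dl])
  have d3: "real CARD('n) + \<mu> * \<kappa>3 > 0"
    using params by (auto simp: \<kappa>3_def kappa3_def intro!: add_pos_nonneg mult_nonneg_nonneg divide_nonneg_nonneg)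
  have u_ae: "AE t in J. u t \<in> H1_perp \<Omega>" using u_in unfolding Linf_time_def J_def by blast
  have xi_ae: "AE t in J. \<xi> t \<in> L2 M" using xi_in unfolding L2_time_def J_def by blast
  have t_ae: "AE t in J. t \<in> {0..T}" unfolding J_def by (rule AE_I2) simp
  have main: "AE t in J.
      L2_inner M (\<xi> t) one = 1 / (real CARD('n) + \<mu> * \<kappa>3) *
        (\<mu> * \<kappa>1 * L2_inner M (\<eta> t) one - L2_inner M f pos - L2_inner S f1 pos) \<and>
      L2_inner M (q t) one = \<kappa>1 * L2_inner M (\<eta> t) one - \<kappa>3 * L2_inner M (\<xi> t) one \<and>
      L2_inner M (p t) one = \<kappa>1 * L2_inner M (\<xi> t) one + \<kappa>2 * L2_inner M (\<eta> t) one \<and>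
      (\<forall>w. has_trace \<Omega> (u t) w \<longrightarrow>
         L2_inner S (\<lambda>x. w x \<bullet> outward_normal \<Omega> x) one = L2_inner M (q t) one)"
    using u_ae xi_ae t_ae eq1 eq2 p_eq q_eq
  proof eventually_elim
    case (elim t)
    \<comment> \<open>The total divergence is the common quantity: \<open>e1\<close> and
      \<open>e2\<close> relate it to the mean of \<open>\<xi>\<close>, and
      \<open>trace_divergence\<close> identifies it with the boundary flux.\<close>
    define W where "W = (\<integral>x. wdiv \<Omega> (u t) x \<partial>M)"
    have ei: "integrable M (\<eta> t)" and xi: "integrable M (\<xi> t)"
      using D.L2_integrable eta_L2[OF elim(3)] elim(2) by (auto simp: M_def)
    have a: "L2_inner M (sym_grad \<Omega> (u t)) (sym_grad \<Omega> pos) = W"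
      unfolding L2_inner_def W_def M_def pos_def
      by (rule integral_cong_AE_lebesgue_on[OF dl sym_grad_inner_ident])
    have b: "L2_inner M (\<xi> t) (wdiv \<Omega> pos) = real CARD('n) * L2_inner M (\<xi> t) one"
    proof -
      have "L2_inner M (\<xi> t) (wdiv \<Omega> pos) = (\<integral>x. real CARD('n) * \<xi> t x \<partial>M)"
        unfolding L2_inner_def M_def pos_def
        by (rule integral_cong_AE_lebesgue_on[OF dl]) (use wdiv_ident in \<open>eventually_elim, simp\<close>)
      then show ?thesis by (simp add: inner_one)
    qed
    have e1: "\<mu> * W - real CARD('n) * L2_inner M (\<xi> t) one = L2_inner M f pos + L2_inner S f1 pos"
      using elim(4)[rule_format, OF pos_tr(2,1)] by (simp only: a b)
    have e2: "\<kappa>3 * L2_inner M (\<xi> t) one + W = \<kappa>1 * L2_inner M (\<eta> t) one"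
      using elim(5)[rule_format, OF one_tr(3)] by (simp add: inner_one W_def)
    have cq: "L2_inner M (q t) one = \<kappa>1 * L2_inner M (\<eta> t) one - \<kappa>3 * L2_inner M (\<xi> t) one"
    proof -
      have "(\<integral>x. q t x \<partial>M) = (\<integral>x. \<kappa>1 * \<eta> t x - \<kappa>3 * \<xi> t x \<partial>M)"
        using elim(7) unfolding M_def by (rule integral_cong_AE_lebesgue_on[OF dl])
      then show ?thesis using ei xi by (simp add: inner_one)
    qed
    have cp: "L2_inner M (p t) one = \<kappa>1 * L2_inner M (\<xi> t) one + \<kappa>2 * L2_inner M (\<eta> t) one"
    proof -
      have "(\<integral>x. p t x \<partial>M) = (\<integral>x. \<kappa>1 * \<xi> t x + \<kappa>2 * \<eta> t x \<partial>M)"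
        using elim(6) unfolding M_def by (rule integral_cong_AE_lebesgue_on[OF dl])
      then show ?thesis using ei xi by (simp add: inner_one)
    qed
    have "W = \<kappa>1 * L2_inner M (\<eta> t) one - \<kappa>3 * L2_inner M (\<xi> t) one" using e2 by simp
    note W = this
    \<comment> \<open>Eliminating \<open>W\<close> from \<open>e1\<close> collects this coefficient
      of the mean of \<open>\<xi>\<close>; it is positive by \<open>d3\<close>, which permits the
      division.\<close>
    have "(real CARD('n) + \<mu> * \<kappa>3) * L2_inner M (\<xi> t) one = \<mu> * \<kappa>1 * L2_inner M (\<eta> t) one - L2_inner M f pos - L2_inner S f1 pos"
      using e1 unfolding W by (simp add: algebra_simps)
    then have cx: "L2_inner M (\<xi> t) one = 1 / (real CARD('n) + \<mu> * \<kappa>3) *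
        (\<mu> * \<kappa>1 * L2_inner M (\<eta> t) one - L2_inner M f pos - L2_inner S f1 pos)"
      using d3 by (simp add: field_simps)
    \<comment> \<open>The second equation gives \<open>W\<close> the same expression in the means of
      \<open>\<eta>\<close> and \<open>\<xi>\<close> as the definition of \<open>q\<close> gives the
      mean of \<open>q\<close>.\<close>
    have tr: "L2_inner S (\<lambda>x. w x \<bullet> outward_normal \<Omega> x) one = L2_inner M (q t) one"
      if "has_trace \<Omega> (u t) w" for w
    proof -
      have "L2_inner S (\<lambda>x. w x \<bullet> outward_normal \<Omega> x) one = W"
        using trace_divergence[OF that] by (simp add: inner_one S_def M_def W_def)
      then show ?thesis unfolding W cq .
    qed
    show ?case using cx cq cp tr by blast
  qed
  have first: "\<forall>t\<in>{0..T}. L2_inner M (\<eta> t) one = L2_inner M (\<lambda>x. c0 * p0 x + \<alpha> * wdiv \<Omega> u0 x) one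
      + (L2_inner M \<phi> one + L2_inner S \<phi>1 one) * t"
    using C\<eta> by (simp only: C\<eta>0 D_def) blast
  show ?thesis
    unfolding Let_def defs by (intro conjI first main)
qed

end
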